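(* Let $f$ be the immersion into $\mathbb X^3\in\{\mathbb E^3,\mathbb H^3\}$ induced by an LWR frame $\Phi$ at evaluation points $(\lambda_0,\lambda_1)$. Holomorphic dressing of $\Phi$ induces a Goursat transformation of the induced immersion $f$. Moreover, any Goursat transformation of $f$ can be obtained by holomorphic dressing, provided that $f$ is not flat.
   Context: Ambient spaces. $\mathcal H_2$: $2\times2$ Hermitian matrices with $\langle x,y\rangle=-\frac12\operatorname{tr}(x\widehat y)$ ($\widehat y$ the adjugate), extended complex-bilinearly. $\mathbb H^3=\{x\in\mathcal H_2:\det x=1,\operatorname{tr}x>0\}$; $\mathbb E^3=T_{\mathrm I}\mathbb H^3$ = trace-free Hermitian matrices, oriented so that $(x,y,-\frac i2[x,y])$ is positive; the orientation is transported to $\mathbb H^3$ by $x\mapsto VxV^*$, $V\in \mathrm{SL}_2\mathbb C$. For a conformal immersion $f$ ($\langle f_z,f_z\rangle=0$): metric $ds^2=2\langle f_z,f_{\bar z}\rangle|dz|^2$, unit normal $N$ with $(f_x,f_y,N)$ positively oriented orthogonal, Hopf differential $Q\,dz^2$ and mean curvature $H$ defined by $-\langle df,dN\rangle=Q\,dz^2+H\,ds^2+\bar Q\,d\bar z^2$; minimal: $H\equiv0$ in $\mathbb E^3$; CMC 1: $H\equiv1$ in $\mathbb H^3$. Such an $f$ is flat if $Q\equiv0$. LWR potential on a Riemann surface $\Sigma$: family $\xi_\lambda$ ($\lambda\in\mathbb C$) of meromorphic $\mathrm{sl}_2\mathbb C$-valued 1-forms, locally away from poles $\xi_\lambda=(A\lambda+B)dz$,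 $A,B$ holomorphic in $z$, $A$ nilpotent. LWR frame: $\mathrm{SL}_2\mathbb C$-valued $\Phi_\lambda$ (on the universal cover of $\Sigma$), holomorphic in $z$ and in $\lambda\in\mathbb C$, with $\Phi^{-1}d\Phi=\xi$. Induced immersions at $(\lambda_0,\lambda_1)$, $\lambda_0\ne\lambda_1$: $f^{\mathbb E}=\psi+\psi^*$, $\psi=(\lambda_1-\lambda_0)(\dot\Phi\Phi^{-1})_{\lambda_0}$ (dot $=\partial_\lambda$), minimal in $\mathbb E^3$; $f^{\mathbb H}=\Psi^*\Psi$, $\Psi=\Phi_{\lambda_1}\Phi_{\lambda_0}^{-1}$, CMC 1 in $\mathbb H^3$. Holomorphic dressing: the map $\Phi\mapsto R\Phi$ on LWR frames, where $R=R_\lambda\in\mathrm{SL}_2\mathbb C$ is independent of $z$ and holomorphic in $\lambda\in\mathbb C$; the dressed immersion is the one induced by $R\Phi$ at the same $(\lambda_0,\lambda_1)$. Gauss map: with $\mathrm{St}$ from the unit sphere of $\mathbb E^3$ to $\mathbb C\cup\{\infty\}$ given by $\mathrm{St}^{-1}(u/v)=\mathrm I-2\|\nu\|^{-2}\nu\nu^*$, $\nu=(u,v)$, the Gauss map is $G=\mathrm{St}(N)$ in $\mathbb E^3$ and $G=\mathrm{St}\big(\frac{2(f+N)}{\operatorname{tr}(f+N)}-\mathrm I\big)$ in $\mathbb H^3$ (hyperbolic Gauss map). Goursat transformation: two minimal or CMC 1 immersions are related by a Goursat transformation if they have the same Hopf differential and the Schwarzian derivatives of their Gauss maps are equal, where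 $\mathcal S[g]=\big(\frac{g''}{2g'}\big)^2-\big(\frac{g''}{2g'}\big)'$. *)

theory Defs
  imports "HOL-Complex_Analysis.Complex_Analysis"
begin

section \<open>Matrices and the ambient spaces\<close>

type_synonym mat2 = "complex^2^2"

definition cscale :: "complex \<Rightarrow> mat2 \<Rightarrow> mat2" where
  "cscale a A = map_matrix ((*) a) A"

definition ctranspose :: "mat2 \<Rightarrow> mat2" where
  "ctranspose A = map_matrix cnj (transpose A)"

definition adjugate :: "mat2 \<Rightarrow> mat2" where
  "adjugate A = vector [vector [A$2$2, - A$1$2], vector [- A$2$1, A$1$1]]"

definition commutator :: "mat2 \<Rightarrow> mat2 \<Rightarrow> mat2" where
  "commutator A B = A ** B - B ** A"

definition nilpotent_mat :: "mat2 \<Rightarrow> bool" where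
  "nilpotent_mat A \<longleftrightarrow> (\<exists>n. (((**) A) ^^ n) (mat 1) = 0)"

definition hermitian :: "mat2 \<Rightarrow> bool" where
  "hermitian A \<longleftrightarrow> ctranspose A = A"

text \<open>The complex-bilinear extension of the Minkowski product on the Hermitian matrices to all
  complex matrices.\<close>

definition minner :: "mat2 \<Rightarrow> mat2 \<Rightarrow> complex" where
  "minner x y = - trace (x ** adjugate y) / 2"

datatype ambient = Euclidean | Hyperbolic

fun ambient_space :: "ambient \<Rightarrow> mat2 set" where
  "ambient_space Euclidean = {x. hermitian x \<and> trace x = 0}"
| "ambient_space Hyperbolic = {x. hermitian x \<and> det x = 1 \<and> Re (trace x) > 0}"

text \<open>A triple of trace-free Hermitian matrices is positive if it is a basis in the orientation
  class of the triples \<open>(x, y, -i/2 [x,y])\<close>; \<open>M\<close> is the matrix of the change of basis.\<close>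

definition positive_triple0 :: "mat2 \<Rightarrow> mat2 \<Rightarrow> mat2 \<Rightarrow> bool" where
  "positive_triple0 a b c \<longleftrightarrow>
     (\<exists>x y w. \<exists>M :: real^3^3.
        x \<in> ambient_space Euclidean \<and> y \<in> ambient_space Euclidean \<and>
        x \<noteq> y \<and> independent {x, y} \<and> w = cscale (- \<i> / 2) (commutator x y) \<and> det M > 0 \<and>
        a = M$1$1 *\<^sub>R x + M$1$2 *\<^sub>R y + M$1$3 *\<^sub>R w \<and>
        b = M$2$1 *\<^sub>R x + M$2$2 *\<^sub>R y + M$2$3 *\<^sub>R w \<and>
        c = M$3$1 *\<^sub>R x + M$3$2 *\<^sub>R y + M$3$3 *\<^sub>R w)"

text \<open>Orientation of the tangent space at the point \<open>q\<close>. In the hyperbolic case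
  \<open>q = V V\<^sup>*\<close> is the image of the identity under \<open>x \<mapsto> V x V\<^sup>*\<close>, and the triple is in particular
  tangent at \<open>q\<close>.\<close>

fun positive_triple :: "ambient \<Rightarrow> mat2 \<Rightarrow> mat2 \<Rightarrow> mat2 \<Rightarrow> mat2 \<Rightarrow> bool" where
  "positive_triple Euclidean q a b c \<longleftrightarrow> positive_triple0 a b c"
| "positive_triple Hyperbolic q a b c \<longleftrightarrow>
     (\<exists>V a' b' c'. det V = 1 \<and> q = V ** ctranspose V \<and> positive_triple0 a' b' c' \<and>
        a = V ** a' ** ctranspose V \<and> b = V ** b' ** ctranspose V \<and> c = V ** c' ** ctranspose V)"


section \<open>Riemann surfaces\<close>

text \<open>A chart is its domain together with its coordinate function. A Riemann surface is a set in
  a Hausdorff space, with the subspace topology, together with a holomorphic atlas. Second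
  countability is automatic by Rado's theorem.\<close>

type_synonym 'a chart = "'a set \<times> ('a \<Rightarrow> complex)"

definition in_chart :: "'a chart \<Rightarrow> ('a \<Rightarrow> 'c) \<Rightarrow> complex \<Rightarrow> 'c" where
  "in_chart c h = h \<circ> inv_into (fst c) (snd c)"

definition riemann_surface :: "'a::t2_space set \<Rightarrow> 'a chart set \<Rightarrow> bool" where
  "riemann_surface S \<A> \<longleftrightarrow>
     S \<noteq> {} \<and> connected S \<and> (\<Union>c\<in>\<A>. fst c) = S \<and>
     (\<forall>(U, z)\<in>\<A>. openin (top_of_set S) U \<and> open (z ` U) \<and>
                  homeomorphism U (z ` U) z (inv_into U z)) \<and>
     (\<forall>(U, z)\<in>\<A>. \<forall>(U', z')\<in>\<A>. in_chart (U, z) z' holomorphic_on z ` (U \<inter> U'))"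

definition universal_covering ::
  "'b::t2_space set \<Rightarrow> ('b \<Rightarrow> 'a::t2_space) \<Rightarrow> 'a set \<Rightarrow> bool" where
  "universal_covering T \<pi> S \<longleftrightarrow> covering_space T \<pi> S \<and> simply_connected T"

definition lifted_domain ::
  "'b::t2_space set \<Rightarrow> ('b \<Rightarrow> 'a) \<Rightarrow> 'a chart \<Rightarrow> 'b set \<Rightarrow> bool" where
  "lifted_domain T \<pi> c V \<longleftrightarrow> openin (top_of_set T) V \<and> inj_on \<pi> V \<and> \<pi> ` V \<subseteq> fst c"

text \<open>The complex structure that makes the covering map \<open>\<pi>\<close> locally biholomorphic.\<close>

definition lifted_atlas ::
  "'b::t2_space set \<Rightarrow> ('b \<Rightarrow> 'a) \<Rightarrow> 'a chart set \<Rightarrow> 'b chart set" where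
  "lifted_atlas T \<pi> \<A> = {(V, snd c \<circ> \<pi>) | c V. c \<in> \<A> \<and> lifted_domain T \<pi> c V}"


section \<open>Derivatives in charts\<close>

definition holomorphic_mat_on :: "(complex \<Rightarrow> mat2) \<Rightarrow> complex set \<Rightarrow> bool" where
  "holomorphic_mat_on F W \<longleftrightarrow> (\<forall>i j. (\<lambda>w. F w $ i $ j) holomorphic_on W)"

definition deriv_mat :: "(complex \<Rightarrow> mat2) \<Rightarrow> complex \<Rightarrow> mat2" where
  "deriv_mat F w = (\<chi> i j. deriv (\<lambda>u. F u $ i $ j) w)"

text \<open>Real differentiability of class \<open>C\<^sup>n\<close> on an open subset of the plane.\<close>

fun Ck_on :: "nat \<Rightarrow> (complex \<Rightarrow> mat2) \<Rightarrow> complex set \<Rightarrow> bool" where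
  "Ck_on 0 F W \<longleftrightarrow> continuous_on W F"
| "Ck_on (Suc n) F W \<longleftrightarrow>
     (\<forall>w\<in>W. F differentiable at w) \<and>
     Ck_on n (\<lambda>w. frechet_derivative F (at w) 1) W \<and>
     Ck_on n (\<lambda>w. frechet_derivative F (at w) \<i>) W"

definition dx :: "'b chart \<Rightarrow> ('b \<Rightarrow> mat2) \<Rightarrow> 'b \<Rightarrow> mat2" where
  "dx c f p = frechet_derivative (in_chart c f) (at (snd c p)) 1"

definition dy :: "'b chart \<Rightarrow> ('b \<Rightarrow> mat2) \<Rightarrow> 'b \<Rightarrow> mat2" where
  "dy c f p = frechet_derivative (in_chart c f) (at (snd c p)) \<i>"

definition dz :: "'b chart \<Rightarrow> ('b \<Rightarrow> mat2) \<Rightarrow> 'b \<Rightarrow> mat2" where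
  "dz c f p = cscale (1/2) (dx c f p - cscale \<i> (dy c f p))"

definition dzbar :: "'b chart \<Rightarrow> ('b \<Rightarrow> mat2) \<Rightarrow> 'b \<Rightarrow> mat2" where
  "dzbar c f p = cscale (1/2) (dx c f p + cscale \<i> (dy c f p))"


section \<open>Surface theory\<close>

text \<open>Below, \<open>\<B>\<close> is the atlas of the Riemann surface on which the maps are defined.\<close>

definition immersion :: "'b chart set \<Rightarrow> ('b \<Rightarrow> mat2) \<Rightarrow> bool" where
  "immersion \<B> f \<longleftrightarrow>
     (\<forall>c\<in>\<B>. (\<forall>n. Ck_on n (in_chart c f) (snd c ` fst c)) \<and>
            (\<forall>p\<in>fst c. inj (frechet_derivative (in_chart c f) (at (snd c p)))))"

definition conformal_immersion :: "ambient \<Rightarrow> 'b chart set \<Rightarrow> ('b \<Rightarrow> mat2) \<Rightarrow> bool" where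
  "conformal_immersion X \<B> f \<longleftrightarrow>
     immersion \<B> f \<and>
     (\<forall>c\<in>\<B>. \<forall>p\<in>fst c. f p \<in> ambient_space X \<and> minner (dz c f p) (dz c f p) = 0)"

definition unit_normal :: "ambient \<Rightarrow> 'b chart set \<Rightarrow> ('b \<Rightarrow> mat2) \<Rightarrow> 'b \<Rightarrow> mat2" where
  "unit_normal X \<B> f p =
     (THE n. \<forall>c\<in>\<B>. p \<in> fst c \<longrightarrow>
        minner (dx c f p) n = 0 \<and> minner (dy c f p) n = 0 \<and> minner n n = 1 \<and>
        positive_triple X (f p) (dx c f p) (dy c f p) n)"

text \<open>The coefficients of \<open>- \<langle>df, dN\<rangle> = Q dz\<^sup>2 + H ds\<^sup>2 + cnj Q dzbar\<^sup>2\<close> with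
  \<open>ds\<^sup>2 = 2 \<langle>f_z, f_zbar\<rangle> dz dzbar\<close>, obtained by inserting \<open>df = f_z dz + f_zbar dzbar\<close>
  and \<open>dN = N_z dz + N_zbar dzbar\<close> and comparing the \<open>dz\<^sup>2\<close> and the \<open>dz dzbar\<close> terms.\<close>

definition hopf :: "ambient \<Rightarrow> 'b chart set \<Rightarrow> ('b \<Rightarrow> mat2) \<Rightarrow> 'b chart \<Rightarrow> 'b \<Rightarrow> complex" where
  "hopf X \<B> f c p = - minner (dz c f p) (dz c (unit_normal X \<B> f) p)"

definition mean_curvature ::
  "ambient \<Rightarrow> 'b chart set \<Rightarrow> ('b \<Rightarrow> mat2) \<Rightarrow> 'b chart \<Rightarrow> 'b \<Rightarrow> complex" where
  "mean_curvature X \<B> f c p =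
     - (minner (dz c f p) (dzbar c (unit_normal X \<B> f) p) +
        minner (dzbar c f p) (dz c (unit_normal X \<B> f) p)) /
     (2 * minner (dz c f p) (dzbar c f p))"

definition flat :: "ambient \<Rightarrow> 'b chart set \<Rightarrow> ('b \<Rightarrow> mat2) \<Rightarrow> bool" where
  "flat X \<B> f \<longleftrightarrow> (\<forall>c\<in>\<B>. \<forall>p\<in>fst c. hopf X \<B> f c p = 0)"

text \<open>Minimal immersions into Euclidean space and CMC 1 immersions into hyperbolic space.\<close>

definition minimal_or_cmc1 :: "ambient \<Rightarrow> 'b chart set \<Rightarrow> ('b \<Rightarrow> mat2) \<Rightarrow> bool" where
  "minimal_or_cmc1 X \<B> f \<longleftrightarrow>
     conformal_immersion X \<B> f \<and>
     (\<forall>c\<in>\<B>. \<forall>p\<in>fst c.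
        mean_curvature X \<B> f c p = (case X of Euclidean \<Rightarrow> 0 | Hyperbolic \<Rightarrow> 1))"

text \<open>The Riemann sphere is \<open>complex option\<close>, with \<open>None\<close> for the point at infinity.\<close>

definition sphere_quotient :: "complex \<Rightarrow> complex \<Rightarrow> complex option" where
  "sphere_quotient u v = (if v = 0 then None else Some (u / v))"

definition St :: "mat2 \<Rightarrow> complex option" where
  "St x = (THE g. \<exists>\<nu>::complex^2. \<nu> \<noteq> 0 \<and> g = sphere_quotient (\<nu>$1) (\<nu>$2) \<and>
             x = mat 1 - (2 / (norm \<nu>)\<^sup>2) *\<^sub>R (\<chi> i j. \<nu>$i * cnj (\<nu>$j)))"

fun gauss_map :: "ambient \<Rightarrow> 'b chart set \<Rightarrow> ('b \<Rightarrow> mat2) \<Rightarrow> 'b \<Rightarrow> complex option" where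
  "gauss_map Euclidean \<B> f p = St (unit_normal Euclidean \<B> f p)"
| "gauss_map Hyperbolic \<B> f p =
     (let m = f p + unit_normal Hyperbolic \<B> f p in St (cscale (2 / trace m) m - mat 1))"

definition schwarzian :: "(complex \<Rightarrow> complex) \<Rightarrow> complex \<Rightarrow> complex" where
  "schwarzian g w =
     (deriv (deriv g) w / (2 * deriv g w))\<^sup>2 - deriv (\<lambda>u. deriv (deriv g) u / (2 * deriv g u)) w"

text \<open>Equality of the Schwarzian derivatives as meromorphic functions in every chart: they agree
  wherever both maps are finite and unramified. The Schwarzian derivative of a constant map is
  undefined, and the condition is then void. This does no harm in the definition of Goursat
  transformations below: the Gauss map of a minimal or CMC 1 immersion is constant if and only if
  the Hopf differential, which is required to be the same, vanishes identically.\<close>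

definition same_schwarzian ::
  "'b chart set \<Rightarrow> ('b \<Rightarrow> complex option) \<Rightarrow> ('b \<Rightarrow> complex option) \<Rightarrow> bool" where
  "same_schwarzian \<B> G G' \<longleftrightarrow>
     (\<forall>c\<in>\<B>. \<forall>p\<in>fst c.
        let g = in_chart c (\<lambda>q. the (G q)); g' = in_chart c (\<lambda>q. the (G' q)); w = snd c p in
        G p \<noteq> None \<and> G' p \<noteq> None \<and> deriv g w \<noteq> 0 \<and> deriv g' w \<noteq> 0 \<longrightarrow>
        schwarzian g w = schwarzian g' w)"

definition goursat_related ::
  "ambient \<Rightarrow> 'b chart set \<Rightarrow> ('b \<Rightarrow> mat2) \<Rightarrow> ('b \<Rightarrow> mat2) \<Rightarrow> bool" where
  "goursat_related X \<B> f f' \<longleftrightarrow>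
     minimal_or_cmc1 X \<B> f \<and> minimal_or_cmc1 X \<B> f' \<and>
     (\<forall>c\<in>\<B>. \<forall>p\<in>fst c. hopf X \<B> f c p = hopf X \<B> f' c p) \<and>
     same_schwarzian \<B> (gauss_map X \<B> f) (gauss_map X \<B> f')"


section \<open>LWR potentials, frames and dressing\<close>

text \<open>A family of 1-forms is given by its coefficients: \<open>\<xi> l c p\<close> is the coefficient, with
  respect to the coordinate of the chart \<open>c\<close>, of the form with parameter \<open>l\<close> at the point \<open>p\<close>.
  The closed discrete set \<open>P\<close> contains all poles; values of \<open>\<xi>\<close> on \<open>P\<close> are irrelevant.\<close>

type_synonym 'a form_family = "complex \<Rightarrow> 'a chart \<Rightarrow> 'a \<Rightarrow> mat2"

definition lwr_potential ::
  "'a::t2_space set \<Rightarrow> 'a chart set \<Rightarrow> 'a set \<Rightarrow> 'a form_family \<Rightarrow> bool" where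
  "lwr_potential S \<A> P \<xi> \<longleftrightarrow>
     P \<subseteq> S \<and> (\<forall>p\<in>S. \<not> p islimpt P) \<and>
     (\<forall>l. \<forall>c\<in>\<A>. \<forall>c'\<in>\<A>. \<forall>p\<in>fst c \<inter> fst c' - P.
        \<xi> l c p = cscale (deriv (in_chart c (snd c')) (snd c p)) (\<xi> l c' p)) \<and>
     (\<forall>l. \<forall>c\<in>\<A>. (\<forall>p\<in>fst c - P. trace (\<xi> l c p) = 0) \<and>
        (\<forall>i j. (\<lambda>w. in_chart c (\<xi> l c) w $ i $ j) meromorphic_on snd c ` fst c)) \<and>
     (\<forall>c\<in>\<A>. \<exists>A B :: 'a \<Rightarrow> mat2.
        holomorphic_mat_on (in_chart c A) (snd c ` (fst c - P)) \<and>
        holomorphic_mat_on (in_chart c B) (snd c ` (fst c - P)) \<and>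
        (\<forall>p\<in>fst c - P. nilpotent_mat (A p) \<and> (\<forall>l. \<xi> l c p = cscale l (A p) + B p)))"

text \<open>Frames live on the covering \<open>\<pi>\<close> of the surface without the poles, and the form \<open>\<xi>\<close> is pulled
  back by \<open>\<pi>\<close>. Holomorphy in the point and the parameter jointly is continuity on the product
  together with holomorphy in each of the two variables (Osgood's lemma).\<close>

definition lwr_frame ::
  "'a chart set \<Rightarrow> 'b::t2_space set \<Rightarrow> ('b \<Rightarrow> 'a) \<Rightarrow> 'a form_family \<Rightarrow>
   (complex \<Rightarrow> 'b \<Rightarrow> mat2) \<Rightarrow> bool" where
  "lwr_frame \<A> T \<pi> \<xi> \<Phi> \<longleftrightarrow>
     (\<forall>l. \<forall>p\<in>T. det (\<Phi> l p) = 1) \<and>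
     continuous_on (UNIV \<times> T) (\<lambda>(l, p). \<Phi> l p) \<and>
     (\<forall>p\<in>T. holomorphic_mat_on (\<lambda>l. \<Phi> l p) UNIV) \<and>
     (\<forall>l. \<forall>c\<in>lifted_atlas T \<pi> \<A>. holomorphic_mat_on (in_chart c (\<Phi> l)) (snd c ` fst c)) \<and>
     (\<forall>l. \<forall>c\<in>\<A>. \<forall>V. lifted_domain T \<pi> c V \<longrightarrow>
        (\<forall>p\<in>V. matrix_inv (\<Phi> l p) **
                 deriv_mat (in_chart (V, snd c \<circ> \<pi>) (\<Phi> l)) (snd c (\<pi> p)) = \<xi> l c (\<pi> p)))"

fun induced :: "ambient \<Rightarrow> (complex \<Rightarrow> 'b \<Rightarrow> mat2) \<Rightarrow> complex \<Rightarrow> complex \<Rightarrow> 'b \<Rightarrow> mat2" where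
  "induced Euclidean \<Phi> l\<^sub>0 l\<^sub>1 p =
     (let \<psi> = cscale (l\<^sub>1 - l\<^sub>0) (deriv_mat (\<lambda>l. \<Phi> l p) l\<^sub>0 ** matrix_inv (\<Phi> l\<^sub>0 p))
      in \<psi> + ctranspose \<psi>)"
| "induced Hyperbolic \<Phi> l\<^sub>0 l\<^sub>1 p =
     (let \<Psi> = \<Phi> l\<^sub>1 p ** matrix_inv (\<Phi> l\<^sub>0 p) in ctranspose \<Psi> ** \<Psi>)"

definition dressing_matrix :: "(complex \<Rightarrow> mat2) \<Rightarrow> bool" where
  "dressing_matrix R \<longleftrightarrow> holomorphic_mat_on R UNIV \<and> (\<forall>l. det (R l) = 1)"

definition dress ::
  "(complex \<Rightarrow> mat2) \<Rightarrow> (complex \<Rightarrow> 'b \<Rightarrow> mat2) \<Rightarrow> complex \<Rightarrow> 'b \<Rightarrow> mat2" where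
  "dress R \<Phi> = (\<lambda>l p. R l ** \<Phi> l p)"

end

theory Submission
  imports Defs
begin

text \<open>A minimal immersion into \<open>E\<^sup>3\<close> or a CMC 1 immersion \<open>f\<close> into \<open>H\<^sup>3\<close> is, in a chart \<open>z\<close>, controlled by one
  matrix function. Put \<open>m = I\<close> in \<open>E\<^sup>3\<close> and \<open>m = f\<close> in \<open>H\<^sup>3\<close>, and let \<open>a = m\<^sup>-\<^sup>1 f\<^sub>z\<close> (\<open>tangent_form\<close>). Conformality
  makes \<open>a\<close> trace free and singular, hence nilpotent, and the classical data can be read off from \<open>a\<close>:
  \<^item> the unit normal is a rational expression in \<open>m\<close>, \<open>a\<close> and \<open>a\<^sup>*\<close> (\<open>unit_normal_eq\<close>);
  \<^item> the Gauss map is the slope \<open>a\<^sub>1\<^sub>1 / a\<^sub>2\<^sub>1\<close> of the image line of \<open>a\<close>, in both spaces (\<open>gauss_map_eq\<close>);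
  \<^item> the Hopf coefficient \<open>Q\<close> is the eigenvalue in \<open>a a\<^sub>z = Q a\<close> (\<open>hopf_eigen\<close>);
  \<^item> \<open>f\<close> is minimal, respectively CMC 1, if and only if \<open>a\<close> is holomorphic (\<open>minimal_or_cmc1_iff\<close>).

  For the immersion induced by an LWR frame, \<open>a\<close> is \<open>\<Phi> (\<xi>\<^sub>1 - \<xi>\<^sub>0) \<Phi>\<^sup>-\<^sup>1\<close>, with \<open>\<Phi>\<close> taken at the first evaluation point
  and \<open>\<xi>\<^sub>0\<close>, \<open>\<xi>\<^sub>1\<close> the values of the potential at the two points. Dressing with \<open>R\<close> therefore conjugates \<open>a\<close> by the
  constant matrix \<open>C = R(\<lambda>\<^sub>0)\<close>. The eigenvalue \<open>Q\<close> does not change and the Gauss map is composed with a Moebius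
  transformation, which preserves the Schwarzian derivative (\<open>goursat_related_of_conjugate\<close>).

  Conversely, let \<open>a\<close> and \<open>b\<close> belong to two immersions with the same Hopf differential and the same Schwarzian
  derivative \<open>S\<close> of the Gauss maps. Where the Gauss map \<open>g\<close> is finite and \<open>Q \<noteq> 0\<close>, choose a root \<open>s = (g')\<^sup>-\<^sup>1\<^sup>/\<^sup>2\<close>. Then
  \<open>v = (g s, s)\<close> solves \<open>v'' = S v\<close>, and \<open>a\<close> is \<open>Q\<close> times a fixed quadratic expression in \<open>v\<close>. The two solutions of this
  linear equation differ by a constant matrix \<open>C\<close> of determinant 1, so \<open>b = C a C\<^sup>-\<^sup>1\<close> locally
  (\<open>equal_schwarzian_conjugate\<close>), and by the identity theorem everywhere (\<open>conjugate\<close>). Non-flatness is what provides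
  one point with \<open>Q \<noteq> 0\<close>. Finally \<open>a\<close> determines the immersion up to an ambient constant: in \<open>E\<^sup>3\<close> the difference
  of two immersions with the same \<open>a\<close> is constant, and in \<open>H\<^sup>3\<close> the matrix \<open>\<Theta>\<^sup>* f' \<Theta>\<close> is constant, where \<open>\<Theta>\<^sup>-\<^sup>1\<close> is the
  holomorphic factor of the first immersion composed with \<open>C\<^sup>-\<^sup>1\<close>. These constants are absorbed by an entire \<open>R\<close> with prescribed \<open>R(\<lambda>\<^sub>0)\<close>
  and prescribed \<open>R'(\<lambda>\<^sub>0)\<close>, respectively prescribed \<open>R(\<lambda>\<^sub>1)\<close>
  (\<open>recover_Euclidean\<close>, \<open>recover_Hyperbolic\<close>).\<close>

text \<open>Throughout, \<open>$\<close> denotes only the entries of vectors and matrices.\<close>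

no_notation fps_nth (infixl "$" 75)

section \<open>Algebra of 2 by 2 matrices\<close>

lemma mat2_eq_iff:
  fixes A B :: mat2
  shows "A = B \<longleftrightarrow> A$1$1 = B$1$1 \<and> A$1$2 = B$1$2 \<and> A$2$1 = B$2$1 \<and> A$2$2 = B$2$2"
  by (simp only: vec_eq_iff forall_2 conj_assoc)

lemma matrix_mult_entry: "((A::mat2) ** B)$i$j = A$i$1 * B$1$j + A$i$2 * B$2$j"
  by (simp add: matrix_matrix_mult_def sum_2)

lemma cscale_entry: "cscale k A $ i $ j = k * A$i$j"
  by (simp add: cscale_def map_matrix_def)

lemma ctranspose_entry: "ctranspose A $ i $ j = cnj (A$j$i)"
  by (simp add: ctranspose_def map_matrix_def transpose_def)

lemma adjugate_entry:
  "adjugate A $ 1 $ 1 = A$2$2" "adjugate A $ 1 $ 2 = - A$1$2"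
  "adjugate A $ 2 $ 1 = - A$2$1" "adjugate A $ 2 $ 2 = A$1$1"
  by (simp_all add: adjugate_def)

lemma mat_entry:
  "(mat c :: mat2)$1$1 = c" "(mat c :: mat2)$1$2 = 0"
  "(mat c :: mat2)$2$1 = 0" "(mat c :: mat2)$2$2 = c"
  by (simp_all add: mat_def)

lemma trace_2: "trace (A::mat2) = A$1$1 + A$2$2"
  by (simp add: trace_def sum_2)

lemma scaleR_entry: "(r *\<^sub>R (A::mat2)) $ i $ j = of_real r * A $ i $ j"
  by (subst vector_scaleR_component)+ (rule scaleR_conv_of_real)

lemmas mat2_simps = mat2_eq_iff matrix_mult_entry cscale_entry ctranspose_entry adjugate_entry
  mat_entry trace_2 det_2

lemma ctranspose_mult: "ctranspose (A ** B) = ctranspose B ** ctranspose A"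
  by (simp add: mat2_simps algebra_simps)
lemma ctranspose_ctranspose [simp]: "ctranspose (ctranspose A) = A"
  by (simp add: mat2_simps)
lemma ctranspose_add: "ctranspose (A + B) = ctranspose A + ctranspose B"
  by (simp add: mat2_simps)
lemma ctranspose_diff: "ctranspose (A - B) = ctranspose A - ctranspose B"
  by (simp add: mat2_simps)
lemma ctranspose_cscale: "ctranspose (cscale k A) = cscale (cnj k) (ctranspose A)"
  by (simp add: mat2_simps)
lemma ctranspose_mat_1 [simp]: "ctranspose (mat 1) = mat 1"
  by (simp add: mat2_simps)
lemma adjugate_mult: "adjugate (A ** B) = adjugate B ** adjugate A"
  by (simp add: mat2_simps algebra_simps)
lemma adjugate_adjugate [simp]: "adjugate (adjugate A) = A"
  by (simp add: mat2_simps)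
lemma adjugate_ctranspose: "adjugate (ctranspose A) = ctranspose (adjugate A)"
  by (simp add: mat2_simps)
lemma adjugate_mat_1 [simp]: "adjugate (mat 1) = mat 1"
  by (simp add: mat2_simps)
lemma adjugate_cscale: "adjugate (cscale k A) = cscale k (adjugate A)"
  by (simp add: mat2_simps)
lemma adjugate_trace_free: "trace A = 0 \<Longrightarrow> adjugate A = - A"
  by (simp add: mat2_simps add_eq_0_iff)
lemma det_adjugate: "det (adjugate A) = det A"
  by (simp add: mat2_simps algebra_simps)
lemma det_ctranspose: "det (ctranspose A) = cnj (det A)"
  by (simp add: mat2_simps algebra_simps)
lemma trace_ctranspose: "trace (ctranspose A) = cnj (trace A)"
  by (simp add: mat2_simps)
lemma trace_cscale: "trace (cscale k A) = k * trace A"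
  by (simp add: mat2_simps algebra_simps)
lemma det_cscale: "det (cscale k A) = k\<^sup>2 * det A"
  by (simp add: mat2_simps algebra_simps power2_eq_square)
lemma cscale_cscale: "cscale k (cscale l A) = cscale (k * l) A"
  by (simp add: mat2_simps)
lemma cscale_1 [simp]: "cscale 1 A = A"
  by (simp add: mat2_simps)
lemma cscale_0 [simp]: "cscale 0 A = 0" "cscale k 0 = 0"
  by (simp_all add: mat2_simps)
lemma cscale_eq_0_iff: "cscale k A = 0 \<longleftrightarrow> k = 0 \<or> A = 0"
  by (auto simp: mat2_simps)
lemma cscale_add: "cscale k (A + B) = cscale k A + cscale k B"
  by (simp add: mat2_simps algebra_simps)
lemma cscale_diff: "cscale k (A - B) = cscale k A - cscale k B"
  by (simp add: mat2_simps algebra_simps)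
lemma cscale_mult_left: "cscale k A ** B = cscale k (A ** B)"
  by (simp add: mat2_simps algebra_simps)
lemma cscale_mult_right: "A ** cscale k B = cscale k (A ** B)" for A B :: mat2
  by (simp add: mat2_simps algebra_simps)
lemma mat2_add_ldistrib: "A ** (B + C) = A ** B + A ** C" for A B C :: mat2
  by (simp add: mat2_simps algebra_simps)
lemma mat2_add_rdistrib: "(B + C) ** A = B ** A + C ** A" for A B C :: mat2
  by (simp add: mat2_simps algebra_simps)
lemma mat2_diff_ldistrib: "A ** (B - C) = A ** B - A ** C" for A B C :: mat2
  by (simp add: mat2_simps algebra_simps)
lemma mat2_diff_rdistrib: "(B - C) ** A = B ** A - C ** A" for A B C :: mat2
  by (simp add: mat2_simps algebra_simps)
lemma mat2_mult_minus: "A ** (- B) = - (A ** B)" "(- A) ** B = - (A ** B)" for A B :: mat2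
  by (simp_all add: mat2_simps algebra_simps)

lemma mat2_mult_zero [simp]: "A ** 0 = 0" "0 ** A = 0" for A :: mat2
  by (simp_all add: mat2_simps)
lemma trace_zero [simp]: "trace (0::mat2) = 0"
  by (simp add: trace_2)

lemma trace_minus: "trace (- A) = - trace A" for A :: mat2
  by (simp add: trace_2)

lemmas mat2_distribs = mat2_add_ldistrib mat2_add_rdistrib mat2_diff_ldistrib mat2_diff_rdistrib
  mat2_mult_minus cscale_mult_left cscale_mult_right cscale_cscale cscale_add cscale_diff
  ctranspose_mult ctranspose_add ctranspose_diff ctranspose_cscale

lemma mult_adjugate: "A ** adjugate A = cscale (det A) (mat 1)"
  by (simp add: mat2_simps algebra_simps)
lemma adjugate_mult_self: "adjugate A ** A = cscale (det A) (mat 1)"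
  by (simp add: mat2_simps algebra_simps)

lemma adjugate_cancel:
  assumes "det A = 1"
  shows "A ** adjugate A = mat 1" "adjugate A ** A = mat 1"
    "B ** A ** adjugate A = B" "B ** adjugate A ** A = B"
proof -
  show *: "A ** adjugate A = mat 1" "adjugate A ** A = mat 1"
    using assms by (simp_all add: mult_adjugate adjugate_mult_self)
  show "B ** A ** adjugate A = B" "B ** adjugate A ** A = B"
    by (simp_all add: matrix_mul_assoc [symmetric] *)
qed

lemma matrix_inv_eq_adjugate:
  assumes "det A = 1"
  shows "matrix_inv A = adjugate (A :: mat2)"
proof -
  have 1: "A ** adjugate A = mat 1" "adjugate A ** A = mat 1"
    using adjugate_cancel[OF assms] by auto
  then have "A ** matrix_inv A = mat 1 \<and> matrix_inv A ** A = mat 1"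
    unfolding matrix_inv_def by (rule_tac someI[of _ "adjugate A"]) simp
  then show ?thesis
    using matrix_mul_assoc[of "adjugate A" A "matrix_inv A"] by (simp add: 1)
qed

text \<open>The polarised Cayley--Hamilton theorem. It is the source of nearly all matrix identities below: orthogonality of
  trace-free matrices becomes anticommutation.\<close>

lemma trace_free_anticommutator:
  assumes "trace A = 0" "trace B = 0"
  shows "A ** B + B ** A = cscale (trace (A ** B)) (mat 1)"
proof -
  have "A$2$2 = - A$1$1" "B$2$2 = - B$1$1"
    using assms by (simp_all add: trace_2 add_eq_0_iff)
  then show ?thesis by (simp add: mat2_simps algebra_simps)
qed

lemma trace_conj_adjugate:
  assumes "det V = 1"
  shows "trace (V ** A ** adjugate V) = trace A"
  by (subst trace_mul_sym) (simp add: matrix_mul_assoc adjugate_cancel[OF assms])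

lemma det_conj_adjugate:
  assumes "det V = 1"
  shows "det (V ** A ** adjugate V) = det A"
  using assms by (simp add: det_mul det_adjugate)

lemma conj_adjugate_eq_0_iff:
  assumes "det V = 1"
  shows "V ** A ** adjugate V = 0 \<longleftrightarrow> A = 0"
proof
  assume "V ** A ** adjugate V = 0"
  then have "adjugate V ** (V ** A ** adjugate V) ** V = 0"
    by (simp add: mat2_simps)
  then show "A = 0"
    by (simp add: matrix_mul_assoc adjugate_cancel[OF assms])
qed (simp add: mat2_simps)

lemma nilpotent_square:
  assumes "trace A = 0" "det A = 0"
  shows "A ** A = (0::mat2)"
proof -
  have "A$2$2 = - A$1$1" "A$1$1 * A$1$1 = - (A$1$2 * A$2$1)"
    using assms by (simp_all add: mat2_simps add_eq_0_iff) (metis minus_equation_iff)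
  then show ?thesis by (simp add: mat2_simps algebra_simps)
qed

lemma minner_self: "minner x x = - det x"
  by (simp add: minner_def mat2_simps field_simps)

lemma minner_congruence:
  assumes "det V = 1"
  shows "minner (V ** x ** ctranspose V) (V ** y ** ctranspose V) = minner x y"
proof -
  have d: "det (ctranspose V) = 1" using assms by (simp add: det_ctranspose)
  have "(V ** x ** ctranspose V) ** adjugate (V ** y ** ctranspose V) = V ** (x ** adjugate y) ** adjugate V"
    by (simp add: adjugate_mult matrix_mul_assoc adjugate_cancel[OF d])
  then show ?thesis
    by (simp add: minner_def trace_conj_adjugate[OF assms])
qed

lemma minner_trace_free: "trace y = 0 \<Longrightarrow> minner x y = trace (x ** y) / 2"
  by (simp add: minner_def adjugate_trace_free mat2_mult_minus) (simp add: mat2_simps)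

lemma trace_mult_ctranspose:
  "trace (A ** ctranspose A) =
     of_real ((norm (A$1$1))\<^sup>2 + (norm (A$1$2))\<^sup>2 + (norm (A$2$1))\<^sup>2 + (norm (A$2$2))\<^sup>2)"
  by (simp add: mat2_simps complex_norm_square del: of_real_power)

lemma trace_mult_ctranspose_pos:
  assumes "A \<noteq> 0"
  obtains t where "t > 0" "trace (A ** ctranspose A) = of_real t"
proof
  let ?t = "(norm (A$1$1))\<^sup>2 + (norm (A$1$2))\<^sup>2 + (norm (A$2$1))\<^sup>2 + (norm (A$2$2))\<^sup>2"
  have "A$1$1 \<noteq> 0 \<or> A$1$2 \<noteq> 0 \<or> A$2$1 \<noteq> 0 \<or> A$2$2 \<noteq> 0"
    using assms by (auto simp: mat2_simps)
  then show "?t > 0"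
    by (smt (verit) zero_le_power2 zero_less_norm_iff zero_less_power)
  show "trace (A ** ctranspose A) = of_real ?t"
    by (rule trace_mult_ctranspose)
qed


section \<open>The unit normal in Euclidean space\<close>

text \<open>On trace-free Hermitian matrices this is \<open>4 \<i>\<close> times the determinant in an oriented orthonormal basis.\<close>

definition triple_product :: "mat2 \<Rightarrow> mat2 \<Rightarrow> mat2 \<Rightarrow> complex" where
  "triple_product a b c = trace ((a ** b - b ** a) ** c)"

lemma triple_product_linear_combinations:
  fixes M :: "real^3^3"
  assumes "a = M$1$1 *\<^sub>R x + M$1$2 *\<^sub>R y + M$1$3 *\<^sub>R w"
    and "b = M$2$1 *\<^sub>R x + M$2$2 *\<^sub>R y + M$2$3 *\<^sub>R w"
    and "c = M$3$1 *\<^sub>R x + M$3$2 *\<^sub>R y + M$3$3 *\<^sub>R w"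
  shows "triple_product a b c = of_real (det M) * triple_product x y w"
proof -
  show ?thesis
    unfolding assms triple_product_def trace_2 det_3
    by (simp add: matrix_mult_entry scaleR_entry del: vector_scaleR_component) algebra
qed

lemma triple_product_cross:
  assumes "hermitian x" "hermitian y" "w = cscale (- \<i> / 2) (commutator x y)"
  obtains r where "r \<ge> 0" "triple_product x y w = 2 * \<i> * of_real r"
proof -
  have "ctranspose w = w"
    using assms(1,2) unfolding assms(3) hermitian_def commutator_def mat2_distribs
    by (simp add: mat2_simps algebra_simps)
  then have "trace (w ** w) = of_real ((norm (w$1$1))\<^sup>2 + (norm (w$1$2))\<^sup>2 + (norm (w$2$1))\<^sup>2 + (norm (w$2$2))\<^sup>2)"
    using trace_mult_ctranspose[of w] by simp
  moreover have "x ** y - y ** x = cscale (2 * \<i>) w"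
    by (simp add: assms(3) commutator_def cscale_cscale)
  then have "triple_product x y w = 2 * \<i> * trace (w ** w)"
    by (simp add: triple_product_def cscale_mult_left trace_cscale)
  ultimately show ?thesis
    by (intro that[of "(norm (w$1$1))\<^sup>2 + (norm (w$1$2))\<^sup>2 + (norm (w$2$1))\<^sup>2 + (norm (w$2$2))\<^sup>2"]) simp_all
qed

lemma trace_linear_combination_real:
  "trace (r *\<^sub>R x + s *\<^sub>R y + t *\<^sub>R w) = of_real r * trace x + of_real s * trace y + of_real t * trace w"
  for x y w :: mat2
  by (simp add: trace_2 scaleR_entry algebra_simps del: vector_scaleR_component)

text \<open>The normal is determined up to sign by the metric conditions, and the sign of the triple product decides between the two.\<close>

lemma positive_triple0_imp:
  assumes "positive_triple0 a b c"
  obtains r where "r \<ge> 0" "triple_product a b c = 2 * \<i> * of_real r" "trace c = 0"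
proof -
  obtain x y w and M :: "real^3^3" where
    xy: "hermitian x" "hermitian y" "trace x = 0" "trace y = 0"
    and w: "w = cscale (- \<i> / 2) (commutator x y)" and M: "det M > 0"
    and abc: "a = M$1$1 *\<^sub>R x + M$1$2 *\<^sub>R y + M$1$3 *\<^sub>R w"
     "b = M$2$1 *\<^sub>R x + M$2$2 *\<^sub>R y + M$2$3 *\<^sub>R w"
     "c = M$3$1 *\<^sub>R x + M$3$2 *\<^sub>R y + M$3$3 *\<^sub>R w"
    using assms unfolding positive_triple0_def by auto
  obtain r where r: "r \<ge> 0" "triple_product x y w = 2 * \<i> * of_real r"
    using triple_product_cross[OF xy(1,2) w] .
  have "trace w = 0"
    by (simp add: w commutator_def trace_cscale) (simp add: mat2_simps)
  then have "trace c = 0"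
    by (simp add: abc(3) trace_linear_combination_real xy)
  moreover have "triple_product a b c = 2 * \<i> * of_real (det M * r)"
    using triple_product_linear_combinations[OF abc] r by simp
  ultimately show ?thesis
    using that[of "det M * r"] M r by simp
qed

lemma nilpotent_mult_ctranspose:
  assumes "trace b = 0" "det b = 0"
  defines "bs \<equiv> ctranspose b"
  shows "b ** bs + bs ** b = cscale (trace (b ** bs)) (mat 1)"
    and "b ** bs ** b = cscale (trace (b ** bs)) b"
    and "bs ** b ** bs = cscale (trace (b ** bs)) bs"
proof -
  have tr: "trace bs = 0" "det bs = 0"
    using assms by (simp_all add: trace_ctranspose det_ctranspose)
  have sq: "b ** b = 0" "bs ** bs = 0"
    using nilpotent_square assms tr by blast+
  show 1: "b ** bs + bs ** b = cscale (trace (b ** bs)) (mat 1)"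
    by (rule trace_free_anticommutator) fact+
  have "(b ** bs + bs ** b) ** b = b ** bs ** b"
    by (simp add: mat2_add_rdistrib matrix_mul_assoc [symmetric] sq)
  then show "b ** bs ** b = cscale (trace (b ** bs)) b"
    by (simp add: 1 cscale_mult_left)
  have "(b ** bs + bs ** b) ** bs = bs ** b ** bs"
    by (simp add: mat2_add_rdistrib matrix_mul_assoc [symmetric] sq)
  then show "bs ** b ** bs = cscale (trace (b ** bs)) bs"
    by (simp add: 1 cscale_mult_left)
qed

text \<open>If \<open>\<nu>\<close> spans the image of the nilpotent matrix \<open>b\<close>, this is the reflection \<open>I - 2 \<nu>\<nu>\<^sup>* / |\<nu>|\<^sup>2\<close>. It is the
  normalised cross product of the tangent vectors \<open>b + b\<^sup>*\<close> and \<open>\<i> (b - b\<^sup>*)\<close>.\<close>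

definition flat_normal :: "mat2 \<Rightarrow> mat2" where
  "flat_normal b = cscale (1 / trace (b ** ctranspose b)) (ctranspose b ** b - b ** ctranspose b)"

lemma flat_normal_square:
  assumes "trace b = 0" "det b = 0" "b \<noteq> 0"
  shows "flat_normal b ** flat_normal b = mat 1"
proof -
  define bs where "bs = ctranspose b"
  define t where "t = trace (b ** bs)"
  have t: "t \<noteq> 0"
    using trace_mult_ctranspose_pos[OF assms(3)] unfolding t_def bs_def by (metis of_real_eq_0_iff less_irrefl)
  note nil = nilpotent_mult_ctranspose[OF assms(1,2), folded bs_def, folded t_def]
  have sq: "b ** b = 0" "bs ** bs = 0"
    using nilpotent_square assms by (auto simp: bs_def trace_ctranspose det_ctranspose)
  have "(bs ** b - b ** bs) ** (bs ** b - b ** bs) =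
      (bs ** b ** bs) ** b - bs ** (b ** b) ** bs - (b ** (bs ** bs) ** b - (b ** bs ** b) ** bs)"
    by (simp add: mat2_distribs matrix_mul_assoc)
  also have "\<dots> = cscale t (b ** bs + bs ** b)"
    by (simp add: sq nil(2,3) cscale_mult_left cscale_add add.commute)
  also have "\<dots> = cscale (t * t) (mat 1)"
    by (simp only: nil(1) cscale_cscale)
  finally show ?thesis
    using t by (simp add: flat_normal_def cscale_mult_left cscale_mult_right cscale_cscale
        flip: bs_def t_def)
qed

text \<open>A trace-free \<open>n\<close> that is orthogonal to \<open>b\<close> and \<open>b\<^sup>*\<close> anticommutes with both and so commutes with
  \<open>E = flat_normal b\<close>. The product of two commuting trace-free matrices is a scalar matrix, so \<open>n\<close> is a multiple of \<open>E\<close>. Both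
  square to the identity, and the orientation excludes the factor \<open>-1\<close>.\<close>

lemma flat_normal_unique:
  assumes b: "trace b = 0" "det b = 0" "b \<noteq> 0"
    and n: "minner (b + ctranspose b) n = 0" "minner (cscale \<i> (b - ctranspose b)) n = 0"
      "minner n n = 1" "positive_triple0 (b + ctranspose b) (cscale \<i> (b - ctranspose b)) n"
  shows "n = flat_normal b"
proof -
  define bs where "bs = ctranspose b"
  obtain r where r: "r \<ge> 0" and tp: "triple_product (b + bs) (cscale \<i> (b - bs)) n = 2 * \<i> * of_real r"
    and trn: "trace n = 0"
    using positive_triple0_imp[OF n(4)] unfolding bs_def .
  have "trace ((b + bs) ** n) = 0" "trace (cscale \<i> (b - bs) ** n) = 0"
    using n(1,2) by (simp_all add: minner_trace_free[OF trn] bs_def)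
  then have "trace (b ** n) = 0" "trace (bs ** n) = 0"
    by (simp_all add: mat2_distribs trace_cscale trace_add trace_sub)
  then have ac: "b ** n + n ** b = 0" "bs ** n + n ** bs = 0"
    using trace_free_anticommutator[OF b(1) trn] trace_free_anticommutator[of bs n] trn b(1)
    by (simp_all add: bs_def trace_ctranspose)
  have nn: "n ** n = mat 1"
    using trace_free_anticommutator[OF trn trn] n(3)
    by (simp add: minner_trace_free[OF trn]) (simp add: mat2_eq_iff mat_entry cscale_entry)
  obtain t where t: "t > 0" "trace (b ** bs) = of_real t"
    using trace_mult_ctranspose_pos[OF b(3)] unfolding bs_def .
  define E where "E = flat_normal b"
  have E: "E = cscale (1 / of_real t) (bs ** b - b ** bs)"
    using t by (simp add: E_def flat_normal_def bs_def)
  have trE: "trace E = 0"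
    by (simp add: E trace_cscale trace_sub trace_mul_sym[of b])
  have EE: "E ** E = mat 1"
    using flat_normal_square[OF b] by (simp add: E_def)
  have nb: "n ** b = - (b ** n)" "n ** bs = - (bs ** n)"
    using ac by (simp_all add: add_eq_0_iff)
  have "n ** (b ** bs) = (b ** bs) ** n"
    by (simp add: matrix_mul_assoc nb mat2_mult_minus) (simp add: matrix_mul_assoc[symmetric] nb mat2_mult_minus)
  moreover have "n ** (bs ** b) = (bs ** b) ** n"
    by (simp add: matrix_mul_assoc nb mat2_mult_minus) (simp add: matrix_mul_assoc[symmetric] nb mat2_mult_minus)
  ultimately have comm: "n ** E = E ** n"
    by (simp add: E mat2_distribs)
  have "E ** n + n ** E = cscale (trace (E ** n)) (mat 1)"
    by (rule trace_free_anticommutator) fact+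
  then have "E ** n + E ** n = cscale (trace (E ** n)) (mat 1)"
    by (simp add: comm)
  then have En: "E ** n = cscale (trace (E ** n) / 2) (mat 1)"
    by (simp add: mat2_eq_iff mat_entry cscale_entry mult.commute)
  have "triple_product (b + bs) (cscale \<i> (b - bs)) n = 2 * \<i> * of_real t * trace (E ** n)"
  proof -
    have "(b + bs) ** cscale \<i> (b - bs) - cscale \<i> (b - bs) ** (b + bs) = cscale (2 * \<i> * of_real t) E"
      using t by (simp add: E cscale_cscale) (simp add: mat2_simps algebra_simps)
    then show ?thesis
      by (simp add: triple_product_def cscale_mult_left trace_cscale)
  qed
  then have "trace (E ** n) = of_real (r / t)"
    using t tp by (simp add: field_simps)
  then obtain q where q: "q \<ge> 0" "E ** n = cscale (of_real q) (mat 1)"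
    using En r t by (intro that[of "r / t / 2"]) auto
  have "n = E ** (E ** n)"
    by (simp add: matrix_mul_assoc EE)
  then have nq: "n = cscale (of_real q) E"
    by (simp add: q cscale_mult_right)
  then have "mat 1 = cscale (of_real (q * q)) (mat 1)"
    using nn EE by (simp add: cscale_mult_left cscale_mult_right cscale_cscale)
  then have "complex_of_real (q * q) = 1"
    by (simp add: mat2_simps)
  then have "q * q = 1"
    by (metis of_real_eq_1_iff)
  with q have "q = 1"
    by (metis abs_of_nonneg abs_mult_self_eq mult_cancel_left2 mult_left_cancel one_neq_zero power2_eq_1_iff power2_eq_square abs_1 abs_minus_cancel)
  then show ?thesis
    using nq by (simp add: E_def)
qed

lemma independent_pairI:
  assumes "\<And>r s. r *\<^sub>R x + s *\<^sub>R y = 0 \<Longrightarrow> r = 0 \<and> s = 0"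
  shows "x \<noteq> y" "independent {x, y}"
proof -
  show "x \<noteq> y"
    using assms[of 1 "- 1"] by auto
  have y: "y \<noteq> 0"
    using assms[of 0 1] by auto
  moreover have "x \<notin> span {y}"
  proof
    assume "x \<in> span {y}"
    then obtain k where "x = k *\<^sub>R y"
      by (auto simp: span_singleton)
    then show False
      using assms[of 1 "- k"] by auto
  qed
  ultimately show "independent {x, y}"
    by (simp add: independent_insert)
qed

text \<open>Multiplication by \<open>b\<close> from the left removes the first summand and leaves a multiple of \<open>b b\<^sup>*\<close>, whose trace is
  positive. With real and imaginary parts of \<open>k\<close> as coefficients, this is the independence of the two tangent vectors.\<close>

lemma nilpotent_real_combination:
  assumes b: "trace b = 0" "det b = 0" "b \<noteq> 0"
    and 0: "cscale k b + cscale (cnj k) (ctranspose b) = 0"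
  shows "k = 0"
proof (rule ccontr)
  assume "k \<noteq> 0"
  obtain t where t: "t > 0" "trace (b ** ctranspose b) = of_real t"
    using trace_mult_ctranspose_pos[OF b(3)] .
  have "b ** (cscale k b + cscale (cnj k) (ctranspose b)) = cscale (cnj k) (b ** ctranspose b)"
    by (simp add: mat2_distribs nilpotent_square[OF b(1,2)])
  then have "cscale (cnj k) (b ** ctranspose b) = 0"
    using 0 by (simp add: mat2_simps)
  then have "cnj k * trace (b ** ctranspose b) = 0"
    by (metis trace_cscale trace_zero)
  then show False
    using t \<open>k \<noteq> 0\<close> by simp
qed

lemma flat_normal_positive:
  assumes b: "trace b = 0" "det b = 0" "b \<noteq> 0"
  defines "x \<equiv> b + ctranspose b" and "y \<equiv> cscale \<i> (b - ctranspose b)"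
  shows "positive_triple0 x y (flat_normal b)"
proof -
  have 1: "x \<in> ambient_space Euclidean" "y \<in> ambient_space Euclidean"
    using b(1) by (auto simp: x_def y_def hermitian_def mat2_distribs trace_add trace_sub
        trace_cscale trace_ctranspose) (simp_all add: mat2_simps)
  have "r = 0 \<and> s = 0" if "r *\<^sub>R x + s *\<^sub>R y = 0" for r s
  proof -
    have "cscale (Complex r s) b + cscale (cnj (Complex r s)) (ctranspose b) = r *\<^sub>R x + s *\<^sub>R y"
      by (simp add: mat2_simps scaleR_entry x_def y_def complex_eq_iff algebra_simps del: vector_scaleR_component)
    then have "Complex r s = 0"
      using nilpotent_real_combination[OF b] that by metis
    then show ?thesis
      by (simp add: complex_eq_iff)
  qed
  then have ind: "x \<noteq> y" "independent {x, y}"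
    using independent_pairI[of x y] by blast+
  define w where "w = cscale (- \<i> / 2) (commutator x y)"
  obtain t where t: "t > 0" "trace (b ** ctranspose b) = of_real t"
    using trace_mult_ctranspose_pos[OF b(3)] .
  have w: "w = ctranspose b ** b - b ** ctranspose b"
    by (simp add: w_def x_def y_def commutator_def mat2_distribs) (simp add: mat2_simps algebra_simps)
  define M :: "real^3^3" where "M = vector [vector [1,0,0], vector [0,1,0], vector [0,0,1/t]]"
  have M: "M$1$1 = 1" "M$1$2 = 0" "M$1$3 = 0" "M$2$1 = 0" "M$2$2 = 1" "M$2$3 = 0"
    "M$3$1 = 0" "M$3$2 = 0" "M$3$3 = 1/t"
    by (simp_all add: M_def vector_3)
  have "det M > 0"
    using t by (simp add: det_3 M)
  moreover have "flat_normal b = (1/t) *\<^sub>R w"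
    unfolding flat_normal_def t w by (simp add: mat2_simps scaleR_entry del: vector_scaleR_component)
  ultimately show ?thesis
    unfolding positive_triple0_def using 1 ind
    by (intro exI[of _ x] exI[of _ y] exI[of _ w] exI[of _ M]) (simp add: M w_def)
qed

lemma flat_normal_orthogonal:
  assumes b: "trace b = 0" "det b = 0" "b \<noteq> 0"
  shows "minner b (flat_normal b) = 0" "minner (ctranspose b) (flat_normal b) = 0"
    "minner (flat_normal b) (flat_normal b) = 1" "trace (flat_normal b) = 0"
proof -
  show tr: "trace (flat_normal b) = 0"
    by (simp add: flat_normal_def trace_cscale trace_sub trace_mul_sym[of b])
  show "minner (flat_normal b) (flat_normal b) = 1"
    by (simp add: minner_trace_free[OF tr] flat_normal_square[OF b]) (simp add: mat2_simps)
  have sq: "b ** b = 0" "ctranspose b ** ctranspose b = 0"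
    using nilpotent_square b by (auto simp: trace_ctranspose det_ctranspose)
  have "trace (b ** (ctranspose b ** b)) = 0"
    by (subst trace_mul_sym) (simp add: matrix_mul_assoc[symmetric] sq)
  moreover have "b ** (b ** ctranspose b) = 0"
    by (simp add: matrix_mul_assoc sq)
  ultimately show "minner b (flat_normal b) = 0"
    by (simp add: minner_trace_free[OF tr]) (simp add: flat_normal_def mat2_distribs trace_cscale trace_sub trace_minus)
  have "trace (ctranspose b ** (b ** ctranspose b)) = 0"
    by (subst trace_mul_sym) (simp add: matrix_mul_assoc[symmetric] sq)
  moreover have "ctranspose b ** (ctranspose b ** b) = 0"
    by (simp add: matrix_mul_assoc sq)
  ultimately show "minner (ctranspose b) (flat_normal b) = 0"
    by (simp add: minner_trace_free[OF tr]) (simp add: flat_normal_def mat2_distribs trace_cscale trace_sub trace_minus)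
qed


section \<open>Tangent directions in both ambient spaces\<close>

text \<open>The Hermitian matrix \<open>m = V V\<^sup>*\<close> for which \<open>x \<mapsto> V x V\<^sup>*\<close> carries the Euclidean tangent space to the tangent space at
  \<open>q\<close>. With it the two ambient spaces are treated by the same formulas.\<close>

fun gram :: "ambient \<Rightarrow> mat2 \<Rightarrow> mat2" where
  "gram Euclidean q = mat 1"
| "gram Hyperbolic q = q"

text \<open>Cholesky factorisation; the factor is lower triangular.\<close>

lemma hermitian_factorization:
  assumes "hermitian m" "det m = 1" "Re (trace m) > 0"
  obtains V where "det V = 1" "m = V ** ctranspose V"
proof -
  have h: "cnj (m$1$1) = m$1$1" "cnj (m$2$2) = m$2$2" "m$2$1 = cnj (m$1$2)"
    using assms(1) unfolding hermitian_def by (simp_all add: mat2_simps)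
  define p where "p = Re (m$1$1)"
  define r where "r = Re (m$2$2)"
  have p: "m$1$1 = of_real p" and r: "m$2$2 = of_real r"
    using h by (simp_all add: p_def r_def complex_eq_iff)
  have "complex_of_real (p * r - (norm (m$1$2))\<^sup>2) = 1"
    using assms(2) unfolding det_2 p r h(3) by (simp add: complex_norm_square del: of_real_power)
  then have d: "p * r = 1 + (norm (m$1$2))\<^sup>2"
    by (metis add.commute add_diff_cancel_left' diff_add_cancel of_real_eq_1_iff)
  have "p + r > 0"
    using assms(3) by (simp add: trace_2 p_def r_def)
  moreover have "p * r > 0"
    using d by (simp add: add_pos_nonneg)
  ultimately have pp: "p > 0"
    by (smt (verit) mult_nonneg_nonpos zero_less_mult_iff)
  define s where "s = complex_of_real (sqrt p)"
  have s: "s * s = of_real p" "s \<noteq> 0" "cnj s = s"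
    using pp by (simp_all add: s_def flip: of_real_mult)
  define V :: mat2 where "V = vector [vector [s, 0], vector [m$2$1 / s, 1 / s]]"
  have V: "V$1$1 = s" "V$1$2 = 0" "V$2$1 = m$2$1 / s" "V$2$2 = 1 / s"
    by (simp_all add: V_def)
  have "m$2$2 = (m$2$1 * cnj (m$2$1) + 1) / of_real p"
    using d pp unfolding r h(3)
    by (simp add: field_simps complex_norm_square[symmetric] flip: of_real_mult)
  then have "m = V ** ctranspose V"
    using s by (simp add: mat2_simps V p h(3) field_simps) (simp add: add_divide_distrib)
  moreover have "det V = 1"
    using s by (simp add: det_2 V)
  ultimately show ?thesis
    using that by blast
qed

lemma gram_factorization:
  assumes "q \<in> ambient_space X"
  obtains V where "det V = 1" "gram X q = V ** ctranspose V"
proof (cases X)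
  case Euclidean
  then show ?thesis
    using that[of "mat 1"] by simp
next
  case Hyperbolic
  then show ?thesis
    using assms hermitian_factorization[of q] that by auto
qed

text \<open>The adjoint of \<open>a\<close> with respect to the Hermitian form \<open>m\<close>.\<close>

definition sharp :: "mat2 \<Rightarrow> mat2 \<Rightarrow> mat2" where
  "sharp m a = adjugate m ** ctranspose a ** m"

text \<open>The Euclidean normal of \<open>b = V\<^sup>* a (V\<^sup>*)\<^sup>-\<^sup>1\<close>, carried to the point \<open>m = V V\<^sup>*\<close>, but written without the choice of
  \<open>V\<close>. That the factor disappears is what makes the hyperbolic normal well defined.\<close>

definition normal_of :: "mat2 \<Rightarrow> mat2 \<Rightarrow> mat2" where
  "normal_of m a = cscale (1 / trace (a ** sharp m a)) (m ** (sharp m a ** a - a ** sharp m a))"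

lemma factored_sharp:
  fixes V m a :: mat2
  assumes V: "det V = 1" "m = V ** ctranspose V"
  defines "b \<equiv> ctranspose V ** a ** adjugate (ctranspose V)"
  shows "m ** a = V ** b ** ctranspose V" "ctranspose a ** m = V ** ctranspose b ** ctranspose V"
    "sharp m a = adjugate (ctranspose V) ** ctranspose b ** ctranspose V"
    "trace (a ** sharp m a) = trace (b ** ctranspose b)"
    "normal_of m a = V ** flat_normal b ** ctranspose V"
    "trace b = trace a" "det b = det a" "b = 0 \<longleftrightarrow> a = 0"
proof -
  have d: "det (ctranspose V) = 1"
    using V by (simp add: det_ctranspose)
  note c = adjugate_cancel[OF V(1)] adjugate_cancel[OF d]
  have a: "a = adjugate (ctranspose V) ** b ** ctranspose V"
    by (simp add: b_def matrix_mul_assoc c)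
  show 1: "m ** a = V ** b ** ctranspose V" "ctranspose a ** m = V ** ctranspose b ** ctranspose V"
    by (simp_all add: b_def V ctranspose_mult matrix_mul_assoc c flip: adjugate_ctranspose)
  have s: "sharp m a = adjugate (ctranspose V) ** ctranspose b ** ctranspose V"
    by (simp add: sharp_def 1 matrix_mul_assoc[symmetric])
       (simp add: V adjugate_mult matrix_mul_assoc c)
  then show "sharp m a = adjugate (ctranspose V) ** ctranspose b ** ctranspose V" .
  have as: "a ** sharp m a = adjugate (ctranspose V) ** (b ** ctranspose b) ** ctranspose V"
    "sharp m a ** a = adjugate (ctranspose V) ** (ctranspose b ** b) ** ctranspose V"
    by (simp_all add: s) (simp_all add: a matrix_mul_assoc c)
  show t: "trace (a ** sharp m a) = trace (b ** ctranspose b)"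
    unfolding as by (subst trace_mul_sym) (simp add: matrix_mul_assoc c)
  show "normal_of m a = V ** flat_normal b ** ctranspose V"
    unfolding normal_of_def t flat_normal_def unfolding as
    by (simp add: mat2_distribs V matrix_mul_assoc c)
  show "trace b = trace a" "det b = det a" "b = 0 \<longleftrightarrow> a = 0"
    unfolding b_def using trace_conj_adjugate[OF d] det_conj_adjugate[OF d] conj_adjugate_eq_0_iff[OF d]
    by blast+
qed

lemma congruence_combinations:
  "V ** (b + ctranspose b) ** ctranspose V = V ** b ** ctranspose V + V ** ctranspose b ** ctranspose V"
  "V ** cscale \<i> (b - ctranspose b) ** ctranspose V =
     cscale \<i> (V ** b ** ctranspose V - V ** ctranspose b ** ctranspose V)"
  by (simp_all add: mat2_distribs)

text \<open>Every factorisation \<open>m = V V\<^sup>*\<close> that may witness the orientation reduces the claim to the Euclidean one, and leads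
  to the same matrix.\<close>

lemma normal_of_unique:
  assumes q: "q \<in> ambient_space X" and a: "trace a = 0" "det a = 0" "a \<noteq> 0"
  defines "m \<equiv> gram X q"
  defines "x \<equiv> m ** a + ctranspose a ** m" and "y \<equiv> cscale \<i> (m ** a - ctranspose a ** m)"
  shows "minner x n = 0 \<and> minner y n = 0 \<and> minner n n = 1 \<and> positive_triple X q x y n \<longleftrightarrow>
    n = normal_of m a"
proof -
  have fwd: "n = normal_of m a"
    if V: "det V = 1" "m = V ** ctranspose V"
      and n: "n = V ** c' ** ctranspose V" "minner x n = 0" "minner y n = 0" "minner n n = 1"
      and p: "positive_triple0 a' b' c'"
      "x = V ** a' ** ctranspose V" "y = V ** b' ** ctranspose V" for V a' b' c'
  proof -
    define b where "b = ctranspose V ** a ** adjugate (ctranspose V)"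
    note f = factored_sharp[OF V, of a, folded b_def]
    have d: "det (ctranspose V) = 1"
      using V by (simp add: det_ctranspose)
    note c = adjugate_cancel[OF V(1)] adjugate_cancel[OF d]
    have xy: "x = V ** (b + ctranspose b) ** ctranspose V" "y = V ** cscale \<i> (b - ctranspose b) ** ctranspose V"
      unfolding x_def y_def congruence_combinations f by auto
    have canc: "A = B" if "V ** A ** ctranspose V = V ** B ** ctranspose V" for A B :: mat2
    proof -
      have "adjugate V ** (V ** A ** ctranspose V) ** adjugate (ctranspose V) =
         adjugate V ** (V ** B ** ctranspose V) ** adjugate (ctranspose V)"
        using that by simp
      then show ?thesis
        by (simp add: matrix_mul_assoc c)
    qed
    have "a' = b + ctranspose b" "b' = cscale \<i> (b - ctranspose b)"
      using canc p(2,3) xy by metis+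
    moreover have "minner (b + ctranspose b) c' = 0" "minner (cscale \<i> (b - ctranspose b)) c' = 0"
       "minner c' c' = 1"
      using n(2-4) unfolding n(1) xy minner_congruence[OF V(1)] .
    ultimately have "c' = flat_normal b"
      using p(1) a f by (intro flat_normal_unique) auto
    then show ?thesis
      by (simp add: f n)
  qed
  have bwd: "minner x n = 0 \<and> minner y n = 0 \<and> minner n n = 1 \<and> positive_triple X q x y n"
    if n: "n = normal_of m a"
  proof -
    obtain V where V: "det V = 1" "m = V ** ctranspose V"
      and V': "X = Euclidean \<Longrightarrow> V = mat 1"
    proof (cases X)
      case Euclidean
      then show ?thesis
        using that[of "mat 1"] by (simp add: m_def)
    next
      case Hyperbolic
      then show ?thesis
        using gram_factorization[OF q] that m_def by (metis ambient.distinct(1))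
    qed
    define b where "b = ctranspose V ** a ** adjugate (ctranspose V)"
    note f = factored_sharp[OF V, of a, folded b_def]
    have b: "trace b = 0" "det b = 0" "b \<noteq> 0"
      using a f by auto
    have xy: "x = V ** (b + ctranspose b) ** ctranspose V" "y = V ** cscale \<i> (b - ctranspose b) ** ctranspose V"
      unfolding x_def y_def congruence_combinations f by auto
    have nV: "n = V ** flat_normal b ** ctranspose V"
      using n f by simp
    note pos = flat_normal_positive[OF b]
    note orth = flat_normal_orthogonal[OF b]
    have "minner (b + ctranspose b) (flat_normal b) = 0"
      "minner (cscale \<i> (b - ctranspose b)) (flat_normal b) = 0"
      using orth unfolding minner_trace_free[OF orth(4)]
      by (simp_all add: mat2_distribs trace_add trace_sub trace_cscale)
    moreover have "positive_triple X q x y n"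
    proof (cases X)
      case Euclidean
      then show ?thesis
        using pos V' by (simp add: nV xy)
    next
      case Hyperbolic
      then show ?thesis
        using pos V nV xy unfolding m_def by auto
    qed
    ultimately show ?thesis
      using orth(3) unfolding nV xy minner_congruence[OF V(1)] by auto
  qed
  show ?thesis
  proof (intro iffI bwd)
    assume h: "minner x n = 0 \<and> minner y n = 0 \<and> minner n n = 1 \<and> positive_triple X q x y n"
    show "n = normal_of m a"
    proof (cases X)
      case Euclidean
      then show ?thesis
        using fwd[of "mat 1" n x y] h by (simp add: m_def)
    next
      case Hyperbolic
      with h obtain V a' b' c' where "det V = 1" "m = V ** ctranspose V" "positive_triple0 a' b' c'"
        "x = V ** a' ** ctranspose V" "y = V ** b' ** ctranspose V" "n = V ** c' ** ctranspose V"
        unfolding m_def by auto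
      then show ?thesis
        using fwd h by blast
    qed
  qed
qed

lemma minner_gram_mult:
  assumes "det m = 1" "trace l = 0"
  shows "minner (m ** k) (m ** l) = trace (k ** l) / 2"
proof -
  have "m ** k ** adjugate (m ** l) = - (m ** (k ** l) ** adjugate m)"
    using assms by (simp add: adjugate_mult adjugate_trace_free mat2_mult_minus matrix_mul_assoc)
  then show ?thesis
    using trace_conj_adjugate[OF assms(1)] by (simp add: minner_def trace_minus)
qed

text \<open>The derivative \<open>m a\<close> of a conformal immersion at one point, with \<open>a\<close> trace free and singular. With respect to the
  form \<open>m\<close>, the matrices \<open>a\<close> and \<open>a\<^sup>#\<close> generate a Clifford algebra: both square to zero and their anticommutator is
  the scalar \<open>t > 0\<close>.\<close>

locale tangent_direction =
  fixes X :: ambient and q m a :: mat2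
  assumes q: "q \<in> ambient_space X" and m: "m = gram X q"
    and a: "trace a = 0" "det a = 0" "a \<noteq> 0"
begin

abbreviation "s \<equiv> sharp m a"
abbreviation "t \<equiv> trace (a ** s)"
abbreviation "N \<equiv> normal_of m a"

lemma det_m: "det m = 1"
  using q m by (cases X) auto

lemma hermitian_m: "ctranspose m = m"
  using q m by (cases X) (auto simp: hermitian_def)

lemma m_s: "m ** s = ctranspose a ** m"
  by (simp add: sharp_def matrix_mul_assoc adjugate_cancel[OF det_m])

lemma t_pos: obtains r where "r > 0" "t = of_real r"
proof -
  obtain V where "det V = 1" "m = V ** ctranspose V"
    using gram_factorization[OF q] m by metis
  from factored_sharp[OF this, of a] show ?thesis
    using a that trace_mult_ctranspose_pos by metis
qed

lemma t_nz: "t \<noteq> 0"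
  using t_pos by (metis of_real_eq_0_iff less_irrefl)

lemma trace_s: "trace s = 0" and det_s: "det s = 0"
proof -
  have "s = adjugate m ** ctranspose a ** adjugate (adjugate m)"
    by (simp add: sharp_def)
  moreover have "det (adjugate m) = 1"
    by (simp add: det_adjugate det_m)
  ultimately show "trace s = 0" "det s = 0"
    using a by (metis trace_conj_adjugate trace_ctranspose complex_cnj_zero,
        metis det_conj_adjugate det_ctranspose complex_cnj_zero)
qed

lemma anticommutator: "a ** s + s ** a = cscale t (mat 1)"
  by (rule trace_free_anticommutator) (fact a(1) trace_s)+

lemma aa: "a ** a = 0" and ss: "s ** s = 0"
  using nilpotent_square a trace_s det_s by auto

lemma asa: "a ** s ** a = cscale t a"
  using arg_cong[OF anticommutator, of "\<lambda>x. x ** a"]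
  by (simp add: mat2_add_rdistrib cscale_mult_left) (simp add: matrix_mul_assoc[symmetric] aa)

lemma sas: "s ** a ** s = cscale t s"
  using arg_cong[OF anticommutator, of "\<lambda>x. x ** s"]
  by (simp add: mat2_add_rdistrib cscale_mult_left) (simp add: matrix_mul_assoc[symmetric] ss)

lemma trace_commutator: "trace (s ** a - a ** s) = 0"
  by (simp add: trace_sub trace_mul_sym[of a])

lemma minner_normal: "minner (m ** k) N = trace (k ** (s ** a - a ** s)) / (2 * t)"
proof -
  have "N = m ** cscale (1 / t) (s ** a - a ** s)"
    by (simp add: normal_of_def cscale_mult_right)
  moreover have "trace (cscale (1 / t) (s ** a - a ** s)) = 0"
    by (simp add: trace_cscale trace_commutator)
  ultimately have "minner (m ** k) N = trace (k ** cscale (1 / t) (s ** a - a ** s)) / 2"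
    by (metis minner_gram_mult det_m)
  then show ?thesis
    by (simp add: cscale_mult_right trace_cscale field_simps)
qed

lemma normal_orthogonal: "minner (m ** a) N = 0" "minner (ctranspose a ** m) N = 0"
proof -
  have 1: "trace (a ** (s ** a - a ** s)) = 0"
    by (simp add: mat2_diff_ldistrib matrix_mul_assoc aa asa trace_cscale a)
  have 2: "trace (s ** (s ** a - a ** s)) = 0"
    by (simp add: mat2_diff_ldistrib matrix_mul_assoc ss sas trace_cscale trace_s trace_minus)
  show "minner (m ** a) N = 0" "minner (ctranspose a ** m) N = 0"
    using minner_normal[of a] minner_normal[of s] 1 2 by (simp_all add: m_s)
qed

lemma minner_tangents: "minner (m ** a) (ctranspose a ** m) = t / 2"
  by (metis m_s minner_gram_mult det_m trace_s)

lemma minner_normal_square: "minner (ctranspose a ** m ** a) N = t / 2"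
proof -
  have "s ** a ** (s ** a - a ** s) = cscale t (s ** a)"
    by (simp add: mat2_diff_ldistrib matrix_mul_assoc sas cscale_mult_left)
      (simp add: matrix_mul_assoc[symmetric] aa)
  then have "minner (m ** (s ** a)) N = trace (s ** a) / 2"
    using t_nz by (simp only: minner_normal trace_cscale) simp
  then show ?thesis
    by (simp add: matrix_mul_assoc m_s trace_mul_sym[of s])
qed

text \<open>This will identify the Hopf coefficient, with \<open>k\<close> the derivative of \<open>a\<close>: the inner product with the normal is the eigenvalue.\<close>

lemma minner_normal_eigen:
  assumes "a ** k = cscale c a" "k ** a = - cscale c a"
  shows "minner (m ** k) N = c"
proof -
  have "trace (k ** (s ** a)) = trace (s ** (a ** k))"
    by (subst trace_mul_sym) (simp add: matrix_mul_assoc)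
  also have "\<dots> = c * t"
    by (simp add: assms cscale_mult_right trace_cscale trace_mul_sym[of s])
  finally have "trace (k ** (s ** a - a ** s)) = 2 * t * c"
    by (simp add: mat2_diff_ldistrib trace_sub)
      (simp add: matrix_mul_assoc assms mat2_mult_minus cscale_mult_left trace_minus trace_cscale)
  then show ?thesis
    using t_nz by (simp add: minner_normal)
qed

lemma base_plus_normal: "m + N = cscale (2 / t) (ctranspose a ** m ** a)"
proof -
  have 1: "m ** (a ** s + s ** a) = cscale t m"
    by (simp add: anticommutator cscale_mult_right)
  have "cscale t (m + N) = m ** (a ** s + s ** a) + m ** (s ** a - a ** s)"
    using t_nz by (simp add: 1 cscale_add normal_of_def cscale_cscale)
  also have "\<dots> = cscale 2 (m ** s ** a)"
    by (simp add: mat2_distribs matrix_mul_assoc) (simp add: mat2_eq_iff cscale_entry)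
  finally have "cscale (1/t) (cscale t (m + N)) = cscale (1/t) (cscale 2 (m ** s ** a))"
    by simp
  then show ?thesis
    using t_nz by (simp add: cscale_cscale m_s)
qed

text \<open>The matrices \<open>m\<close>, \<open>m a\<close>, \<open>a\<^sup>* m\<close> and \<open>N\<close> span all complex matrices, and \<open>m k\<close> is
  orthogonal to all four; orthogonality to \<open>a\<^sup>* m\<close> is the conjugate of orthogonality to \<open>m a\<close>. This is how the mean curvature controls the whole
  mixed second derivative.\<close>

lemma hermitian_zero:
  assumes h: "ctranspose (m ** k) = m ** k" and "trace k = 0" "trace (a ** k) = 0"
    "minner (m ** k) N = 0"
  shows "k = 0"
proof -
  have h': "ctranspose k ** m = m ** k"
    using h by (simp add: ctranspose_mult hermitian_m)
  have "s ** k = adjugate m ** ctranspose a ** (m ** k)"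
    by (simp add: sharp_def matrix_mul_assoc)
  also have "\<dots> = adjugate m ** ctranspose (k ** a) ** m"
    by (simp only: h'[symmetric] ctranspose_mult matrix_mul_assoc)
  finally have "trace (s ** k) = trace (m ** (adjugate m ** ctranspose (k ** a)))"
    by (simp add: trace_mul_sym[of m])
  also have "\<dots> = cnj (trace (k ** a))"
    by (simp add: matrix_mul_assoc adjugate_cancel[OF det_m] trace_ctranspose)
  finally have sk: "trace (s ** k) = 0"
    using assms(3) by (simp add: trace_mul_sym[of k])
  have ac: "a ** k + k ** a = 0" "s ** k + k ** s = 0"
    using trace_free_anticommutator[OF a(1) assms(2)] trace_free_anticommutator[OF trace_s assms(2)]
    by (simp_all add: assms(3) sk)
  then have kk: "k ** a = - (a ** k)" "k ** s = - (s ** k)"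
    by (simp_all add: add_eq_0_iff)
  define L where "L = s ** a - a ** s"
  have "k ** (a ** s) = (a ** s) ** k"
    by (simp add: matrix_mul_assoc kk mat2_mult_minus) (simp add: matrix_mul_assoc[symmetric] kk mat2_mult_minus)
  moreover have "k ** (s ** a) = (s ** a) ** k"
    by (simp add: matrix_mul_assoc kk mat2_mult_minus) (simp add: matrix_mul_assoc[symmetric] kk mat2_mult_minus)
  ultimately have comm: "k ** L = L ** k"
    by (simp add: L_def mat2_distribs)
  have "trace (k ** L) = 0"
    using assms(4) t_nz by (simp add: minner_normal L_def)
  then have "k ** L + L ** k = 0"
    using trace_free_anticommutator[OF assms(2), of L] trace_commutator by (simp add: L_def)
  then have "k ** L = 0"
    by (simp add: comm) (simp add: mat2_eq_iff)
  then have "k ** (L ** L) = 0"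
    by (simp add: matrix_mul_assoc)
  moreover have "L ** L = cscale t (a ** s + s ** a)"
  proof -
    have "L ** L = (s ** a ** s) ** a - s ** (a ** a) ** s - (a ** (s ** s) ** a - (a ** s ** a) ** s)"
      by (simp add: L_def mat2_distribs matrix_mul_assoc)
    also have "\<dots> = cscale t (a ** s + s ** a)"
      by (simp add: aa ss asa sas cscale_mult_left cscale_add add.commute)
    finally show ?thesis .
  qed
  ultimately have "cscale (t * t) k = 0"
    by (simp add: anticommutator cscale_cscale cscale_mult_right)
  then show "k = 0"
    using t_nz by (simp add: cscale_eq_0_iff)
qed

end


section \<open>The Gauss map\<close>

lemma St_rank_one:
  assumes "\<nu> \<noteq> (0::complex^2)"
  shows "St (mat 1 - (2 / (norm \<nu>)\<^sup>2) *\<^sub>R (\<chi> i j. \<nu>$i * cnj (\<nu>$j))) = sphere_quotient (\<nu>$1) (\<nu>$2)"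
proof -
  have uniq: "sphere_quotient (\<mu>$1) (\<mu>$2) = sphere_quotient (\<nu>$1) (\<nu>$2)"
    if \<mu>: "\<mu> \<noteq> (0::complex^2)" and
      eq: "mat 1 - (2 / (norm \<nu>)\<^sup>2) *\<^sub>R (\<chi> i j. \<nu>$i * cnj (\<nu>$j)) =
       (mat 1 - (2 / (norm \<mu>)\<^sup>2) *\<^sub>R (\<chi> i j. \<mu>$i * cnj (\<mu>$j)) :: mat2)" for \<mu>
  proof -
    define k where "k = complex_of_real (2 / (norm \<nu>)\<^sup>2)"
    define l where "l = complex_of_real (2 / (norm \<mu>)\<^sup>2)"
    have kl: "k \<noteq> 0" "l \<noteq> 0"
      using \<mu> assms by (simp_all add: k_def l_def)
    have e: "k * (\<nu>$1 * cnj (\<nu>$2)) = l * (\<mu>$1 * cnj (\<mu>$2))"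
      "k * (\<nu>$2 * cnj (\<nu>$2)) = l * (\<mu>$2 * cnj (\<mu>$2))"
      using eq unfolding mat2_eq_iff
      by (simp_all add: scaleR_entry k_def l_def del: vector_scaleR_component)
    show ?thesis
    proof (cases "\<nu>$2 = 0")
      case True
      then show ?thesis
        using e(2) kl by (simp add: sphere_quotient_def)
    next
      case False
      then have "\<mu>$2 \<noteq> 0"
        using e(2) kl by auto
      have "\<mu>$1 / \<mu>$2 = (l * (\<mu>$1 * cnj (\<mu>$2))) / (l * (\<mu>$2 * cnj (\<mu>$2)))"
        using \<open>\<mu>$2 \<noteq> 0\<close> kl by simp
      also have "\<dots> = (k * (\<nu>$1 * cnj (\<nu>$2))) / (k * (\<nu>$2 * cnj (\<nu>$2)))"
        by (simp only: e)
      also have "\<dots> = \<nu>$1 / \<nu>$2"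
        using False kl by simp
      finally show ?thesis
        using False \<open>\<mu>$2 \<noteq> 0\<close> by (simp add: sphere_quotient_def)
    qed
  qed
  show ?thesis
    unfolding St_def
  proof (rule the_equality)
    show "\<exists>\<nu>'. \<nu>' \<noteq> 0 \<and> sphere_quotient (\<nu> $ 1) (\<nu> $ 2) = sphere_quotient (\<nu>' $ 1) (\<nu>' $ 2) \<and>
         mat 1 - (2 / (norm \<nu>)\<^sup>2) *\<^sub>R (\<chi> i j. \<nu> $ i * cnj (\<nu> $ j)) =
         mat 1 - (2 / (norm \<nu>')\<^sup>2) *\<^sub>R (\<chi> i j. \<nu>' $ i * cnj (\<nu>' $ j))"
      using assms by blast
  qed (use uniq in metis)
qed

text \<open>The image of a nilpotent matrix as a point of the Riemann sphere.\<close>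

definition image_slope :: "mat2 \<Rightarrow> complex option" where
  "image_slope b = (if b$2$1 = 0 then None else Some (b$1$1 / b$2$1))"

lemma St_flat_normal:
  assumes b: "trace b = 0" "det b = 0" "b \<noteq> 0"
  shows "St (flat_normal b) = image_slope b"
proof -
  \<comment> \<open>A vector that spans the image of the matrix; the first column vanishes exactly when the slope is infinite.\<close>
  define \<nu> :: "complex^2" where "\<nu> = (if b$2$1 = 0 then vector [1, 0] else vector [b$1$1, b$2$1])"
  have \<nu>: "\<nu>$1 = (if b$2$1 = 0 then 1 else b$1$1)" "\<nu>$2 = (if b$2$1 = 0 then 0 else b$2$1)"
    by (simp_all add: \<nu>_def)
  have nz: "\<nu> \<noteq> 0"
    using \<nu> by (metis zero_index zero_neq_one)
  define n where "n = complex_of_real ((norm \<nu>)\<^sup>2)"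
  have n: "n = \<nu>$1 * cnj (\<nu>$1) + \<nu>$2 * cnj (\<nu>$2)" "n \<noteq> 0"
    by (simp add: n_def norm_vec_def L2_set_def sum_2 flip: complex_norm_square)
       (simp add: n_def nz)
  define t where "t = trace (b ** ctranspose b)"
  have t: "t \<noteq> 0"
    using trace_mult_ctranspose_pos[OF b(3)] unfolding t_def by (metis of_real_eq_0_iff less_irrefl)
  have b22: "b$2$2 = - b$1$1" and dt: "b$1$1 * b$1$1 = - (b$1$2 * b$2$1)"
    using b by (simp_all add: mat2_simps add_eq_0_iff) (metis minus_equation_iff)
  have dt': "cnj (b$1$1) * cnj (b$1$1) = - (cnj (b$1$2) * cnj (b$2$1))"
    using arg_cong[OF dt, of cnj] by simp
  have "flat_normal b = cscale (1 / t) (cscale t (mat 1) - cscale 2 (b ** ctranspose b))"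
  proof -
    have "ctranspose b ** b = cscale t (mat 1) - b ** ctranspose b"
      using nilpotent_mult_ctranspose(1)[OF b(1,2)] by (simp add: t_def eq_diff_eq add.commute)
    then have "ctranspose b ** b - b ** ctranspose b = cscale t (mat 1) - cscale 2 (b ** ctranspose b)"
      by (simp only:) (simp add: mat2_eq_iff cscale_entry)
    then show ?thesis
      by (simp only: flat_normal_def t_def)
  qed
  also have "\<dots> = mat 1 - cscale (2 / t) (b ** ctranspose b)"
    using t by (simp add: cscale_diff cscale_cscale)
  also have "cscale (2 / t) (b ** ctranspose b) = (2 / (norm \<nu>)\<^sup>2) *\<^sub>R (\<chi> i j. \<nu>$i * cnj (\<nu>$j))"
  proof -
    have "cscale n (b ** ctranspose b) = cscale t (\<chi> i j. \<nu>$i * cnj (\<nu>$j))"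
    proof (cases "b$2$1 = 0")
      case True
      then show ?thesis
        using dt b22 by (simp add: n(1) t_def mat2_simps \<nu>)
    next
      case False
      then show ?thesis
        unfolding n(1) t_def mat2_simps using b22 dt dt'
        by (simp add: \<nu>) algebra
    qed
    then have "cscale (2 / n / t) (cscale n (b ** ctranspose b)) = cscale (2 / n / t) (cscale t (\<chi> i j. \<nu>$i * cnj (\<nu>$j)))"
      by simp
    then have "cscale (2 / t) (b ** ctranspose b) = cscale (2 / n) (\<chi> i j. \<nu>$i * cnj (\<nu>$j))"
      using n(2) t by (simp add: cscale_cscale)
    also have "\<dots> = (2 / (norm \<nu>)\<^sup>2) *\<^sub>R (\<chi> i j. \<nu>$i * cnj (\<nu>$j))"
      by (simp add: mat2_eq_iff cscale_entry scaleR_entry n_def del: vector_scaleR_component)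
    finally show ?thesis .
  qed
  finally show ?thesis
    using St_rank_one[OF nz] by (simp add: \<nu> image_slope_def sphere_quotient_def)
qed

text \<open>A singular matrix is \<open>v w\<^sup>T\<close>, and \<open>a\<^sup>* m a\<close> is the rank one matrix of \<open>w\<close> scaled by \<open>v\<^sup>* m v\<close>. So after
  normalisation of the trace \<open>m\<close> drops out, and the hyperbolic Gauss map has the Euclidean form.\<close>

lemma singular_congruence:
  assumes "det a = 0"
  shows "cscale (trace (ctranspose a ** a)) (ctranspose a ** m ** a) =
    cscale (trace (ctranspose a ** m ** a)) (ctranspose a ** a)"
proof -
  have 1: "a$1$1 * a$2$2 = a$1$2 * a$2$1"
    using assms by (simp add: det_2)
  have 2: "cnj (a$1$1) * cnj (a$2$2) = cnj (a$1$2) * cnj (a$2$1)"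
    using arg_cong[OF 1, of cnj] by simp
  show ?thesis
    unfolding mat2_simps using 1 2 by (intro conjI; algebra)
qed

context tangent_direction
begin

lemma trace_base_plus_normal: "trace (ctranspose a ** m ** a) \<noteq> 0"
proof
  assume "trace (ctranspose a ** m ** a) = 0"
  then have "cscale (trace (ctranspose a ** a)) (ctranspose a ** m ** a) = 0"
    using singular_congruence[OF a(2), of m] by simp
  moreover have "trace (ctranspose a ** a) \<noteq> 0"
    using trace_mult_ctranspose_pos[OF a(3)]
    by (metis of_real_eq_0_iff less_irrefl trace_mul_sym)
  ultimately have "ctranspose a ** m ** a = 0"
    by (simp add: cscale_eq_0_iff)
  then show False
    using minner_normal_square t_nz by (simp add: minner_def)
qed

lemma St_hyperbolic:
  "St (cscale (2 / trace (m + N)) (m + N) - mat 1) = image_slope a"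
proof -
  let ?k = "trace (ctranspose a ** m ** a)" and ?t = "trace (a ** ctranspose a)"
  have tt: "trace (ctranspose a ** a) = ?t"
    by (rule trace_mul_sym)
  have tnz: "?t \<noteq> 0"
    using trace_mult_ctranspose_pos[OF a(3)] by (metis of_real_eq_0_iff less_irrefl)
  have "cscale (2 / trace (m + N)) (m + N) = cscale (2 / ?k) (ctranspose a ** m ** a)"
    unfolding base_plus_normal trace_cscale using trace_base_plus_normal t_nz
    by (simp add: cscale_cscale)
  also have "\<dots> = cscale (2 / ?k / ?t) (cscale ?t (ctranspose a ** m ** a))"
    using tnz by (simp add: cscale_cscale)
  also have "\<dots> = cscale (2 / ?t) (ctranspose a ** a)"
    using singular_congruence[OF a(2), of m] trace_base_plus_normal
    by (simp add: tt cscale_cscale)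
  also have "\<dots> - mat 1 = cscale (1 / ?t) (cscale 2 (ctranspose a ** a) - cscale ?t (mat 1))"
    using tnz by (simp add: cscale_cscale cscale_diff)
  also have "\<dots> = flat_normal a"
    unfolding nilpotent_mult_ctranspose(1)[OF a(1,2), symmetric] flat_normal_def
    by (simp add: mat2_eq_iff cscale_entry)
  finally show ?thesis
    using St_flat_normal[OF a] by simp
qed

lemma flat_normal_of: "m = mat 1 \<Longrightarrow> N = flat_normal a"
  by (simp add: normal_of_def flat_normal_def sharp_def)

end


section \<open>Wirtinger derivatives of matrix functions\<close>

text \<open>The derivatives \<open>\<partial>/\<partial>z\<close> and \<open>\<partial>/\<partial>zbar\<close>; the functions \<open>dz\<close> and \<open>dzbar\<close> are these in a chart.\<close>

definition wz :: "(complex \<Rightarrow> mat2) \<Rightarrow> complex \<Rightarrow> mat2" where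
  "wz F w = cscale (1/2) (frechet_derivative F (at w) 1 - cscale \<i> (frechet_derivative F (at w) \<i>))"

definition wzb :: "(complex \<Rightarrow> mat2) \<Rightarrow> complex \<Rightarrow> mat2" where
  "wzb F w = cscale (1/2) (frechet_derivative F (at w) 1 + cscale \<i> (frechet_derivative F (at w) \<i>))"

lemma wz_wzb_has_derivative:
  assumes "(F has_derivative D) (at w)"
  shows "wz F w = cscale (1/2) (D 1 - cscale \<i> (D \<i>))" "wzb F w = cscale (1/2) (D 1 + cscale \<i> (D \<i>))"
  using frechet_derivative_at[OF assms] by (simp_all add: wz_def wzb_def)

lemma frechet_from_wirtinger:
  "frechet_derivative F (at w) 1 = wz F w + wzb F w"
  "frechet_derivative F (at w) \<i> = cscale \<i> (wz F w - wzb F w)"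
  by (simp_all add: wz_def wzb_def mat2_simps field_simps)

lemma has_derivative_wirtinger:
  assumes "F differentiable at w"
  shows "(F has_derivative (\<lambda>h. cscale h (wz F w) + cscale (cnj h) (wzb F w))) (at w)"
proof -
  let ?D = "frechet_derivative F (at w)"
  have D: "(F has_derivative ?D) (at w)"
    using assms by (simp add: frechet_derivative_works)
  interpret D: bounded_linear ?D
    using D by (rule has_derivative_bounded_linear)
  have "?D h = cscale h (wz F w) + cscale (cnj h) (wzb F w)" for h
  proof -
    have "?D h = ?D (Re h *\<^sub>R 1 + Im h *\<^sub>R \<i>)"
      by (rule arg_cong[of _ _ ?D]) (simp add: complex_eq_iff)
    also have "\<dots> = Re h *\<^sub>R (wz F w + wzb F w) + Im h *\<^sub>R cscale \<i> (wz F w - wzb F w)"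
      unfolding D.add D.scaleR frechet_from_wirtinger ..
    also have "\<dots> = cscale h (wz F w) + cscale (cnj h) (wzb F w)"
      by (subst (9) complex_eq, subst (9) complex_eq)
         (simp add: mat2_eq_iff scaleR_entry cscale_entry complex_eq_iff algebra_simps
            del: vector_scaleR_component)
    finally show ?thesis .
  qed
  then show ?thesis
    using D by (metis (no_types, lifting) ext)
qed

lemma bounded_bilinear_mat2_mult: "bounded_bilinear ((**) :: mat2 \<Rightarrow> mat2 \<Rightarrow> mat2)"
  unfolding bilinear_conv_bounded_bilinear[symmetric] bilinear_def
  by (intro conjI allI linearI)
     (simp_all add: mat2_simps scaleR_entry algebra_simps del: vector_scaleR_component)

lemma bounded_linear_ctranspose: "bounded_linear ctranspose"
  unfolding linear_conv_bounded_linear[symmetric]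
  by (intro linearI) (simp_all add: mat2_simps scaleR_entry algebra_simps del: vector_scaleR_component)

lemma bounded_linear_adjugate: "bounded_linear adjugate"
  unfolding linear_conv_bounded_linear[symmetric]
  by (intro linearI) (simp_all add: mat2_simps scaleR_entry algebra_simps del: vector_scaleR_component)

lemma bounded_linear_cscale: "bounded_linear (cscale k)"
  unfolding linear_conv_bounded_linear[symmetric]
  by (intro linearI) (simp_all add: mat2_simps scaleR_entry algebra_simps del: vector_scaleR_component)

lemma bounded_bilinear_cscale: "bounded_bilinear cscale"
  unfolding bilinear_conv_bounded_bilinear[symmetric] bilinear_def
  by (intro conjI allI linearI)
     (simp_all add: mat2_simps scaleR_entry algebra_simps scaleR_conv_of_real[where 'a=complex] del: vector_scaleR_component)

lemma bounded_linear_trace: "bounded_linear (trace :: mat2 \<Rightarrow> complex)"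
  unfolding linear_conv_bounded_linear[symmetric]
  by (intro linearI)
     (simp_all add: trace_2 scaleR_entry algebra_simps scaleR_conv_of_real[where 'a=complex] del: vector_scaleR_component)

lemma bounded_linear_entry: "bounded_linear (\<lambda>A::mat2. A$i$j)"
  unfolding linear_conv_bounded_linear[symmetric]
  by (intro linearI)
     (simp_all add: scaleR_entry algebra_simps scaleR_conv_of_real[where 'a=complex] del: vector_scaleR_component)

lemma differentiable_bounded_bilinear:
  assumes "bounded_bilinear B" "F differentiable at w" "G differentiable at w"
  shows "(\<lambda>u. B (F u) (G u)) differentiable at w"
  using assms bounded_bilinear.FDERIV[OF assms(1)] unfolding differentiable_def by blast

lemma differentiable_bounded_linear:
  assumes "bounded_linear L" "F differentiable at w"
  shows "(\<lambda>u. L (F u)) differentiable at w"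
  using assms bounded_linear.has_derivative[OF assms(1)] unfolding differentiable_def by blast

lemmas mat2_differentiable =
  differentiable_bounded_bilinear[OF bounded_bilinear_mat2_mult]
  differentiable_bounded_linear[OF bounded_linear_ctranspose]
  differentiable_bounded_linear[OF bounded_linear_adjugate]
  differentiable_bounded_linear[OF bounded_linear_cscale]
  differentiable_bounded_bilinear[OF bounded_bilinear_cscale]
  differentiable_bounded_linear[OF bounded_linear_trace]

lemma wirtinger_mult:
  assumes "F differentiable at w" "G differentiable at w"
  shows "wz (\<lambda>u. F u ** G u) w = wz F w ** G w + F w ** wz G w"
    "wzb (\<lambda>u. F u ** G u) w = wzb F w ** G w + F w ** wzb G w"
proof -
  have "((\<lambda>u. F u ** G u) has_derivative
     (\<lambda>h. F w ** frechet_derivative G (at w) h + frechet_derivative F (at w) h ** G w)) (at w)"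
    using assms by (intro bounded_bilinear.FDERIV[OF bounded_bilinear_mat2_mult]; simp add: frechet_derivative_works)
  from wz_wzb_has_derivative[OF this]
  show "wz (\<lambda>u. F u ** G u) w = wz F w ** G w + F w ** wz G w"
    "wzb (\<lambda>u. F u ** G u) w = wzb F w ** G w + F w ** wzb G w"
    by (simp_all add: wz_def wzb_def mat2_distribs)
qed

lemma wirtinger_bounded_linear:
  assumes L: "bounded_linear L" and F: "F differentiable at w"
    and c: "\<And>k A. L (cscale k A) = cscale k (L A)"
  shows "wz (\<lambda>u. L (F u)) w = L (wz F w)" "wzb (\<lambda>u. L (F u)) w = L (wzb F w)"
proof -
  interpret bounded_linear L by fact
  have "((\<lambda>u. L (F u)) has_derivative (\<lambda>h. L (frechet_derivative F (at w) h))) (at w)"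
    using F by (intro has_derivative) (simp add: frechet_derivative_works)
  from wz_wzb_has_derivative[OF this]
  show "wz (\<lambda>u. L (F u)) w = L (wz F w)" "wzb (\<lambda>u. L (F u)) w = L (wzb F w)"
    by (simp_all add: wz_def wzb_def c add diff)
qed

lemma wirtinger_ctranspose:
  assumes F: "F differentiable at w"
  shows "wz (\<lambda>u. ctranspose (F u)) w = ctranspose (wzb F w)"
    "wzb (\<lambda>u. ctranspose (F u)) w = ctranspose (wz F w)"
proof -
  have "((\<lambda>u. ctranspose (F u)) has_derivative (\<lambda>h. ctranspose (frechet_derivative F (at w) h))) (at w)"
    using F by (intro bounded_linear.has_derivative[OF bounded_linear_ctranspose])
      (simp add: frechet_derivative_works)
  from wz_wzb_has_derivative[OF this]
  show "wz (\<lambda>u. ctranspose (F u)) w = ctranspose (wzb F w)"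
    "wzb (\<lambda>u. ctranspose (F u)) w = ctranspose (wz F w)"
    by (simp_all add: wz_def wzb_def ctranspose_cscale ctranspose_add ctranspose_diff)
      (simp_all add: mat2_simps)
qed

lemma wirtinger_add:
  assumes "F differentiable at w" "G differentiable at w"
  shows "wz (\<lambda>u. F u + G u) w = wz F w + wz G w" "wzb (\<lambda>u. F u + G u) w = wzb F w + wzb G w"
proof -
  have "((\<lambda>u. F u + G u) has_derivative
     (\<lambda>h. frechet_derivative F (at w) h + frechet_derivative G (at w) h)) (at w)"
    using assms by (intro has_derivative_add) (simp_all add: frechet_derivative_works)
  from wz_wzb_has_derivative[OF this]
  show "wz (\<lambda>u. F u + G u) w = wz F w + wz G w" "wzb (\<lambda>u. F u + G u) w = wzb F w + wzb G w"
    by (simp_all add: wz_def wzb_def) (simp_all add: mat2_simps algebra_simps)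
qed

lemma wirtinger_const [simp]: "wz (\<lambda>u. A) w = 0" "wzb (\<lambda>u. A) w = 0"
  using wz_wzb_has_derivative[of "\<lambda>u. A" "\<lambda>h. 0" w] by (simp_all add: mat2_eq_iff cscale_entry)

section \<open>Locality and holomorphic matrix functions\<close>

lemma frechet_derivative_cong:
  assumes "open W" "w \<in> W" "\<And>u. u \<in> W \<Longrightarrow> F u = G u"
  shows "frechet_derivative F (at w) = frechet_derivative G (at w)"
proof -
  have "(F has_derivative D) (at w) \<longleftrightarrow> (G has_derivative D) (at w)" for D
    using assms has_derivative_transform_within_open by metis
  then show ?thesis
    by (simp add: frechet_derivative_def)
qed

lemma wirtinger_cong:
  assumes "open W" "w \<in> W" "\<And>u. u \<in> W \<Longrightarrow> F u = G u"
  shows "wz F w = wz G w" "wzb F w = wzb G w"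
  using frechet_derivative_cong[OF assms] by (simp_all add: wz_def wzb_def)

lemma differentiable_cong:
  assumes "open W" "w \<in> W" "\<And>u. u \<in> W \<Longrightarrow> F u = G u" "F differentiable at w"
  shows "G differentiable at w"
  using assms has_derivative_transform_within_open unfolding differentiable_def by metis

lemma mat2_has_derivative_entries:
  assumes "\<And>i j. ((\<lambda>u. F u $ i $ j) has_derivative (\<lambda>h. D h $ i $ j)) (at w)"
  shows "(F has_derivative (D :: complex \<Rightarrow> mat2)) (at w)"
proof -
  \<comment> \<open>The matrix units.\<close>
  define E :: "2 \<Rightarrow> 2 \<Rightarrow> mat2" where "E i j = (\<chi> k l. if k = i \<and> l = j then 1 else 0)" for i j
  have E: "A = cscale (A$1$1) (E 1 1) + cscale (A$1$2) (E 1 2) + cscale (A$2$1) (E 2 1) + cscale (A$2$2) (E 2 2)" for A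
    by (simp add: mat2_eq_iff cscale_entry E_def)
  note L = bounded_linear.has_derivative[OF bounded_bilinear.bounded_linear_left[OF bounded_bilinear_cscale]]
  have "((\<lambda>u. cscale (F u$1$1) (E 1 1) + cscale (F u$1$2) (E 1 2) + cscale (F u$2$1) (E 2 1) + cscale (F u$2$2) (E 2 2))
     has_derivative (\<lambda>h. cscale (D h$1$1) (E 1 1) + cscale (D h$1$2) (E 1 2) + cscale (D h$2$1) (E 2 1) + cscale (D h$2$2) (E 2 2))) (at w)"
    by (intro has_derivative_add L assms)
  then show ?thesis
    unfolding E[symmetric] .
qed

lemma holomorphic_mat_has_derivative:
  assumes "holomorphic_mat_on F W" "open W" "w \<in> W"
  shows "(F has_derivative (\<lambda>h. cscale h (deriv_mat F w))) (at w)"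
proof (rule mat2_has_derivative_entries)
  fix i j
  have "((\<lambda>u. F u $ i $ j) has_field_derivative deriv (\<lambda>u. F u $ i $ j) w) (at w)"
    using assms by (intro holomorphic_derivI) (auto simp: holomorphic_mat_on_def)
  then show "((\<lambda>u. F u $ i $ j) has_derivative (\<lambda>h. cscale h (deriv_mat F w) $ i $ j)) (at w)"
    by (simp add: has_field_derivative_def cscale_entry deriv_mat_def mult.commute[of _ "deriv _ _"])
qed

lemma holomorphic_mat_wirtinger:
  assumes "holomorphic_mat_on F W" "open W" "w \<in> W"
  shows "F differentiable at w" "wz F w = deriv_mat F w" "wzb F w = 0"
proof -
  note d = holomorphic_mat_has_derivative[OF assms]
  show "F differentiable at w"
    using d by (auto simp: differentiable_def)
  show "wz F w = deriv_mat F w" "wzb F w = 0"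
    using wz_wzb_has_derivative[OF d] by (simp_all add: mat2_simps)
qed

lemma entry_has_field_derivative:
  assumes "F differentiable at w" "wzb F w = 0"
  shows "((\<lambda>u. F u $ i $ j) has_field_derivative wz F w $ i $ j) (at w)"
proof -
  have "((\<lambda>u. F u $ i $ j) has_derivative (\<lambda>h. (cscale h (wz F w) + cscale (cnj h) (wzb F w)) $ i $ j)) (at w)"
    by (rule bounded_linear.has_derivative[OF bounded_linear_entry has_derivative_wirtinger[OF assms(1)]])
  then show ?thesis
    using assms(2) by (simp add: has_field_derivative_def cscale_entry mult.commute[of _ "wz _ _ $ _ $ _"])
qed

lemma holomorphic_mat_onI:
  assumes "open W" "\<And>w. w \<in> W \<Longrightarrow> F differentiable at w" "\<And>w. w \<in> W \<Longrightarrow> wzb F w = 0"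
  shows "holomorphic_mat_on F W" "w \<in> W \<Longrightarrow> wz F w = deriv_mat F w"
proof -
  show *: "holomorphic_mat_on F W"
    unfolding holomorphic_mat_on_def
    using entry_has_field_derivative[OF assms(2,3)] assms(1) by (auto simp: holomorphic_on_open)
  show "w \<in> W \<Longrightarrow> wz F w = deriv_mat F w"
    using holomorphic_mat_wirtinger[OF * assms(1)] by simp
qed

lemma holomorphic_mat_mult:
  "holomorphic_mat_on F W \<Longrightarrow> holomorphic_mat_on G W \<Longrightarrow> holomorphic_mat_on (\<lambda>w. F w ** G w) W"
  unfolding holomorphic_mat_on_def matrix_mult_entry by (auto intro!: holomorphic_intros)

lemma holomorphic_mat_cscale:
  "holomorphic_mat_on F W \<Longrightarrow> holomorphic_mat_on (\<lambda>w. cscale k (F w)) W"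
  unfolding holomorphic_mat_on_def cscale_entry by (auto intro!: holomorphic_intros)

lemma holomorphic_mat_const: "holomorphic_mat_on (\<lambda>w. A) W"
  unfolding holomorphic_mat_on_def by (auto intro!: holomorphic_intros)

lemma holomorphic_mat_adjugate:
  "holomorphic_mat_on F W \<Longrightarrow> holomorphic_mat_on (\<lambda>w. adjugate (F w)) W"
  unfolding holomorphic_mat_on_def forall_2 adjugate_entry by (auto intro!: holomorphic_intros)

lemma holomorphic_mat_deriv:
  assumes "holomorphic_mat_on F W" "open W"
  shows "holomorphic_mat_on (deriv_mat F) W"
  using assms unfolding holomorphic_mat_on_def deriv_mat_def
  by (auto intro: holomorphic_deriv)

section \<open>Smooth matrix functions\<close>

lemma Ck_on_cong:
  assumes "open W" "\<And>u. u \<in> W \<Longrightarrow> F u = G u" "Ck_on n F W"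
  shows "Ck_on n G W"
  using assms(2,3)
proof (induction n arbitrary: F G)
  case 0
  then show ?case
    using continuous_on_cong[of W W F G] by simp
next
  case (Suc n)
  have "frechet_derivative F (at w) = frechet_derivative G (at w)" if "w \<in> W" for w
    using frechet_derivative_cong[OF assms(1) that] Suc.prems(1) by blast
  then have "Ck_on n (\<lambda>w. frechet_derivative G (at w) h) W"
    if "Ck_on n (\<lambda>w. frechet_derivative F (at w) h) W" for h
    by (intro Suc.IH[OF _ that]) simp
  moreover have "\<forall>w\<in>W. G differentiable at w"
  proof
    fix w assume "w \<in> W"
    moreover have "F differentiable at w"
      using Suc.prems(2) \<open>w \<in> W\<close> by simp
    ultimately show "G differentiable at w"
      by (intro differentiable_cong[OF assms(1), of w F G] Suc.prems(1))
  qed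
  ultimately show ?case
    using Suc.prems(2) by simp
qed

lemma Ck_on_Suc_imp:
  assumes "Ck_on (Suc n) F W"
  shows "Ck_on n F W"
  using assms
proof (induction n arbitrary: F)
  case 0
  then show ?case
    by (auto intro!: differentiable_imp_continuous_on differentiable_at_imp_differentiable_on)
next
  case (Suc n)
  note h = Suc.prems[unfolded Ck_on.simps(2)[of "Suc n" F W]]
  have "Ck_on n (\<lambda>w. frechet_derivative F (at w) 1) W" "Ck_on n (\<lambda>w. frechet_derivative F (at w) \<i>) W"
    using h Suc.IH by blast+
  then show ?case
    using h by simp
qed

lemma Ck_on_add:
  assumes "open W" "Ck_on n F W" "Ck_on n G W"
  shows "Ck_on n (\<lambda>u. F u + G u) W"
  using assms(2,3)
proof (induction n arbitrary: F G)
  case 0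
  then show ?case
    by (auto intro: continuous_intros)
next
  case (Suc n)
  have d: "\<forall>w\<in>W. F differentiable at w" "\<forall>w\<in>W. G differentiable at w"
    using Suc.prems by simp_all
  have e: "frechet_derivative F (at w) h + frechet_derivative G (at w) h =
     frechet_derivative (\<lambda>u. F u + G u) (at w) h" if "w \<in> W" for w h
    using d that by (intro fun_cong[OF frechet_derivative_at] has_derivative_add)
       (auto simp: frechet_derivative_works)
  show ?case
    using Suc d by (auto intro!: Ck_on_cong[OF assms(1) e])
qed

lemma Ck_on_bounded_linear:
  assumes "open W" "bounded_linear L" "Ck_on n F W"
  shows "Ck_on n (\<lambda>u. L (F u)) W"
  using assms(3)
proof (induction n arbitrary: F)
  case 0
  then show ?case
    by (auto intro: bounded_linear.continuous_on[OF assms(2)])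
next
  case (Suc n)
  have d: "\<forall>w\<in>W. F differentiable at w"
    using Suc.prems by simp_all
  have e: "L (frechet_derivative F (at w) h) =
     frechet_derivative (\<lambda>u. L (F u)) (at w) h" if "w \<in> W" for w h
    using d that by (intro fun_cong[OF frechet_derivative_at] bounded_linear.has_derivative[OF assms(2)])
       (auto simp: frechet_derivative_works)
  show ?case
    using Suc d by (auto intro!: Ck_on_cong[OF assms(1) e] differentiable_bounded_linear[OF assms(2)])
qed

lemma Ck_on_mult:
  assumes "open W" "Ck_on n F W" "Ck_on n G W"
  shows "Ck_on n (\<lambda>u. F u ** G u) W"
  using assms(2,3)
proof (induction n arbitrary: F G)
  case 0
  then show ?case
    by (auto intro: bounded_bilinear.continuous_on[OF bounded_bilinear_mat2_mult])
next
  case (Suc n)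
  have d: "\<forall>w\<in>W. F differentiable at w" "\<forall>w\<in>W. G differentiable at w"
    using Suc.prems by simp_all
  have e: "F w ** frechet_derivative G (at w) h + frechet_derivative F (at w) h ** G w =
     frechet_derivative (\<lambda>u. F u ** G u) (at w) h" if "w \<in> W" for w h
    using d that by (intro fun_cong[OF frechet_derivative_at] bounded_bilinear.FDERIV[OF bounded_bilinear_mat2_mult])
       (auto simp: frechet_derivative_works)
  have FG: "Ck_on n F W" "Ck_on n G W"
    using Suc.prems Ck_on_Suc_imp by blast+
  show ?case
    using Suc d FG by (auto intro!: Ck_on_cong[OF assms(1) e] Ck_on_add[OF assms(1)] mat2_differentiable)
qed

lemma Ck_on_holomorphic:
  assumes "open W" "holomorphic_mat_on F W"
  shows "Ck_on n F W"
  using assms(2)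
proof (induction n arbitrary: F)
  case 0
  then show ?case
    using holomorphic_mat_wirtinger(1)[OF _ assms(1)]
    by (auto intro!: differentiable_imp_continuous_on differentiable_at_imp_differentiable_on)
next
  case (Suc n)
  have e: "cscale h (deriv_mat F w) = frechet_derivative F (at w) h" if "w \<in> W" for w h
    using fun_cong[OF frechet_derivative_at[OF holomorphic_mat_has_derivative[OF Suc.prems assms(1) that]]] .
  have "Ck_on n (\<lambda>w. frechet_derivative F (at w) h) W" for h
    by (rule Ck_on_cong[OF assms(1) e])
       (auto intro!: Suc.IH holomorphic_mat_cscale holomorphic_mat_deriv assms(1) Suc.prems)
  then show ?case
    using holomorphic_mat_wirtinger(1)[OF Suc.prems assms(1)] by simp
qed

lemma Ck_on_wirtinger:
  assumes "open W" "Ck_on (Suc n) F W"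
  shows "Ck_on n (wz F) W" "Ck_on n (wzb F) W"
proof -
  have 1: "Ck_on n (\<lambda>w. frechet_derivative F (at w) 1) W" "Ck_on n (\<lambda>w. frechet_derivative F (at w) \<i>) W"
    using assms(2) by simp_all
  have "Ck_on n (\<lambda>w. cscale (1/2) (frechet_derivative F (at w) 1) + cscale (-\<i>/2) (frechet_derivative F (at w) \<i>)) W"
    by (intro Ck_on_add assms(1) Ck_on_bounded_linear[OF assms(1) bounded_linear_cscale] 1)
  then show "Ck_on n (wz F) W"
    by (rule Ck_on_cong[OF assms(1), rotated]) (simp add: wz_def mat2_simps algebra_simps)
  have "Ck_on n (\<lambda>w. cscale (1/2) (frechet_derivative F (at w) 1) + cscale (\<i>/2) (frechet_derivative F (at w) \<i>)) W"
    by (intro Ck_on_add assms(1) Ck_on_bounded_linear[OF assms(1) bounded_linear_cscale] 1)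
  then show "Ck_on n (wzb F) W"
    by (rule Ck_on_cong[OF assms(1), rotated]) (simp add: wzb_def mat2_simps algebra_simps)
qed

section \<open>Symmetry of second derivatives\<close>

text \<open>The mean value theorem is applied twice: in direction \<open>d\<close> to the difference of \<open>h\<close> along \<open>e\<close>, and then in direction
  \<open>e\<close>. The left-hand side is symmetric in \<open>d\<close> and \<open>e\<close>, which gives the equality of mixed derivatives in the limit.\<close>

lemma second_difference_mean_value:
  fixes h :: "complex \<Rightarrow> real" and w d e :: complex
  assumes r: "r > 0" and W: "ball w (2 * r + r) \<subseteq> W" and de: "norm d = 1" "norm e = 1"
    and h: "\<And>u. u \<in> W \<Longrightarrow> (h has_derivative h' u) (at u)"
    and k: "\<And>u. u \<in> W \<Longrightarrow> ((\<lambda>v. h' v d) has_derivative k' u) (at u)"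
  shows "\<exists>\<xi>\<in>ball w (2 * r + r). h (w + r *\<^sub>R d + r *\<^sub>R e) - h (w + r *\<^sub>R d) - h (w + r *\<^sub>R e) + h w = r * r * k' \<xi> e"
proof -
  have inW: "w + s *\<^sub>R d + t *\<^sub>R e \<in> ball w (2 * r + r)" if "0 \<le> s" "s \<le> r" "0 \<le> t" "t \<le> r" for s t
  proof -
    have "norm (s *\<^sub>R d + t *\<^sub>R e) \<le> s + t"
      using norm_triangle_ineq[of "s *\<^sub>R d" "t *\<^sub>R e"] de that by simp
    moreover have "dist w (w + s *\<^sub>R d + t *\<^sub>R e) = norm (s *\<^sub>R d + t *\<^sub>R e)"
      by (simp add: dist_norm norm_minus_commute add.commute add.left_commute)
    ultimately show ?thesis
      using that r by simp
  qed
  have along_d: "((\<lambda>s. h (w + s *\<^sub>R d + t *\<^sub>R e)) has_real_derivative h' (w + s *\<^sub>R d + t *\<^sub>R e) d) (at s)"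
    if "0 \<le> s" "s \<le> r" "0 \<le> t" "t \<le> r" for s t
  proof -
    have hd: "(h has_derivative h' (w + s *\<^sub>R d + t *\<^sub>R e)) (at (w + s *\<^sub>R d + t *\<^sub>R e))"
      using h inW that W by blast
    have "((\<lambda>s. w + s *\<^sub>R d + t *\<^sub>R e) has_derivative (\<lambda>x. x *\<^sub>R d)) (at s)"
      by (auto intro!: derivative_eq_intros)
    from has_derivative_compose[OF this hd]
    show ?thesis
      using linear_scale[OF has_derivative_linear[OF hd]]
      by (simp add: has_field_derivative_def mult_commute_abs)
  qed
  have diff: "((\<lambda>s. h (w + s *\<^sub>R d + r *\<^sub>R e) - h (w + s *\<^sub>R d + 0 *\<^sub>R e)) has_real_derivative
      h' (w + s *\<^sub>R d + r *\<^sub>R e) d - h' (w + s *\<^sub>R d + 0 *\<^sub>R e) d) (at s)" if "0 \<le> s" "s \<le> r" for s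
    using that r by (intro DERIV_diff along_d) auto
  obtain s where s: "0 < s" "s < r" and
    eq: "(h (w + r *\<^sub>R d + r *\<^sub>R e) - h (w + r *\<^sub>R d + 0 *\<^sub>R e)) - (h (w + 0 *\<^sub>R d + r *\<^sub>R e) - h (w + 0 *\<^sub>R d + 0 *\<^sub>R e)) =
      (r - 0) * (h' (w + s *\<^sub>R d + r *\<^sub>R e) d - h' (w + s *\<^sub>R d + 0 *\<^sub>R e) d)"
    using MVT2[OF r diff] by blast
  have along_e: "((\<lambda>t. h' (w + s *\<^sub>R d + t *\<^sub>R e) d) has_real_derivative k' (w + s *\<^sub>R d + t *\<^sub>R e) e) (at t)"
    if "0 \<le> t" "t \<le> r" for t
  proof -
    have hd: "((\<lambda>v. h' v d) has_derivative k' (w + s *\<^sub>R d + t *\<^sub>R e)) (at (w + s *\<^sub>R d + t *\<^sub>R e))"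
      using k inW that s W by (meson less_imp_le subsetD)
    have "((\<lambda>t. w + s *\<^sub>R d + t *\<^sub>R e) has_derivative (\<lambda>x. x *\<^sub>R e)) (at t)"
      by (auto intro!: derivative_eq_intros)
    from has_derivative_compose[OF this hd]
    show ?thesis
      using linear_scale[OF has_derivative_linear[OF hd]]
      by (simp add: has_field_derivative_def mult_commute_abs)
  qed
  obtain t where t: "0 < t" "t < r" and
    eq2: "h' (w + s *\<^sub>R d + r *\<^sub>R e) d - h' (w + s *\<^sub>R d + 0 *\<^sub>R e) d = (r - 0) * k' (w + s *\<^sub>R d + t *\<^sub>R e) e"
    using MVT2[OF r, of "\<lambda>t. h' (w + s *\<^sub>R d + t *\<^sub>R e) d" "\<lambda>t. k' (w + s *\<^sub>R d + t *\<^sub>R e) e"] along_e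
    by auto
  show ?thesis
    using eq eq2 inW[of s t] s t
    by (intro bexI[of _ "w + s *\<^sub>R d + t *\<^sub>R e"]) (auto simp: algebra_simps)
qed

lemma mixed_partials_real:
  fixes h :: "complex \<Rightarrow> real" and w d e :: complex
  assumes W: "open W" "w \<in> W" and de: "norm d = 1" "norm e = 1"
    and h: "\<And>u. u \<in> W \<Longrightarrow> (h has_derivative h' u) (at u)"
    and k: "\<And>u. u \<in> W \<Longrightarrow> ((\<lambda>v. h' v d) has_derivative k' u) (at u)"
    and l: "\<And>u. u \<in> W \<Longrightarrow> ((\<lambda>v. h' v e) has_derivative l' u) (at u)"
    and ck: "continuous_on W (\<lambda>u. k' u e)" and cl: "continuous_on W (\<lambda>u. l' u d)"
  shows "k' w e = l' w d"
proof (rule ccontr)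
  assume "k' w e \<noteq> l' w d"
  define \<delta> where "\<delta> = \<bar>k' w e - l' w d\<bar> / 2"
  have \<delta>: "\<delta> > 0"
    using \<open>k' w e \<noteq> l' w d\<close> by (simp add: \<delta>_def)
  obtain r0 where r0: "r0 > 0" "ball w r0 \<subseteq> W"
    using W open_contains_ball by blast
  obtain r1 where r1: "r1 > 0" "\<And>u. u \<in> W \<Longrightarrow> dist u w < r1 \<Longrightarrow> dist (k' u e) (k' w e) < \<delta>"
    using ck \<delta> W(2) unfolding continuous_on_iff by blast
  obtain r2 where r2: "r2 > 0" "\<And>u. u \<in> W \<Longrightarrow> dist u w < r2 \<Longrightarrow> dist (l' u d) (l' w d) < \<delta>"
    using cl \<delta> W(2) unfolding continuous_on_iff by blast
  define r where "r = Min {r0, r1, r2} / 3"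
  have r: "r > 0" "2 * r + r \<le> r0" "2 * r + r \<le> r1" "2 * r + r \<le> r2"
    using r0 r1 r2 by (auto simp: r_def)
  have sub: "ball w (2 * r + r) \<subseteq> W"
    using r r0 by (meson order_trans subset_ball)
  obtain \<xi> where \<xi>: "\<xi> \<in> ball w (2 * r + r)"
    "h (w + r *\<^sub>R d + r *\<^sub>R e) - h (w + r *\<^sub>R d) - h (w + r *\<^sub>R e) + h w = r * r * k' \<xi> e"
    using second_difference_mean_value[OF r(1) sub de h k] by blast
  obtain \<eta> where \<eta>: "\<eta> \<in> ball w (2 * r + r)"
    "h (w + r *\<^sub>R e + r *\<^sub>R d) - h (w + r *\<^sub>R e) - h (w + r *\<^sub>R d) + h w = r * r * l' \<eta> d"
    using second_difference_mean_value[OF r(1) sub de(2,1) h l] by blast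
  have comm: "w + r *\<^sub>R e + r *\<^sub>R d = w + r *\<^sub>R d + r *\<^sub>R e"
    by simp
  have "r * r * k' \<xi> e = r * r * l' \<eta> d"
    using \<xi>(2) \<eta>(2)[unfolded comm] by linarith
  then have eq: "k' \<xi> e = l' \<eta> d"
    using r by simp
  have "dist (k' \<xi> e) (k' w e) < \<delta>"
    using \<xi>(1) sub r by (intro r1) (auto simp: dist_commute)
  moreover have "dist (l' \<eta> d) (l' w d) < \<delta>"
    using \<eta>(1) sub r by (intro r2) (auto simp: dist_commute)
  ultimately have "\<bar>k' w e - l' w d\<bar> < 2 * \<delta>"
    unfolding eq dist_real_def by linarith
  then show False
    by (simp add: \<delta>_def)
qed

lemma frechet_derivative_symmetric:
  fixes F :: "complex \<Rightarrow> mat2"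
  assumes W: "open W" "w \<in> W" and F: "Ck_on 2 F W"
  shows "frechet_derivative (\<lambda>v. frechet_derivative F (at v) 1) (at w) \<i> =
    frechet_derivative (\<lambda>v. frechet_derivative F (at v) \<i>) (at w) 1"
proof (rule euclidean_eqI)
  fix b :: mat2
  let ?D = "\<lambda>G v. frechet_derivative G (at v)"
  let ?F1 = "\<lambda>v. ?D F v 1" and ?Fi = "\<lambda>v. ?D F v \<i>"
  have d: "(F has_derivative ?D F u) (at u)" "(?F1 has_derivative ?D ?F1 u) (at u)"
    "(?Fi has_derivative ?D ?Fi u) (at u)" if "u \<in> W" for u
    using F that by (auto simp: numeral_2_eq_2 frechet_derivative_works)
  have c: "continuous_on W (\<lambda>u. ?D ?F1 u \<i>)" "continuous_on W (\<lambda>u. ?D ?Fi u 1)"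
    using F by (simp_all add: numeral_2_eq_2)
  show "?D ?F1 w \<i> \<bullet> b = ?D ?Fi w 1 \<bullet> b"
    by (rule mixed_partials_real[OF W, of 1 \<i> "\<lambda>u. F u \<bullet> b" "\<lambda>u x. ?D F u x \<bullet> b"
          "\<lambda>u x. ?D ?F1 u x \<bullet> b" "\<lambda>u x. ?D ?Fi u x \<bullet> b"])
       (auto intro!: has_derivative_inner_left d continuous_intros c)
qed

lemma wirtinger_symmetric:
  fixes F :: "complex \<Rightarrow> mat2"
  assumes W: "open W" "w \<in> W" and F: "Ck_on 2 F W"
  shows "wzb (wz F) w = wz (wzb F) w"
proof -
  let ?D = "\<lambda>G v. frechet_derivative G (at v)"
  let ?F1 = "\<lambda>v. ?D F v 1" and ?Fi = "\<lambda>v. ?D F v \<i>"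
  have "?F1 differentiable at w" "?Fi differentiable at w"
    using F W by (auto simp: numeral_2_eq_2)
  then have d: "(?F1 has_derivative ?D ?F1 w) (at w)" "(?Fi has_derivative ?D ?Fi w) (at w)"
    by (simp_all add: frechet_derivative_works)
  note L = bounded_linear.has_derivative[OF bounded_linear_cscale]
  have "(wz F has_derivative (\<lambda>h. cscale (1/2) (?D ?F1 w h - cscale \<i> (?D ?Fi w h)))) (at w)"
    unfolding wz_def[abs_def] by (intro L has_derivative_diff d)
  note 1 = wz_wzb_has_derivative(2)[OF this]
  have "(wzb F has_derivative (\<lambda>h. cscale (1/2) (?D ?F1 w h + cscale \<i> (?D ?Fi w h)))) (at w)"
    unfolding wzb_def[abs_def] by (intro L has_derivative_add d)
  note 2 = wz_wzb_has_derivative(1)[OF this]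
  show ?thesis
    unfolding 1 2 frechet_derivative_symmetric[OF assms] by (simp add: mat2_simps algebra_simps)
qed


section \<open>Conformal immersions in a chart\<close>

text \<open>In \<open>H\<^sup>3\<close> this is \<open>F\<^sup>-\<^sup>1 F\<^sub>z\<close>, and in \<open>E\<^sup>3\<close> it is \<open>F\<^sub>z\<close>; the adjugate is the inverse because the determinant is 1.\<close>

definition tangent_form :: "ambient \<Rightarrow> (complex \<Rightarrow> mat2) \<Rightarrow> complex \<Rightarrow> mat2" where
  "tangent_form X F w = adjugate (gram X (F w)) ** wz F w"

text \<open>The inner product as a matrix identity, so that the product rule for matrices also differentiates inner products.\<close>

lemma minner_matrix: "x ** adjugate y + y ** adjugate x = cscale (- 2 * minner x y) (mat 1)"
  by (simp add: minner_def mat2_simps field_simps)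

lemma minner_diff_orthogonal:
  assumes W: "open W" "w \<in> W" and d: "G differentiable at w" "N differentiable at w"
    and 0: "\<And>u. u \<in> W \<Longrightarrow> minner (G u) (N u) = 0"
  shows "minner (G w) (wz N w) = - minner (wz G w) (N w)"
    "minner (G w) (wzb N w) = - minner (wzb G w) (N w)"
proof -
  have eq: "G u ** adjugate (N u) + N u ** adjugate (G u) = 0" if "u \<in> W" for u
    using 0[OF that] by (simp add: minner_matrix)
  note L = wirtinger_bounded_linear[OF bounded_linear_adjugate _ adjugate_cscale]
  have *: "cscale (- 2 * (minner x y + minner x' y')) (mat 1) = 0 \<Longrightarrow> minner x' y' = - minner x y" for x y x' y'
    by (simp add: mat2_simps add_eq_0_iff)
  have "wz (\<lambda>u. G u ** adjugate (N u) + N u ** adjugate (G u)) w = 0"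
    using wirtinger_cong(1)[OF W eq] by simp
  then have "(wz G w ** adjugate (N w) + N w ** adjugate (wz G w)) +
      (G w ** adjugate (wz N w) + wz N w ** adjugate (G w)) = 0"
    by (simp add: wirtinger_add wirtinger_mult L d mat2_differentiable algebra_simps)
  then show "minner (G w) (wz N w) = - minner (wz G w) (N w)"
    unfolding minner_matrix by (intro *) (simp add: mat2_simps algebra_simps)
  have "wzb (\<lambda>u. G u ** adjugate (N u) + N u ** adjugate (G u)) w = 0"
    using wirtinger_cong(2)[OF W eq] by simp
  then have "(wzb G w ** adjugate (N w) + N w ** adjugate (wzb G w)) +
      (G w ** adjugate (wzb N w) + wzb N w ** adjugate (G w)) = 0"
    by (simp add: wirtinger_add wirtinger_mult L d mat2_differentiable algebra_simps)
  then show "minner (G w) (wzb N w) = - minner (wzb G w) (N w)"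
    unfolding minner_matrix by (intro *) (simp add: mat2_simps algebra_simps)
qed

lemma det_one_derivative:
  assumes "open W" "w \<in> W" "F differentiable at w" "\<And>u. u \<in> W \<Longrightarrow> det (F u) = 1"
  shows "trace (wz F w ** adjugate (F w)) = 0"
proof -
  have eq: "F u ** adjugate (F u) = mat 1" if "u \<in> W" for u
    using assms(4)[OF that] by (rule adjugate_cancel)
  have "wz (\<lambda>u. F u ** adjugate (F u)) w = 0"
    using wirtinger_cong(1)[OF assms(1,2) eq] by simp
  then have "wz F w ** adjugate (F w) + F w ** adjugate (wz F w) = 0"
    using assms(3)
    by (simp add: wirtinger_mult mat2_differentiable wirtinger_bounded_linear[OF bounded_linear_adjugate _ adjugate_cscale])
  moreover have "trace (wz F w ** adjugate (F w) + F w ** adjugate (wz F w)) = 2 * trace (wz F w ** adjugate (F w))"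
    by (simp add: mat2_simps algebra_simps)
  ultimately show ?thesis
    by simp
qed

lemma trace_free_derivative:
  assumes W: "open W" "w \<in> W" and d: "G differentiable at w" and 0: "\<And>u. u \<in> W \<Longrightarrow> trace (G u) = 0"
  shows "trace (wz G w) = 0" "trace (wzb G w) = 0"
proof -
  have eq: "G u + adjugate (G u) = 0" if "u \<in> W" for u
    using 0[OF that] by (simp add: adjugate_trace_free)
  note L = wirtinger_bounded_linear[OF bounded_linear_adjugate _ adjugate_cscale]
  have "wz (\<lambda>u. G u + adjugate (G u)) w = 0" "wzb (\<lambda>u. G u + adjugate (G u)) w = 0"
    using wirtinger_cong[OF W eq] by simp_all
  then show "trace (wz G w) = 0" "trace (wzb G w) = 0"
    by (simp_all add: wirtinger_add L d mat2_differentiable) (simp_all add: mat2_simps)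
qed

text \<open>Because \<open>k\<close> anticommutes with \<open>a\<close>, it maps the image line of \<open>a\<close>, which is also its kernel, to itself.\<close>

lemma nilpotent_anticommuting_eigen:
  assumes "trace a = 0" "det a = 0" "a \<noteq> 0" "trace k = 0" "a ** k + k ** a = (0::mat2)"
  shows "\<exists>c. a ** k = cscale c a"
proof -
  obtain x y z where a: "a$1$1 = x" "a$1$2 = y" "a$2$1 = z" "a$2$2 = - x"
    using assms(1) by (simp add: trace_2 add_eq_0_iff)
  obtain p q r where k: "k$1$1 = p" "k$1$2 = q" "k$2$1 = r" "k$2$2 = - p"
    using assms(4) by (simp add: trace_2 add_eq_0_iff)
  have xx: "x * x = - (y * z)"
    using assms(2) by (simp add: det_2 a) (metis add.inverse_inverse)
  have e: "2 * x * p + y * r + q * z = 0"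
    using assms(5) by (simp add: mat2_simps a k algebra_simps)
  show ?thesis
  proof (cases "z = 0")
    case False
    have "z * (x * p + y * r) = x * (z * p - x * r)"
      using xx e by algebra
    moreover have "z * (x * q - y * p) = y * (z * p - x * r)"
      using xx e by algebra
    moreover have "z * (z * q + x * p) = - x * (z * p - x * r)"
      using xx e by algebra
    ultimately have "a ** k = cscale ((z * p - x * r) / z) a"
      using False by (simp add: mat2_simps a k field_simps)
    then show ?thesis ..
  next
    case True
    then have "x = 0"
      using xx by simp
    then have "y \<noteq> 0"
      using assms(3) True by (auto simp: mat2_simps a)
    then have "r = 0"
      using e True \<open>x = 0\<close> by simp
    then have "a ** k = cscale (- p) a"
      using True \<open>x = 0\<close> by (simp add: mat2_simps a k)
    then show ?thesis ..
  qed
qed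

text \<open>A conformal immersion seen in one chart.\<close>

locale conformal_chart =
  fixes X :: ambient and F :: "complex \<Rightarrow> mat2" and W :: "complex set"
  assumes open_W: "open W" and smooth: "\<And>n. Ck_on n F W"
    and ambient: "\<And>w. w \<in> W \<Longrightarrow> F w \<in> ambient_space X"
    and conformal: "\<And>w. w \<in> W \<Longrightarrow> minner (wz F w) (wz F w) = 0"
    and immersed: "\<And>w. w \<in> W \<Longrightarrow> inj (frechet_derivative F (at w))"
begin

abbreviation "M \<equiv> \<lambda>w. gram X (F w)"
abbreviation "A \<equiv> tangent_form X F"
abbreviation "N \<equiv> \<lambda>w. normal_of (M w) (A w)"

lemma det_M: "w \<in> W \<Longrightarrow> det (M w) = 1"
  using ambient by (cases X) auto

lemma hermitian_F: "w \<in> W \<Longrightarrow> ctranspose (F w) = F w"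
  using ambient by (cases X) (auto simp: hermitian_def)

lemma hermitian_M: "w \<in> W \<Longrightarrow> ctranspose (M w) = M w"
  using hermitian_F by (cases X) auto

lemma F_differentiable: "w \<in> W \<Longrightarrow> F differentiable at w"
  using smooth[of 1] by simp

lemma wz_smooth: "Ck_on n (wz F) W" and wzb_smooth: "Ck_on n (wzb F) W"
  using Ck_on_wirtinger[OF open_W smooth] by auto

lemma wz_differentiable: "w \<in> W \<Longrightarrow> wz F differentiable at w"
  and wzb_differentiable: "w \<in> W \<Longrightarrow> wzb F differentiable at w"
  using wz_smooth[of 1] wzb_smooth[of 1] by simp_all

lemma M_differentiable: "w \<in> W \<Longrightarrow> M differentiable at w"
  using F_differentiable by (cases X) auto

lemma A_differentiable: "w \<in> W \<Longrightarrow> A differentiable at w"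
  unfolding tangent_form_def[abs_def]
  by (intro mat2_differentiable M_differentiable wz_differentiable)

lemma M_A: "w \<in> W \<Longrightarrow> M w ** A w = wz F w"
  by (simp add: tangent_form_def matrix_mul_assoc adjugate_cancel det_M)

text \<open>The values are Hermitian.\<close>

lemma wzb_F: "w \<in> W \<Longrightarrow> wzb F w = ctranspose (wz F w)"
  using wirtinger_ctranspose(2)[OF F_differentiable, of w] wirtinger_cong(2)[OF open_W _ hermitian_F, of w] by simp

lemma A_M: "w \<in> W \<Longrightarrow> ctranspose (A w) ** M w = wzb F w"
  using M_A[of w] wzb_F[of w] by (metis ctranspose_mult hermitian_M)

lemma trace_A: assumes w: "w \<in> W" shows "trace (A w) = 0"
proof (cases X)
  case Euclidean
  then have "trace (wz F w) = 0"
    using ambient by (intro trace_free_derivative[OF open_W w F_differentiable[OF w]]) auto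
  then show ?thesis
    by (simp add: tangent_form_def Euclidean)
next
  case Hyperbolic
  then have "trace (wz F w ** adjugate (F w)) = 0"
    using ambient by (intro det_one_derivative[OF open_W w F_differentiable[OF w]]) auto
  then show ?thesis
    by (simp add: tangent_form_def Hyperbolic trace_mul_sym[of "adjugate (F w)"])
qed

lemma det_A: "w \<in> W \<Longrightarrow> det (A w) = 0"
  using conformal[of w] by (simp add: minner_self tangent_form_def det_mul)

lemma A_nonzero: assumes w: "w \<in> W" shows "A w \<noteq> 0"
proof
  assume "A w = 0"
  then have "wz F w = 0"
    using M_A[OF w] by simp
  then have "wzb F w = 0"
    using wzb_F[OF w] by (simp add: mat2_simps)
  have "frechet_derivative F (at w) 1 = frechet_derivative F (at w) 0"
    using \<open>wz F w = 0\<close> \<open>wzb F w = 0\<close>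
    by (simp add: frechet_from_wirtinger linear_0[OF linear_frechet_derivative[OF F_differentiable[OF w]]])
  then show False
    using immersed[OF w] by (auto dest: injD)
qed

lemma tangent: "w \<in> W \<Longrightarrow> tangent_direction X (F w) (M w) (A w)"
  using ambient trace_A det_A A_nonzero by unfold_locales auto

lemma N_differentiable: assumes w: "w \<in> W" shows "N differentiable at w"
proof -
  interpret t: tangent_direction X "F w" "M w" "A w"
    by (rule tangent[OF w])
  have "(\<lambda>u. trace (A u ** sharp (M u) (A u))) differentiable at w"
    unfolding sharp_def
    by (intro mat2_differentiable M_differentiable A_differentiable w)
  then have "(\<lambda>u. 1 / trace (A u ** sharp (M u) (A u))) differentiable at w"
    using t.t_nz by (intro differentiable_divide) auto
  then show ?thesis
    unfolding normal_of_def sharp_def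
    by (intro mat2_differentiable differentiable_diff M_differentiable A_differentiable w)
qed

lemma wz_M: "w \<in> W \<Longrightarrow> wz M w = (case X of Euclidean \<Rightarrow> 0 | Hyperbolic \<Rightarrow> wz F w)"
  and wzb_M: "w \<in> W \<Longrightarrow> wzb M w = (case X of Euclidean \<Rightarrow> 0 | Hyperbolic \<Rightarrow> wzb F w)"
  by (cases X; simp)+

text \<open>The product rule for \<open>F\<^sub>z = m a\<close>. The term \<open>m\<^sub>z a\<close> is zero since \<open>m\<^sub>z\<close> is \<open>0\<close> or \<open>m a\<close>, and \<open>a a = 0\<close>.\<close>

lemma second_derivatives:
  assumes w: "w \<in> W"
  shows "wz (wz F) w = M w ** wz A w"
    "wzb (wz F) w = (case X of Euclidean \<Rightarrow> 0 | Hyperbolic \<Rightarrow> ctranspose (A w) ** M w ** A w) + M w ** wzb A w"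
proof -
  interpret t: tangent_direction X "F w" "M w" "A w"
    by (rule tangent[OF w])
  have eq: "wz F u = M u ** A u" if "u \<in> W" for u
    using M_A that by simp
  note d = M_differentiable[OF w] A_differentiable[OF w]
  have "wz F w ** A w = M w ** (A w ** A w)"
    by (simp add: M_A w matrix_mul_assoc)
  then have "wz F w ** A w = 0"
    by (simp add: t.aa)
  moreover have "B ** C = 0 \<Longrightarrow> (case X of Euclidean \<Rightarrow> 0 | Hyperbolic \<Rightarrow> B) ** C = 0" for B C :: mat2
    by (cases X) simp_all
  ultimately have "wz M w ** A w = 0"
    unfolding wz_M[OF w] by blast
  then show "wz (wz F) w = M w ** wz A w"
    using wirtinger_cong(1)[OF open_W w eq] wirtinger_mult(1)[OF d] by simp
  have "wzb M w ** A w = (case X of Euclidean \<Rightarrow> 0 | Hyperbolic \<Rightarrow> ctranspose (A w) ** M w ** A w)"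
    unfolding A_M[OF w] wzb_M[OF w] by (cases X) simp_all
  then show "wzb (wz F) w = (case X of Euclidean \<Rightarrow> 0 | Hyperbolic \<Rightarrow> ctranspose (A w) ** M w ** A w) + M w ** wzb A w"
    using wirtinger_cong(2)[OF open_W w eq] wirtinger_mult(2)[OF d] by simp
qed

lemma derivative_A:
  assumes w: "w \<in> W"
  shows "trace (wz A w) = 0" "trace (wzb A w) = 0"
    "A w ** wz A w + wz A w ** A w = 0" "A w ** wzb A w + wzb A w ** A w = 0"
proof -
  note d = A_differentiable[OF w]
  show "trace (wz A w) = 0" "trace (wzb A w) = 0"
    using trace_free_derivative[OF open_W w d trace_A] by auto
  have eq: "A u ** A u = 0" if "u \<in> W" for u
    using nilpotent_square trace_A det_A that by blast
  show "A w ** wz A w + wz A w ** A w = 0" "A w ** wzb A w + wzb A w ** A w = 0"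
    using wirtinger_cong[OF open_W w eq] wirtinger_mult[OF d d] by (simp_all add: add.commute)
qed

lemma normal_derivatives:
  assumes w: "w \<in> W"
  shows "minner (wz F w) (wz N w) = - minner (wz (wz F) w) (N w)"
    "minner (wz F w) (wzb N w) = - minner (wzb (wz F) w) (N w)"
    "minner (wzb F w) (wz N w) = - minner (wz (wzb F) w) (N w)"
proof -
  have 0: "minner (wz F u) (N u) = 0" "minner (wzb F u) (N u) = 0" if "u \<in> W" for u
    using tangent_direction.normal_orthogonal[OF tangent[OF that]] M_A[OF that] A_M[OF that] by auto
  show "minner (wz F w) (wz N w) = - minner (wz (wz F) w) (N w)"
    "minner (wz F w) (wzb N w) = - minner (wzb (wz F) w) (N w)"
    "minner (wzb F w) (wz N w) = - minner (wz (wzb F) w) (N w)"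
    using minner_diff_orthogonal[OF open_W w wz_differentiable[OF w] N_differentiable[OF w] 0(1)]
      minner_diff_orthogonal[OF open_W w wzb_differentiable[OF w] N_differentiable[OF w] 0(2)]
    by auto
qed

lemma hopf_eigenvalue:
  assumes w: "w \<in> W"
  shows "A w ** wz A w = cscale (- minner (wz F w) (wz N w)) (A w)"
proof -
  interpret t: tangent_direction X "F w" "M w" "A w"
    by (rule tangent[OF w])
  obtain c where c: "A w ** wz A w = cscale c (A w)"
    using nilpotent_anticommuting_eigen[OF t.a derivative_A(1)[OF w] derivative_A(3)[OF w]] by blast
  then have "wz A w ** A w = - cscale c (A w)"
    using derivative_A(3)[OF w] by (simp add: add_eq_0_iff)
  then show ?thesis
    using t.minner_normal_eigen[OF c] c normal_derivatives(1)[OF w] second_derivatives(1)[OF w] by simp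
qed

lemma hermitian_second_derivative:
  assumes w: "w \<in> W"
  shows "ctranspose (wzb (wz F) w) = wzb (wz F) w" "wz (wzb F) w = wzb (wz F) w"
proof -
  have sym: "wz (wzb F) w = wzb (wz F) w"
    using wirtinger_symmetric[OF open_W w smooth] by simp
  then show "wz (wzb F) w = wzb (wz F) w" .
  have "ctranspose (wzb (wz F) w) = wz (\<lambda>u. ctranspose (wz F u)) w"
    using wirtinger_ctranspose(1)[OF wz_differentiable[OF w]] by simp
  also have "\<dots> = wz (wzb F) w"
    using wirtinger_cong(1)[OF open_W w wzb_F] by simp
  finally show "ctranspose (wzb (wz F) w) = wzb (wz F) w"
    by (simp add: sym)
qed

text \<open>By orthogonality of \<open>N\<close> to the tangent vectors, the quotient is \<open>\<langle>L, N\<rangle>\<close> divided by the inner product of the two first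
  derivatives, where \<open>L\<close> is the mixed second derivative of \<open>F\<close>. The part of \<open>L\<close> that comes from the curvature of the ambient
  space contributes exactly the constant on the right. The remaining part, \<open>m\<close> times the antiholomorphic derivative of \<open>a\<close>, is
  Hermitian because mixed derivatives commute, and it is orthogonal to \<open>m\<close> and to \<open>m a\<close> for algebraic reasons, so it
  vanishes as soon as its normal component does.\<close>

lemma mean_curvature_iff:
  assumes w: "w \<in> W"
  shows "- (minner (wz F w) (wzb N w) + minner (wzb F w) (wz N w)) / (2 * minner (wz F w) (wzb F w)) =
     (case X of Euclidean \<Rightarrow> 0 | Hyperbolic \<Rightarrow> 1) \<longleftrightarrow> wzb A w = 0"
proof -
  interpret t: tangent_direction X "F w" "M w" "A w"
    by (rule tangent[OF w])
  let ?L = "wzb (wz F) w" and ?n = "N w"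
  let ?H = "case X of Euclidean \<Rightarrow> 0 | Hyperbolic \<Rightarrow> ctranspose (A w) ** M w ** A w"
  have add: "minner (x + y) z = minner x z + minner y z" for x y z
    by (simp add: minner_def mat2_distribs trace_add field_simps)
  have H: "minner ?H ?n = (case X of Euclidean \<Rightarrow> 0 | Hyperbolic \<Rightarrow> 1) * (t.t / 2)"
    using t.minner_normal_square by (cases X) (simp_all add: minner_def)
  have "- (minner (wz F w) (wzb N w) + minner (wzb F w) (wz N w)) / (2 * minner (wz F w) (wzb F w)) =
     minner ?L ?n / (t.t / 2)"
  proof -
    have "minner (wz F w) (wzb F w) = t.t / 2"
      using t.minner_tangents M_A[OF w] A_M[OF w] by simp
    then show ?thesis
      by (simp only: normal_derivatives[OF w] hermitian_second_derivative(2)[OF w]) simp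
  qed
  also have "\<dots> = (case X of Euclidean \<Rightarrow> 0 | Hyperbolic \<Rightarrow> 1) + minner (M w ** wzb A w) ?n / (t.t / 2)"
    unfolding second_derivatives(2)[OF w] add H using t.t_nz by (simp add: field_simps)
  finally have "- (minner (wz F w) (wzb N w) + minner (wzb F w) (wz N w)) / (2 * minner (wz F w) (wzb F w)) =
     (case X of Euclidean \<Rightarrow> 0 | Hyperbolic \<Rightarrow> 1) \<longleftrightarrow> minner (M w ** wzb A w) ?n = 0"
    using t.t_nz by simp
  also have "\<dots> \<longleftrightarrow> wzb A w = 0"
  proof
    assume 0: "minner (M w ** wzb A w) ?n = 0"
    have hH: "ctranspose ?H = ?H"
    proof -
      have "ctranspose (ctranspose (A w) ** M w ** A w) = ctranspose (A w) ** M w ** A w"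
        by (simp add: ctranspose_mult hermitian_M[OF w] matrix_mul_assoc)
      moreover have "ctranspose 0 = 0"
        by (simp add: mat2_simps)
      moreover have "ctranspose 0 = 0 \<Longrightarrow> ctranspose B = B \<Longrightarrow>
          ctranspose (case X of Euclidean \<Rightarrow> 0 | Hyperbolic \<Rightarrow> B) = (case X of Euclidean \<Rightarrow> 0 | Hyperbolic \<Rightarrow> B)" for B
        by (cases X) simp_all
      ultimately show ?thesis
        by blast
    qed
    have "M w ** wzb A w = ?L - ?H"
      using second_derivatives(2)[OF w] by simp
    then have h: "ctranspose (M w ** wzb A w) = M w ** wzb A w"
      using hermitian_second_derivative(1)[OF w] hH by (simp add: ctranspose_diff)
    have "trace (A w ** wzb A w) = 0"
    proof -
      have "trace (A w ** wzb A w + wzb A w ** A w) = 0"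
        using derivative_A(4)[OF w] by simp
      then show ?thesis
        by (simp add: trace_add trace_mul_sym[of "wzb A w"])
    qed
    then show "wzb A w = 0"
      using t.hermitian_zero[OF h derivative_A(2)[OF w] _ 0] by simp
  qed (simp add: minner_def)
  finally show ?thesis .
qed

end


section \<open>The Schwarzian derivative\<close>

lemma deriv_cong_open:
  assumes "open U" "w \<in> U" "\<And>u. u \<in> U \<Longrightarrow> g u = h u"
  shows "deriv g w = deriv h w"
  using assms by (intro deriv_cong_ev) (auto simp: eventually_nhds)

lemma schwarzian_cong:
  assumes U: "open U" "w \<in> U" and eq: "\<And>u. u \<in> U \<Longrightarrow> g u = h u"
  shows "schwarzian g w = schwarzian h w"
proof -
  have 1: "deriv g u = deriv h u" if "u \<in> U" for u
    using U(1) that eq by (rule deriv_cong_open)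
  have 2: "deriv (deriv g) u = deriv (deriv h) u" if "u \<in> U" for u
    using U(1) that 1 by (rule deriv_cong_open)
  have 3: "deriv (\<lambda>u. deriv (deriv g) u / (2 * deriv g u)) w = deriv (\<lambda>u. deriv (deriv h) u / (2 * deriv h u)) w"
    using U by (rule deriv_cong_open) (simp add: 1 2)
  show ?thesis
    unfolding schwarzian_def 3 using 1 2 U by simp
qed

lemma holomorphic_has_deriv:
  "g holomorphic_on U \<Longrightarrow> open U \<Longrightarrow> u \<in> U \<Longrightarrow> (g has_field_derivative deriv g u) (at u)"
  by (rule holomorphic_derivI)

lemma has_field_derivative_cong_open:
  assumes "open U" "w \<in> U" "\<And>u. u \<in> U \<Longrightarrow> g u = h u" "(g has_field_derivative D) (at w)"
  shows "(h has_field_derivative D) (at w)"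
  using assms has_field_derivative_transform_within_open by metis

text \<open>With \<open>e = \<gamma> g + \<delta>\<close>, the derivative of \<open>h\<close> is \<open>g' / e\<^sup>2\<close>, so half its logarithmic derivative is \<open>r - e'/e\<close>, where
  \<open>r = g''/(2 g')\<close>. The correction terms cancel because \<open>e'' = 2 r e'\<close>.\<close>

lemma schwarzian_moebius:
  assumes U: "open U" "w \<in> U" and g: "g holomorphic_on U"
    and g': "\<And>u. u \<in> U \<Longrightarrow> deriv g u \<noteq> 0"
    and den: "\<And>u. u \<in> U \<Longrightarrow> \<gamma> * g u + \<delta> \<noteq> 0"
    and det: "\<alpha> * \<delta> - \<beta> * \<gamma> = 1"
    and h: "\<And>u. u \<in> U \<Longrightarrow> h u = (\<alpha> * g u + \<beta>) / (\<gamma> * g u + \<delta>)"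
  shows "schwarzian h w = schwarzian g w"
proof -
  define e where "e u = \<gamma> * g u + \<delta>" for u
  have e0: "e u \<noteq> 0" if "u \<in> U" for u
    using den that by (simp add: e_def)
  define g1 where "g1 = deriv g"
  define g2 where "g2 = deriv g1"
  define r where "r u = g2 u / (2 * g1 u)" for u
  have hol: "g1 holomorphic_on U" "g2 holomorphic_on U" "r holomorphic_on U"
    using g U g' unfolding g1_def g2_def r_def[abs_def]
    by (auto intro!: holomorphic_intros holomorphic_deriv)
  have D: "(g has_field_derivative g1 u) (at u)" "(g1 has_field_derivative g2 u) (at u)"
    "(r has_field_derivative deriv r u) (at u)" if "u \<in> U" for u
    using holomorphic_has_deriv[OF _ U(1) that] g hol unfolding g1_def g2_def by auto
  have De: "(e has_field_derivative \<gamma> * g1 u) (at u)" if "u \<in> U" for u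
    unfolding e_def[abs_def] using D(1)[OF that] by (auto intro!: derivative_eq_intros)
  have h1: "deriv h u = g1 u / (e u)\<^sup>2" if u: "u \<in> U" for u
  proof (rule DERIV_imp_deriv, rule has_field_derivative_cong_open[OF U(1) u h[symmetric]])
    have "((\<lambda>u. (\<alpha> * g u + \<beta>) / e u) has_field_derivative
       ((\<alpha> * g1 u) * e u - (\<alpha> * g u + \<beta>) * (\<gamma> * g1 u)) / (e u * e u)) (at u)"
      using D(1)[OF u] De[OF u] e0[OF u] by (auto intro!: derivative_eq_intros)
    moreover have "(\<alpha> * g1 u) * e u - (\<alpha> * g u + \<beta>) * (\<gamma> * g1 u) = g1 u"
      using det unfolding e_def by algebra
    ultimately show "((\<lambda>u. (\<alpha> * g u + \<beta>) / (\<gamma> * g u + \<delta>)) has_field_derivative g1 u / (e u)\<^sup>2) (at u)"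
      by (simp add: e_def power2_eq_square)
  qed
  have h2: "deriv (deriv h) u / (2 * deriv h u) = r u - \<gamma> * g1 u / e u" if u: "u \<in> U" for u
  proof -
    have "((\<lambda>u. g1 u / (e u)\<^sup>2) has_field_derivative
       (g2 u * (e u)\<^sup>2 - g1 u * (2 * e u * (\<gamma> * g1 u))) / ((e u)\<^sup>2 * (e u)\<^sup>2)) (at u)"
      using D(2)[OF u] De[OF u] e0[OF u] by (auto intro!: derivative_eq_intros)
    then have h2: "deriv (deriv h) u = (g2 u * (e u)\<^sup>2 - g1 u * (2 * e u * (\<gamma> * g1 u))) / ((e u)\<^sup>2 * (e u)\<^sup>2)"
      by (intro DERIV_imp_deriv has_field_derivative_cong_open[OF U(1) u h1[symmetric]])
    then show ?thesis
      using e0[OF u] g'[OF u] unfolding h2 h1[OF u] r_def g1_def[symmetric]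
      by (simp add: field_simps power2_eq_square)
  qed
  have "((\<lambda>u. r u - \<gamma> * g1 u / e u) has_field_derivative
     deriv r w - (\<gamma> * g2 w * e w - \<gamma> * g1 w * (\<gamma> * g1 w)) / (e w * e w)) (at w)"
    using D[OF U(2)] De[OF U(2)] e0[OF U(2)] by (auto intro!: derivative_eq_intros)
  then have "deriv (\<lambda>u. deriv (deriv h) u / (2 * deriv h u)) w =
     deriv r w - (\<gamma> * g2 w * e w - \<gamma> * g1 w * (\<gamma> * g1 w)) / (e w * e w)"
    by (intro DERIV_imp_deriv has_field_derivative_cong_open[OF U(1,2) h2[symmetric]])
  then have "schwarzian h w = (r w - \<gamma> * g1 w / e w)\<^sup>2 -
     (deriv r w - (\<gamma> * g2 w * e w - \<gamma> * g1 w * (\<gamma> * g1 w)) / (e w * e w))"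
    unfolding schwarzian_def h2[OF U(2)] by simp
  also have "\<dots> = (r w)\<^sup>2 - deriv r w"
  proof -
    have "g2 w = 2 * g1 w * r w"
      using g'[OF U(2)] by (simp add: r_def g1_def)
    then show ?thesis
      using e0[OF U(2)] by (simp add: field_simps power2_eq_square)
  qed
  also have "\<dots> = schwarzian g w"
    unfolding schwarzian_def r_def[abs_def] g1_def g2_def by simp
  finally show ?thesis .
qed

definition wronskian :: "(complex \<Rightarrow> complex) \<Rightarrow> (complex \<Rightarrow> complex) \<Rightarrow> complex \<Rightarrow> mat2" where
  "wronskian u s w = vector [vector [u w, deriv u w], vector [s w, deriv s w]]"

lemma wronskian_entry:
  "wronskian u s w $ 1 $ 1 = u w" "wronskian u s w $ 1 $ 2 = deriv u w"
  "wronskian u s w $ 2 $ 1 = s w" "wronskian u s w $ 2 $ 2 = deriv s w"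
  by (simp_all add: wronskian_def)

text \<open>The solutions are \<open>s = (g')\<^sup>-\<^sup>1\<^sup>/\<^sup>2\<close> and \<open>u = g s\<close>. The logarithmic derivative of \<open>s\<close> is \<open>-r\<close> with \<open>r = g''/(2 g')\<close>, so
  \<open>s''/s = r\<^sup>2 - r'\<close>, which is the Schwarzian derivative. Convexity provides the holomorphic square root.\<close>

lemma schwarzian_linear_equation:
  assumes U: "open U" "convex U" and g: "g holomorphic_on U"
    and g': "\<And>u. u \<in> U \<Longrightarrow> deriv g u \<noteq> 0"
  obtains u s where "u holomorphic_on U" "s holomorphic_on U"
    "\<And>w. w \<in> U \<Longrightarrow> s w * s w * deriv g w = 1" "\<And>w. w \<in> U \<Longrightarrow> u w = g w * s w"
    "\<And>w. w \<in> U \<Longrightarrow> det (wronskian u s w) = - 1"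
    "\<And>w. w \<in> U \<Longrightarrow> (deriv u has_field_derivative schwarzian g w * u w) (at w)"
    "\<And>w. w \<in> U \<Longrightarrow> (deriv s has_field_derivative schwarzian g w * s w) (at w)"
proof -
  define g1 where "g1 = deriv g"
  define g2 where "g2 = deriv g1"
  define r where "r u = g2 u / (2 * g1 u)" for u
  have nz: "g1 u \<noteq> 0" if "u \<in> U" for u
    using g' that by (simp add: g1_def)
  have hol: "g1 holomorphic_on U" "g2 holomorphic_on U" "r holomorphic_on U"
    using g U g' unfolding g1_def g2_def r_def[abs_def]
    by (auto intro!: holomorphic_intros holomorphic_deriv)
  obtain q where q: "q holomorphic_on U" "\<And>w. w \<in> U \<Longrightarrow> g1 w = (q w)\<^sup>2"
    using contractible_imp_holomorphic_sqrt[OF hol(1) convex_imp_contractible[OF U(2)] nz] by blast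
  have q0: "q w \<noteq> 0" if "w \<in> U" for w
    using q(2)[OF that] nz[OF that] by auto
  define s where "s w = 1 / q w" for w
  define u where "u w = g w * s w" for w
  have s: "s holomorphic_on U" and u: "u holomorphic_on U"
    using q q0 g unfolding u_def[abs_def] s_def[abs_def] by (auto intro!: holomorphic_intros)
  have D: "(g has_field_derivative g1 w) (at w)" "(g1 has_field_derivative g2 w) (at w)"
    "(r has_field_derivative deriv r w) (at w)" "(q has_field_derivative deriv q w) (at w)"
    "(s has_field_derivative deriv s w) (at w)"
    if "w \<in> U" for w
    using holomorphic_has_deriv[OF _ U(1) that] g hol q s unfolding g1_def g2_def by auto
  have ss: "s w * s w * g1 w = 1" if "w \<in> U" for w
    using q0[OF that] q(2)[OF that] by (simp add: s_def power2_eq_square)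
  have s1: "deriv s w = - (r w * s w)" if w: "w \<in> U" for w
  proof -
    have "g2 w = 2 * q w * deriv q w"
    proof -
      have "((\<lambda>w. (q w)\<^sup>2) has_field_derivative 2 * q w * deriv q w) (at w)"
        using D(4)[OF w] by (auto intro!: derivative_eq_intros)
      then have "(g1 has_field_derivative 2 * q w * deriv q w) (at w)"
        using has_field_derivative_cong_open[OF U(1) w, of "\<lambda>w. (q w)\<^sup>2" g1] q(2) by simp
      then show ?thesis
        using D(2)[OF w] DERIV_unique by blast
    qed
    moreover have "(s has_field_derivative - (deriv q w / (q w * q w))) (at w)"
      unfolding s_def[abs_def] using D(4)[OF w] q0[OF w] by (auto intro!: derivative_eq_intros)
    then have "deriv s w = - (deriv q w / (q w * q w))"
      by (rule DERIV_imp_deriv)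
    ultimately show ?thesis
      using q0[OF w] q(2)[OF w] by (simp add: r_def s_def field_simps power2_eq_square)
  qed
  have S: "schwarzian g w = (r w)\<^sup>2 - deriv r w" for w
    unfolding schwarzian_def r_def[abs_def] g1_def g2_def by simp
  have s2: "(deriv s has_field_derivative schwarzian g w * s w) (at w)" if w: "w \<in> U" for w
  proof (rule has_field_derivative_cong_open[OF U(1) w s1[symmetric]])
    have "((\<lambda>w. - (r w * s w)) has_field_derivative - (deriv r w * s w + r w * deriv s w)) (at w)"
      using D[OF w] by (auto intro!: derivative_eq_intros)
    then show "((\<lambda>w. - (r w * s w)) has_field_derivative schwarzian g w * s w) (at w)"
      by (simp add: S s1[OF w] algebra_simps power2_eq_square)
  qed
  have u1: "deriv u w = g1 w * s w - r w * u w" if w: "w \<in> U" for w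
  proof -
    have "(u has_field_derivative g1 w * s w + g w * deriv s w) (at w)"
      unfolding u_def[abs_def] using D[OF w] by (auto intro!: derivative_eq_intros)
    then show ?thesis
      using DERIV_imp_deriv[of u] s1[OF w] by (simp add: u_def algebra_simps)
  qed
  have u2: "(deriv u has_field_derivative schwarzian g w * u w) (at w)" if w: "w \<in> U" for w
  proof (rule has_field_derivative_cong_open[OF U(1) w u1[symmetric]])
    have Du: "(u has_field_derivative deriv u w) (at w)"
      using holomorphic_has_deriv[OF u U(1) w] .
    have "((\<lambda>w. g1 w * s w - r w * u w) has_field_derivative
       (g2 w * s w + g1 w * deriv s w) - (deriv r w * u w + r w * deriv u w)) (at w)"
      using D[OF w] Du by (auto intro!: derivative_eq_intros)
    moreover have "g2 w = 2 * g1 w * r w"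
      using nz[OF w] by (simp add: r_def)
    ultimately show "((\<lambda>w. g1 w * s w - r w * u w) has_field_derivative schwarzian g w * u w) (at w)"
      by (simp add: S s1[OF w] u1[OF w] algebra_simps power2_eq_square)
  qed
  have "det (wronskian u s w) = - 1" if w: "w \<in> U" for w
    unfolding det_2 wronskian_entry s1[OF w] u1[OF w] using ss[OF w]
    by (simp add: algebra_simps)
  then show ?thesis
    using that[OF u s _ _ _ u2 s2] ss by (simp add: u_def g1_def)
qed

lemma wronskian_has_derivative:
  assumes U: "open U" "w \<in> U" and hol: "u holomorphic_on U" "s holomorphic_on U"
    and D: "(deriv u has_field_derivative S * u w) (at w)" "(deriv s has_field_derivative S * s w) (at w)"
  shows "((\<lambda>w. wronskian u s w $ i $ j) has_field_derivative
    (wronskian u s w ** vector [vector [0, S], vector [1, 0]]) $ i $ j) (at w)"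
proof -
  have *: "\<forall>i j. ((\<lambda>w. wronskian u s w $ i $ j) has_field_derivative
    (wronskian u s w ** vector [vector [0, S], vector [1, 0]]) $ i $ j) (at w)"
    unfolding forall_2 wronskian_entry matrix_mult_entry
    using D holomorphic_has_deriv[OF hol(1) U] holomorphic_has_deriv[OF hol(2) U]
    by (simp add: mult.commute)
  then show ?thesis
    by blast
qed

lemma holomorphic_mat_constant:
  assumes U: "open U" "connected U" "U \<noteq> {}"
    and d: "\<And>i j w. w \<in> U \<Longrightarrow> ((\<lambda>w. (F w :: mat2) $ i $ j) has_field_derivative 0) (at w)"
  obtains C where "\<And>w. w \<in> U \<Longrightarrow> F w = C"
proof -
  obtain a where a: "a \<in> U"
    using U by auto
  have "F w $ i $ j = F a $ i $ j" if "w \<in> U" for w i j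
  proof (rule has_derivative_zero_unique_connected[OF U(1,2) _ that a])
    show "((\<lambda>w. F w $ i $ j) has_derivative (\<lambda>h. 0)) (at x)" if "x \<in> U" for x
      using d[OF that, of i j] by (simp add: has_field_derivative_def lambda_zero)
  qed
  then show ?thesis
    using that[of "F a"] by (simp add: vec_eq_iff)
qed

text \<open>The rank one matrix \<open>v (J v)\<^sup>T\<close> of \<open>v = (u, s)\<close>, with \<open>J\<close> the rotation by a right angle, is equivariant under matrices of
  determinant 1 because these preserve the symplectic form given by \<open>J\<close>.\<close>

lemma spinor_square_conj:
  assumes "det C = 1"
  shows "C ** vector [vector [u * s, - (u * u)], vector [s * s, - (u * s)]] ** adjugate C =
    (let u' = C$1$1 * u + C$1$2 * s; s' = C$2$1 * u + C$2$2 * s in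
      vector [vector [u' * s', - (u' * u')], vector [s' * s', - (u' * s')]])"
  by (simp add: mat2_simps Let_def algebra_simps)

lemma nilpotent_from_slope:
  assumes "trace a = 0" "det a = 0" "a$2$1 = Q * (s * s)" "s \<noteq> 0" "Q \<noteq> 0" "a$1$1 = Q * (u * s)"
  shows "a = cscale Q (vector [vector [u * s, - (u * u)], vector [s * s, - (u * s)]])"
proof -
  have a22: "a$2$2 = - a$1$1"
    using assms(1) by (simp add: trace_2 add_eq_0_iff)
  have "a$1$2 * (Q * (s * s)) = - (Q * (u * u)) * (Q * (s * s))"
    using assms(2) unfolding det_2 a22 assms(3,6) by algebra
  then have "(a$1$2 + Q * (u * u)) * (Q * (s * s)) = 0"
    by algebra
  then have "a$1$2 = - (Q * (u * u))"
    using assms(4,5) by (simp add: add_eq_0_iff2)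
  then show ?thesis
    using a22 assms by (simp add: mat2_simps)
qed

text \<open>The fundamental matrices \<open>M\<close> and \<open>M'\<close> of the two Gauss maps satisfy the same linear equation \<open>M\<^sub>z = M K\<close>, so \<open>M' M\<^sup>-\<^sup>1\<close> is
  constant. This constant conjugates \<open>a\<close> into \<open>b\<close> because each of them is \<open>Q\<close> times the rank one matrix of its spinor.\<close>

lemma equal_schwarzian_conjugate:
  assumes U: "open U" "convex U" "U \<noteq> {}"
    and hol: "g holomorphic_on U" "h holomorphic_on U"
    and d: "\<And>w. w \<in> U \<Longrightarrow> deriv g w \<noteq> 0" "\<And>w. w \<in> U \<Longrightarrow> deriv h w \<noteq> 0"
    and S: "\<And>w. w \<in> U \<Longrightarrow> schwarzian g w = schwarzian h w"
    and a: "\<And>w. w \<in> U \<Longrightarrow> trace (a w) = 0 \<and> det (a w) = 0"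
      "\<And>w. w \<in> U \<Longrightarrow> a w $ 2 $ 1 * deriv g w = Q w" "\<And>w. w \<in> U \<Longrightarrow> a w $ 1 $ 1 = g w * a w $ 2 $ 1"
    and b: "\<And>w. w \<in> U \<Longrightarrow> trace (b w) = 0 \<and> det (b w) = 0"
      "\<And>w. w \<in> U \<Longrightarrow> b w $ 2 $ 1 * deriv h w = Q w" "\<And>w. w \<in> U \<Longrightarrow> b w $ 1 $ 1 = h w * b w $ 2 $ 1"
    and Q: "\<And>w. w \<in> U \<Longrightarrow> Q w \<noteq> 0"
  obtains C where "det C = 1" "\<And>w. w \<in> U \<Longrightarrow> b w = C ** a w ** adjugate C"
proof -
  obtain u s where us: "u holomorphic_on U" "s holomorphic_on U"
    "\<And>w. w \<in> U \<Longrightarrow> s w * s w * deriv g w = 1" "\<And>w. w \<in> U \<Longrightarrow> u w = g w * s w"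
    "\<And>w. w \<in> U \<Longrightarrow> det (wronskian u s w) = - 1"
    "\<And>w. w \<in> U \<Longrightarrow> (deriv u has_field_derivative schwarzian g w * u w) (at w)"
    "\<And>w. w \<in> U \<Longrightarrow> (deriv s has_field_derivative schwarzian g w * s w) (at w)"
    using schwarzian_linear_equation[OF U(1,2) hol(1) d(1)] by blast
  obtain v t where vt: "v holomorphic_on U" "t holomorphic_on U"
    "\<And>w. w \<in> U \<Longrightarrow> t w * t w * deriv h w = 1" "\<And>w. w \<in> U \<Longrightarrow> v w = h w * t w"
    "\<And>w. w \<in> U \<Longrightarrow> det (wronskian v t w) = - 1"
    "\<And>w. w \<in> U \<Longrightarrow> (deriv v has_field_derivative schwarzian h w * v w) (at w)"
    "\<And>w. w \<in> U \<Longrightarrow> (deriv t has_field_derivative schwarzian h w * t w) (at w)"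
    using schwarzian_linear_equation[OF U(1,2) hol(2) d(2)] by blast
  define M where "M = wronskian u s"
  define M' where "M' = wronskian v t"
  have "((\<lambda>w. (M' w ** adjugate (M w)) $ i $ j) has_field_derivative 0) (at w)" if w: "w \<in> U" for i j w
  proof -
    define K :: mat2 where "K = vector [vector [0, schwarzian g w], vector [1, 0]]"
    have K: "K$1$1 = 0" "K$1$2 = schwarzian g w" "K$2$1 = 1" "K$2$2 = 0"
      by (simp_all add: K_def)
    have DM: "((\<lambda>w. M w $ i $ j) has_field_derivative (M w ** K) $ i $ j) (at w)" for i j
      unfolding M_def K_def using us w U by (intro wronskian_has_derivative) auto
    have DM': "((\<lambda>w. M' w $ i $ j) has_field_derivative (M' w ** K) $ i $ j) (at w)" for i j
      unfolding M'_def K_def using vt w U S by (intro wronskian_has_derivative) auto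
    have "\<forall>i j. ((\<lambda>w. (M' w ** adjugate (M w)) $ i $ j) has_field_derivative 0) (at w)"
      unfolding forall_2 matrix_mult_entry adjugate_entry
      by (intro conjI; (rule derivative_eq_intros DM DM' refl)+; simp add: matrix_mult_entry K algebra_simps)
    then show ?thesis
      by blast
  qed
  note const = this
  obtain C0 where C0: "\<And>w. w \<in> U \<Longrightarrow> M' w ** adjugate (M w) = C0"
    by (rule holomorphic_mat_constant[OF U(1) convex_connected[OF U(2)] U(3) const]) auto
  \<comment> \<open>The fundamental matrices have determinant -1, so the inverse of \<open>M\<close> is minus its adjugate.\<close>
  define C where "C = cscale (- 1) C0"
  have CM: "C ** M w = M' w" if w: "w \<in> U" for w
  proof -
    have "C ** M w = cscale (-1) (M' w ** (adjugate (M w) ** M w))"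
      by (simp add: C_def C0[OF w, symmetric] cscale_mult_left matrix_mul_assoc)
    then show ?thesis
      using us(5)[OF w] by (simp add: adjugate_mult_self M_def cscale_mult_right cscale_cscale)
  qed
  obtain w0 where w0: "w0 \<in> U"
    using U(3) by auto
  have "det C * - 1 = - 1"
    using arg_cong[OF CM[OF w0], of det] us(5)[OF w0] vt(5)[OF w0] by (simp add: det_mul M_def M'_def)
  then have dC: "det C = 1"
    by simp
  moreover have "b w = C ** a w ** adjugate C" if w: "w \<in> U" for w
  proof -
    have s0: "s w \<noteq> 0" "t w \<noteq> 0"
      using us(3)[OF w] vt(3)[OF w] by auto
    have "a w $ 2 $ 1 = Q w * (s w * s w)" "b w $ 2 $ 1 = Q w * (t w * t w)"
      using us(3)[OF w] vt(3)[OF w] a(2)[OF w] b(2)[OF w] by algebra+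
    then have A: "a w = cscale (Q w) (vector [vector [u w * s w, - (u w * u w)], vector [s w * s w, - (u w * s w)]])"
      and B: "b w = cscale (Q w) (vector [vector [v w * t w, - (v w * v w)], vector [t w * t w, - (v w * t w)]])"
      using a(1,3)[OF w] b(1,3)[OF w] Q[OF w] s0 us(4)[OF w] vt(4)[OF w]
      by (auto intro!: nilpotent_from_slope)
    have "C$1$1 * u w + C$1$2 * s w = v w" "C$2$1 * u w + C$2$2 * s w = t w"
      using CM[OF w] by (simp_all add: mat2_eq_iff matrix_mult_entry M_def M'_def wronskian_entry)
    then show ?thesis
      using spinor_square_conj[OF dC, of "u w" "s w"]
      by (simp add: A B cscale_mult_left cscale_mult_right Let_def)
  qed
  ultimately show ?thesis
    using that by blast
qed


section \<open>Immersed surfaces\<close>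

text \<open>A connected Riemann surface whose atlas also contains all restrictions of its charts to preimages of open sets. This closure is what allows
  a chart to be shrunk around a point.\<close>

locale complex_atlas =
  fixes T :: "'b::t2_space set" and \<B> :: "'b chart set"
  assumes connected: "connected T"
    and chart_open: "\<And>c. c \<in> \<B> \<Longrightarrow> openin (top_of_set T) (fst c)"
    and image_open: "\<And>c. c \<in> \<B> \<Longrightarrow> open (snd c ` fst c)"
    and homeo: "\<And>c. c \<in> \<B> \<Longrightarrow>
      homeomorphism (fst c) (snd c ` fst c) (snd c) (inv_into (fst c) (snd c))"
    and transition: "\<And>c c'. c \<in> \<B> \<Longrightarrow> c' \<in> \<B> \<Longrightarrow>
      in_chart c (snd c') holomorphic_on snd c ` (fst c \<inter> fst c')"
    and cover: "\<And>p. p \<in> T \<Longrightarrow> \<exists>c\<in>\<B>. p \<in> fst c"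
    and restrict: "\<And>c D. c \<in> \<B> \<Longrightarrow> open D \<Longrightarrow> (fst c \<inter> snd c -` D, snd c) \<in> \<B>"
begin

lemma chart_subset: "c \<in> \<B> \<Longrightarrow> fst c \<subseteq> T"
  using chart_open openin_imp_subset by blast

lemma chart_inverse: "c \<in> \<B> \<Longrightarrow> p \<in> fst c \<Longrightarrow> inv_into (fst c) (snd c) (snd c p) = p"
  using homeo homeomorphism_apply1 by metis

lemma in_chart_apply: "c \<in> \<B> \<Longrightarrow> p \<in> fst c \<Longrightarrow> in_chart c h (snd c p) = h p"
  by (simp add: in_chart_def chart_inverse)

lemma open_chart_image:
  assumes "c \<in> \<B>" "openin (top_of_set T) V" "V \<subseteq> fst c"
  shows "open (snd c ` V)"
proof -
  have "openin (top_of_set (fst c)) V"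
    using assms chart_subset[OF assms(1)] by (metis openin_subset_trans)
  then have "openin (top_of_set (snd c ` fst c)) (snd c ` V)"
    using homeomorphism_imp_open_map[OF homeo[OF assms(1)]] by blast
  then show ?thesis
    using image_open[OF assms(1)] openin_open_trans by blast
qed

lemma overlap_open: "c \<in> \<B> \<Longrightarrow> c' \<in> \<B> \<Longrightarrow> open (snd c ` (fst c \<inter> fst c'))"
  by (intro open_chart_image openin_Int chart_open) auto

lemma transition_derivative:
  assumes c: "c \<in> \<B>" "c' \<in> \<B>" and p: "p \<in> fst c" "p \<in> fst c'"
  obtains \<kappa> where "\<kappa> \<noteq> 0" "(in_chart c (snd c') has_field_derivative \<kappa>) (at (snd c p))"
proof -
  let ?\<tau> = "in_chart c (snd c')" and ?\<sigma> = "in_chart c' (snd c)"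
  let ?O = "snd c ` (fst c \<inter> fst c')" and ?O' = "snd c' ` (fst c' \<inter> fst c)"
  have "(?\<tau> has_field_derivative deriv ?\<tau> (snd c p)) (at (snd c p))"
    using p by (intro holomorphic_derivI[OF transition[OF c] overlap_open[OF c]]) auto
  moreover have "(?\<sigma> has_field_derivative deriv ?\<sigma> (snd c' p)) (at (snd c' p))"
    using p by (intro holomorphic_derivI[OF transition[OF c(2,1)] overlap_open[OF c(2,1)]]) auto
  then have "(?\<sigma> has_field_derivative deriv ?\<sigma> (snd c' p)) (at (?\<tau> (snd c p)))"
    using c p by (simp add: in_chart_apply)
  ultimately have "(?\<sigma> \<circ> ?\<tau> has_field_derivative deriv ?\<sigma> (snd c' p) * deriv ?\<tau> (snd c p)) (at (snd c p))"
    by (intro DERIV_chain)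
  moreover have "(?\<sigma> \<circ> ?\<tau>) u = u" if "u \<in> ?O" for u
    using that c by (auto simp: in_chart_apply)
  ultimately have "((\<lambda>u. u) has_field_derivative deriv ?\<sigma> (snd c' p) * deriv ?\<tau> (snd c p)) (at (snd c p))"
    using has_field_derivative_cong_open[OF overlap_open[OF c], of "snd c p" "?\<sigma> \<circ> ?\<tau>" "\<lambda>u. u"] p by simp
  then have "deriv ?\<sigma> (snd c' p) * deriv ?\<tau> (snd c p) = 1"
    using DERIV_unique DERIV_ident by blast
  then have "deriv ?\<tau> (snd c p) \<noteq> 0"
    by auto
  then show ?thesis
    using that \<open>(?\<tau> has_field_derivative deriv ?\<tau> (snd c p)) (at (snd c p))\<close> by blast
qed

lemma wirtinger_chart_change:
  assumes c: "c \<in> \<B>" "c' \<in> \<B>" and p: "p \<in> fst c" "p \<in> fst c'"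
  obtains \<kappa> where "\<kappa> \<noteq> 0"
    "\<And>h. in_chart c' h differentiable at (snd c' p) \<Longrightarrow>
       wz (in_chart c h) (snd c p) = cscale \<kappa> (wz (in_chart c' h) (snd c' p))"
proof -
  obtain \<kappa> where \<kappa>: "\<kappa> \<noteq> 0" "(in_chart c (snd c') has_field_derivative \<kappa>) (at (snd c p))"
    using transition_derivative[OF assms] .
  have "wz (in_chart c h) (snd c p) = cscale \<kappa> (wz (in_chart c' h) (snd c' p))"
    if h: "in_chart c' h differentiable at (snd c' p)" for h
  proof -
    let ?A = "wz (in_chart c' h) (snd c' p)" and ?B = "wzb (in_chart c' h) (snd c' p)"
    have "(in_chart c' h has_derivative (\<lambda>x. cscale x ?A + cscale (cnj x) ?B)) (at (in_chart c (snd c') (snd c p)))"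
      using has_derivative_wirtinger[OF h] c p by (simp add: in_chart_apply)
    from has_derivative_compose[OF \<kappa>(2)[unfolded has_field_derivative_def] this]
    have D: "((\<lambda>u. in_chart c' h (in_chart c (snd c') u)) has_derivative
       (\<lambda>x. cscale (\<kappa> * x) ?A + cscale (cnj (\<kappa> * x)) ?B)) (at (snd c p))" .
    have "wz (in_chart c h) (snd c p) = wz (\<lambda>u. in_chart c' h (in_chart c (snd c') u)) (snd c p)"
      using p c by (intro wirtinger_cong(1)[OF overlap_open[OF c]]) (auto simp: in_chart_apply)
    also have "\<dots> = cscale \<kappa> ?A"
      unfolding wz_wzb_has_derivative(1)[OF D] by (simp add: mat2_simps algebra_simps)
    finally show ?thesis .
  qed
  with \<kappa>(1) show ?thesis
    using that by blast
qed

end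

text \<open>Hence the normal computed in one chart serves all charts: a change of chart scales \<open>a\<close> by the derivative of the transition.\<close>

lemma normal_of_cscale:
  assumes "k \<noteq> 0"
  shows "normal_of m (cscale k a) = normal_of m a"
proof -
  have s: "sharp m (cscale k a) = cscale (cnj k) (sharp m a)"
    by (simp add: sharp_def mat2_distribs)
  show ?thesis
    unfolding normal_of_def s using assms
    by (simp add: mat2_distribs trace_cscale mult.commute)
qed

lemma dz_eq_wz: "dz c f p = wz (in_chart c f) (snd c p)"
  and dzbar_eq_wzb: "dzbar c f p = wzb (in_chart c f) (snd c p)"
  by (simp_all add: dz_def dzbar_def wz_def wzb_def dx_def dy_def)

lemma dx_dy_eq:
  "dx c f p = wz (in_chart c f) (snd c p) + wzb (in_chart c f) (snd c p)"
  "dy c f p = cscale \<i> (wz (in_chart c f) (snd c p) - wzb (in_chart c f) (snd c p))"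
  by (simp_all add: dx_def dy_def frechet_from_wirtinger)

locale conformal_surface = complex_atlas T \<B> for T :: "'b::t2_space set" and \<B> +
  fixes X :: ambient and f :: "'b \<Rightarrow> mat2"
  assumes conformal: "conformal_immersion X \<B> f"
begin

lemma chart: "c \<in> \<B> \<Longrightarrow> conformal_chart X (in_chart c f) (snd c ` fst c)"
  using conformal image_open[of c]
  unfolding conformal_immersion_def immersion_def dz_eq_wz
  by unfold_locales (auto simp: in_chart_apply)

abbreviation "A c \<equiv> tangent_form X (in_chart c f)"
abbreviation "n \<equiv> unit_normal X \<B> f"

lemma tangent:
  assumes "c \<in> \<B>" "p \<in> fst c"
  shows "tangent_direction X (f p) (gram X (f p)) (A c (snd c p))"
  using conformal_chart.tangent[OF chart[OF assms(1)], of "snd c p"] assms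
  by (simp add: in_chart_apply)

lemma A_chart_change:
  assumes c: "c \<in> \<B>" "c' \<in> \<B>" and p: "p \<in> fst c" "p \<in> fst c'"
    and \<kappa>: "\<And>h. in_chart c' h differentiable at (snd c' p) \<Longrightarrow>
       wz (in_chart c h) (snd c p) = cscale \<kappa> (wz (in_chart c' h) (snd c' p))"
  shows "A c (snd c p) = cscale \<kappa> (A c' (snd c' p))"
proof -
  have "in_chart c' f differentiable at (snd c' p)"
    using conformal_chart.F_differentiable[OF chart[OF c(2)]] p by blast
  then show ?thesis
    unfolding tangent_form_def using \<kappa> c p by (simp add: in_chart_apply cscale_mult_right)
qed

text \<open>The definition of the unit normal asks for compatibility with all charts at once, so existence needs the invariance under changes of
  charts.\<close>

lemma unit_normal_eq:
  assumes c: "c \<in> \<B>" and p: "p \<in> fst c"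
  shows "n p = normal_of (gram X (f p)) (A c (snd c p))"
proof -
  let ?N = "normal_of (gram X (f p)) (A c (snd c p))"
  have iff: "minner (dx c' f p) n' = 0 \<and> minner (dy c' f p) n' = 0 \<and> minner n' n' = 1 \<and>
        positive_triple X (f p) (dx c' f p) (dy c' f p) n' \<longleftrightarrow> n' = ?N"
    if c': "c' \<in> \<B>" "p \<in> fst c'" for c' n'
  proof -
    interpret t: tangent_direction X "f p" "gram X (f p)" "A c' (snd c' p)"
      by (rule tangent[OF c'])
    interpret C: conformal_chart X "in_chart c' f" "snd c' ` fst c'"
      by (rule chart[OF c'(1)])
    have w: "snd c' p \<in> snd c' ` fst c'"
      using c' by blast
    obtain \<kappa> where \<kappa>: "\<kappa> \<noteq> 0" "\<And>h. in_chart c h differentiable at (snd c p) \<Longrightarrow>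
       wz (in_chart c' h) (snd c' p) = cscale \<kappa> (wz (in_chart c h) (snd c p))"
      using wirtinger_chart_change[OF c'(1) c c'(2) p] by blast
    have "A c' (snd c' p) = cscale \<kappa> (A c (snd c p))"
      by (rule A_chart_change[OF c'(1) c c'(2) p \<kappa>(2)])
    then have N: "normal_of (gram X (f p)) (A c' (snd c' p)) = ?N"
      using normal_of_cscale[OF \<kappa>(1)] by simp
    have x: "dx c' f p = gram X (f p) ** A c' (snd c' p) + ctranspose (A c' (snd c' p)) ** gram X (f p)"
      and y: "dy c' f p = cscale \<i> (gram X (f p) ** A c' (snd c' p) - ctranspose (A c' (snd c' p)) ** gram X (f p))"
      using C.M_A[OF w] C.A_M[OF w] c' by (simp_all add: dx_dy_eq in_chart_apply)
    show ?thesis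
      unfolding x y using normal_of_unique[OF t.q t.a] N by simp
  qed
  show ?thesis
    unfolding unit_normal_def
  proof (rule the_equality)
    show "\<forall>c\<in>\<B>. p \<in> fst c \<longrightarrow> minner (dx c f p) ?N = 0 \<and> minner (dy c f p) ?N = 0 \<and> minner ?N ?N = 1 \<and>
        positive_triple X (f p) (dx c f p) (dy c f p) ?N"
      using iff by blast
  qed (use iff c p in blast)
qed

lemma unit_normal_chart:
  assumes "c \<in> \<B>" "w \<in> snd c ` fst c"
  shows "in_chart c n w = normal_of (gram X (in_chart c f w)) (A c w)"
proof -
  obtain p where "p \<in> fst c" "w = snd c p"
    using assms by blast
  then show ?thesis
    using unit_normal_eq[OF assms(1), of p] assms(1) by (simp add: in_chart_apply)
qed

lemma unit_normal_derivative:
  assumes "c \<in> \<B>" "p \<in> fst c"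
  shows "dz c n p = wz (\<lambda>w. normal_of (gram X (in_chart c f w)) (A c w)) (snd c p)"
    "dzbar c n p = wzb (\<lambda>w. normal_of (gram X (in_chart c f w)) (A c w)) (snd c p)"
  unfolding dz_eq_wz dzbar_eq_wzb
  by (rule wirtinger_cong[OF image_open[OF assms(1)] imageI[OF assms(2)]],
      erule unit_normal_chart[OF assms(1)])+

lemma hopf_eigen:
  assumes "c \<in> \<B>" "p \<in> fst c"
  shows "A c (snd c p) ** wz (A c) (snd c p) = cscale (hopf X \<B> f c p) (A c (snd c p))"
  unfolding hopf_def dz_eq_wz[of c f] unit_normal_derivative[OF assms]
  using conformal_chart.hopf_eigenvalue[OF chart[OF assms(1)], of "snd c p"] assms by blast

lemma minimal_or_cmc1_iff:
  "minimal_or_cmc1 X \<B> f \<longleftrightarrow> (\<forall>c\<in>\<B>. \<forall>w\<in>snd c ` fst c. wzb (A c) w = 0)"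
proof -
  have "mean_curvature X \<B> f c p = (case X of Euclidean \<Rightarrow> 0 | Hyperbolic \<Rightarrow> 1) \<longleftrightarrow> wzb (A c) (snd c p) = 0"
    if "c \<in> \<B>" "p \<in> fst c" for c p
    unfolding mean_curvature_def dz_eq_wz[of c f] dzbar_eq_wzb[of c f] unit_normal_derivative[OF that]
    using conformal_chart.mean_curvature_iff[OF chart[OF that(1)], of "snd c p"] that by blast
  then show ?thesis
    using conformal by (auto simp: minimal_or_cmc1_def)
qed

lemma gauss_map_eq:
  assumes c: "c \<in> \<B>" and p: "p \<in> fst c"
  shows "gauss_map X \<B> f p = image_slope (A c (snd c p))"
proof -
  interpret t: tangent_direction X "f p" "gram X (f p)" "A c (snd c p)"
    by (rule tangent[OF assms])
  show ?thesis
  proof (cases X)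
    case Euclidean
    then have "n p = flat_normal (A c (snd c p))"
      using unit_normal_eq[OF assms] t.flat_normal_of by simp
    then show ?thesis
      using St_flat_normal[OF t.a] by (simp add: Euclidean)
  next
    case Hyperbolic
    then show ?thesis
      using t.St_hyperbolic unit_normal_eq[OF assms] by (simp add: Let_def)
  qed
qed

end

text \<open>A minimal immersion into \<open>E\<^sup>3\<close> or a CMC 1 immersion into \<open>H\<^sup>3\<close>.\<close>

locale minimal_surface = conformal_surface +
  assumes minimal: "minimal_or_cmc1 X \<B> f"
begin

lemma A_holomorphic: "c \<in> \<B> \<Longrightarrow> holomorphic_mat_on (A c) (snd c ` fst c)"
  using minimal conformal_chart.A_differentiable[OF chart]
  unfolding minimal_or_cmc1_iff by (intro holomorphic_mat_onI image_open) auto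

end


section \<open>Goursat transformations as conjugations\<close>

lemma open_nonzero_set:
  assumes "open W" "continuous_on W (K :: complex \<Rightarrow> 'a::real_normed_vector)"
  shows "open {w \<in> W. K w \<noteq> 0}"
proof -
  have "open (W \<inter> K -` (- {0}))"
    using assms by (intro continuous_open_preimage) auto
  moreover have "W \<inter> K -` (- {0}) = {w \<in> W. K w \<noteq> 0}"
    by auto
  ultimately show ?thesis by simp
qed

lemma holomorphic_mat_entry: "holomorphic_mat_on F W \<Longrightarrow> (\<lambda>w. F w $ i $ j) holomorphic_on W"
  by (simp add: holomorphic_mat_on_def)

lemma holomorphic_mat_subset: "holomorphic_mat_on F W \<Longrightarrow> U \<subseteq> W \<Longrightarrow> holomorphic_mat_on F U"
  unfolding holomorphic_mat_on_def using holomorphic_on_subset by blast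

lemma holomorphic_mat_continuous:
  assumes "holomorphic_mat_on F W" "open W"
  shows "continuous_on W F"
  using holomorphic_mat_wirtinger(1)[OF assms]
  by (auto intro!: differentiable_imp_continuous_on differentiable_at_imp_differentiable_on)

text \<open>The entry \<open>(2,1)\<close> of the eigenvalue equation is the quotient rule for the slope.\<close>

lemma slope_derivative:
  assumes "open U" "w \<in> U" "holomorphic_mat_on a U" "trace (a w) = 0" "a w $ 2 $ 1 \<noteq> 0"
    and "a w ** deriv_mat a w = cscale Q (a w)"
  shows "a w $ 2 $ 1 * deriv (\<lambda>u. a u $ 1 $ 1 / a u $ 2 $ 1) w = Q"
proof -
  have D: "((\<lambda>u. a u $ i $ j) has_field_derivative deriv_mat a w $ i $ j) (at w)" for i j
    using holomorphic_has_deriv[OF holomorphic_mat_entry[OF assms(3)] assms(1,2)] by (simp add: deriv_mat_def)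
  have a22: "a w $ 2 $ 2 = - a w $ 1 $ 1"
    using assms(4) by (simp add: trace_2 add_eq_0_iff)
  have "((\<lambda>u. a u $ 1 $ 1 / a u $ 2 $ 1) has_field_derivative
     (deriv_mat a w $ 1 $ 1 * a w $ 2 $ 1 - a w $ 1 $ 1 * deriv_mat a w $ 2 $ 1) / (a w $ 2 $ 1 * a w $ 2 $ 1)) (at w)"
    using assms(5) by (auto intro!: derivative_eq_intros D)
  then have "deriv (\<lambda>u. a u $ 1 $ 1 / a u $ 2 $ 1) w =
     (deriv_mat a w $ 1 $ 1 * a w $ 2 $ 1 - a w $ 1 $ 1 * deriv_mat a w $ 2 $ 1) / (a w $ 2 $ 1 * a w $ 2 $ 1)"
    by (rule DERIV_imp_deriv)
  moreover have "(a w ** deriv_mat a w) $ 2 $ 1 = Q * a w $ 2 $ 1"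
    by (simp add: assms(6) cscale_entry)
  then have "deriv_mat a w $ 1 $ 1 * a w $ 2 $ 1 - a w $ 1 $ 1 * deriv_mat a w $ 2 $ 1 = Q * a w $ 2 $ 1"
    by (simp add: matrix_mult_entry a22 mult.commute)
  ultimately show ?thesis
    using assms(5) by simp
qed

text \<open>If the Gauss map were constantly infinite on an open set, only the upper right entry of \<open>a\<close> would be nonzero there, and \<open>a a\<^sub>z\<close>
  would vanish.\<close>

lemma exists_finite_slope:
  assumes Z: "open Z" "w0 \<in> Z" and a: "holomorphic_mat_on a Z"
    and nil: "\<And>w. w \<in> Z \<Longrightarrow> trace (a w) = 0 \<and> det (a w) = 0"
    and nz: "a w0 ** deriv_mat a w0 \<noteq> 0"
  obtains w where "w \<in> Z" "a w $ 2 $ 1 \<noteq> 0"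
proof (rule ccontr)
  assume "\<not> thesis"
  with that have 21: "a w $ 2 $ 1 = 0" if "w \<in> Z" for w
    using \<open>w \<in> Z\<close> by blast
  have 22: "a w $ 2 $ 2 = - a w $ 1 $ 1" if "w \<in> Z" for w
    using nil[OF that] by (simp add: trace_2 add_eq_0_iff)
  have 11: "a w $ 1 $ 1 = 0" if "w \<in> Z" for w
    using nil[OF that] 21[OF that] 22[OF that] by (simp add: det_2)
  have d0: "deriv (\<lambda>u. a u $ i $ j) w0 = 0" if "\<And>w. w \<in> Z \<Longrightarrow> a w $ i $ j = 0" for i j
    using deriv_cong_open[OF Z, of "\<lambda>u. a u $ i $ j" "\<lambda>u. 0"] that by simp
  have "deriv_mat a w0 $ 2 $ 1 = 0" "deriv_mat a w0 $ 1 $ 1 = 0" "deriv_mat a w0 $ 2 $ 2 = 0"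
    unfolding deriv_mat_def using 21 11 22 by (simp_all add: d0)
  then have "a w0 ** deriv_mat a w0 = 0"
    using 21[OF Z(2)] 22[OF Z(2)] 11[OF Z(2)] by (simp add: mat2_simps)
  with nz show False
    by simp
qed

context conformal_surface
begin

lemma slope_chart:
  assumes "c \<in> \<B>" "w \<in> snd c ` fst c" "A c w $ 2 $ 1 \<noteq> 0"
  shows "in_chart c (\<lambda>q. the (gauss_map X \<B> f q)) w = A c w $ 1 $ 1 / A c w $ 2 $ 1"
  using assms gauss_map_eq[OF assms(1)] by (auto simp: in_chart_apply image_slope_def)

lemma chart_nilpotent:
  assumes "c \<in> \<B>" "w \<in> snd c ` fst c"
  shows "trace (A c w) = 0" "det (A c w) = 0" "A c w \<noteq> 0"
  using conformal_chart.trace_A[OF chart] conformal_chart.det_A[OF chart]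
     conformal_chart.A_nonzero[OF chart] assms by blast+

end

context minimal_surface
begin

lemma hopf_deriv:
  assumes "c \<in> \<B>" "p \<in> fst c"
  shows "A c (snd c p) ** deriv_mat (A c) (snd c p) = cscale (hopf X \<B> f c p) (A c (snd c p))"
  using hopf_eigen[OF assms] holomorphic_mat_wirtinger(2)[OF A_holomorphic[OF assms(1)] image_open[OF assms(1)], of "snd c p"] assms
  by simp

end

text \<open>Conjugation by \<open>C\<close> moves the image line of \<open>a\<close> by \<open>C\<close>, that is, its slope by a Moebius transformation.\<close>

lemma spinor_slope_conj:
  assumes a: "trace a = 0" "det a = 0" and C: "det C = 1" and b: "b = C ** a ** adjugate C"
    and nz: "a$2$1 \<noteq> 0" "b$2$1 \<noteq> 0"
  defines "g \<equiv> a$1$1 / a$2$1"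
  shows "C$2$1 * g + C$2$2 \<noteq> 0" "b$1$1 / b$2$1 = (C$1$1 * g + C$1$2) / (C$2$1 * g + C$2$2)"
proof -
  define z where "z = a$2$1"
  have z: "z \<noteq> 0"
    using nz by (simp add: z_def)
  have 11: "a$1$1 = g * z"
    using nz by (simp add: g_def z_def)
  have 22: "a$2$2 = - (g * z)"
    using a(1) 11 by (simp add: trace_2 add_eq_0_iff2)
  have "a$1$2 * z = - (g * z) * (g * z)"
    using a(2) unfolding det_2 11 22 z_def[symmetric] by algebra
  then have "(a$1$2 + g * g * z) * z = 0"
    by algebra
  then have 12: "a$1$2 = - (g * g * z)"
    using z by (simp add: add_eq_0_iff2)
  have b21: "b$2$1 = z * (C$2$1 * g + C$2$2) * (C$2$1 * g + C$2$2)"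
    and b11: "b$1$1 = z * (C$1$1 * g + C$1$2) * (C$2$1 * g + C$2$2)"
    unfolding b by (simp_all add: matrix_mult_entry adjugate_entry 11 12 22 z_def[symmetric] algebra_simps)
  show "C$2$1 * g + C$2$2 \<noteq> 0"
    using nz(2) unfolding b21 by auto
  then show "b$1$1 / b$2$1 = (C$1$1 * g + C$1$2) / (C$2$1 * g + C$2$2)"
    unfolding b21 b11 using z by simp
qed

text \<open>Holomorphy, and the eigenvalue in \<open>a a\<^sub>z = Q a\<close>, are invariant under conjugation by a constant matrix.\<close>

theorem goursat_related_of_conjugate:
  assumes f: "minimal_surface T \<B> X f" and g: "conformal_surface T \<B> X g" and C: "det C = 1"
    and conj: "\<And>c w. c \<in> \<B> \<Longrightarrow> w \<in> snd c ` fst c \<Longrightarrow>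
      tangent_form X (in_chart c g) w = C ** tangent_form X (in_chart c f) w ** adjugate C"
  shows "goursat_related X \<B> f g"
proof -
  interpret f: minimal_surface T \<B> X f by fact
  interpret g: conformal_surface T \<B> X g by fact
  have wirt: "wz (g.A c) w = C ** wz (f.A c) w ** adjugate C" "wzb (g.A c) w = C ** wzb (f.A c) w ** adjugate C"
    if c: "c \<in> \<B>" "w \<in> snd c ` fst c" for c w
  proof -
    have d: "f.A c differentiable at w"
      using conformal_chart.A_differentiable[OF f.chart[OF c(1)] c(2)] .
    have "wz (g.A c) w = wz (\<lambda>w. C ** f.A c w ** adjugate C) w" "wzb (g.A c) w = wzb (\<lambda>w. C ** f.A c w ** adjugate C) w"
      using wirtinger_cong[OF f.image_open[OF c(1)] c(2), of "g.A c"] conj[OF c(1)] by auto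
    then show "wz (g.A c) w = C ** wz (f.A c) w ** adjugate C" "wzb (g.A c) w = C ** wzb (f.A c) w ** adjugate C"
      using d by (simp_all add: wirtinger_mult mat2_differentiable)
  qed
  have g': "minimal_or_cmc1 X \<B> g"
    using f.minimal wirt unfolding f.minimal_or_cmc1_iff g.minimal_or_cmc1_iff by simp
  then interpret g: minimal_surface T \<B> X g
    by unfold_locales
  have hopf: "hopf X \<B> f c p = hopf X \<B> g c p" if c: "c \<in> \<B>" "p \<in> fst c" for c p
  proof -
    have w: "snd c p \<in> snd c ` fst c"
      using c by blast
    have "g.A c (snd c p) ** wz (g.A c) (snd c p) =
       C ** (f.A c (snd c p) ** wz (f.A c) (snd c p)) ** adjugate C"
      unfolding conj[OF c(1) w] wirt[OF c(1) w] by (simp add: matrix_mul_assoc adjugate_cancel[OF C])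
    also have "\<dots> = cscale (hopf X \<B> f c p) (g.A c (snd c p))"
      unfolding f.hopf_eigen[OF c] conj[OF c(1) w] by (simp add: mat2_distribs)
    finally have "cscale (hopf X \<B> g c p) (g.A c (snd c p)) = cscale (hopf X \<B> f c p) (g.A c (snd c p))"
      by (simp add: g.hopf_eigen[OF c])
    then show ?thesis
      using g.chart_nilpotent(3)[OF c(1) w] by (auto simp: mat2_simps)
  qed
  have schw: "schwarzian (in_chart c (\<lambda>q. the (gauss_map X \<B> f q))) (snd c p) =
      schwarzian (in_chart c (\<lambda>q. the (gauss_map X \<B> g q))) (snd c p)"
    if c: "c \<in> \<B>" "p \<in> fst c" and G: "gauss_map X \<B> f p \<noteq> None" "gauss_map X \<B> g p \<noteq> None"
      and d: "deriv (in_chart c (\<lambda>q. the (gauss_map X \<B> f q))) (snd c p) \<noteq> 0" for c p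
  proof -
    let ?W = "snd c ` fst c"
    have w: "snd c p \<in> ?W"
      using c by blast
    define gf where "gf u = f.A c u $ 1 $ 1 / f.A c u $ 2 $ 1" for u
    define gg where "gg u = g.A c u $ 1 $ 1 / g.A c u $ 2 $ 1" for u
    define U1 where "U1 = {u \<in> ?W. f.A c u $ 2 $ 1 * g.A c u $ 2 $ 1 \<noteq> 0}"
    have hol: "(\<lambda>u. f.A c u $ i $ j) holomorphic_on ?W" "(\<lambda>u. g.A c u $ i $ j) holomorphic_on ?W" for i j
      using f.A_holomorphic[OF c(1)] g.A_holomorphic[OF c(1)] by (auto simp: holomorphic_mat_on_def)
    have U1: "open U1"
      unfolding U1_def using hol
      by (intro open_nonzero_set f.image_open c holomorphic_on_imp_continuous_on holomorphic_intros)
    have sub: "U1 \<subseteq> ?W"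
      by (auto simp: U1_def)
    have w1: "snd c p \<in> U1"
      using G w f.gauss_map_eq[OF c] g.gauss_map_eq[OF c] by (auto simp: U1_def image_slope_def split: if_splits)
    have gf: "gf holomorphic_on U1"
      unfolding gf_def[abs_def] using holomorphic_on_subset[OF hol(1) sub]
      by (intro holomorphic_intros) (auto simp: U1_def)
    define U where "U = {u \<in> U1. deriv gf u \<noteq> 0}"
    have U: "open U"
      unfolding U_def using gf U1
      by (intro open_nonzero_set holomorphic_on_imp_continuous_on holomorphic_deriv)
    have eqf: "in_chart c (\<lambda>q. the (gauss_map X \<B> f q)) u = gf u" if "u \<in> U1" for u
      unfolding gf_def using that by (intro f.slope_chart c) (auto simp: U1_def)
    have eqg: "in_chart c (\<lambda>q. the (gauss_map X \<B> g q)) u = gg u" if "u \<in> U1" for u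
      unfolding gg_def using that by (intro g.slope_chart c) (auto simp: U1_def)
    have wU: "snd c p \<in> U"
      using d deriv_cong_open[OF U1 w1 eqf] w1 by (simp add: U_def)
    have mob: "C$2$1 * gf u + C$2$2 \<noteq> 0" "gg u = (C$1$1 * gf u + C$1$2) / (C$2$1 * gf u + C$2$2)"
      if "u \<in> U" for u
    proof -
      have u: "u \<in> ?W" "f.A c u $ 2 $ 1 \<noteq> 0" "g.A c u $ 2 $ 1 \<noteq> 0"
        using that by (auto simp: U_def U1_def)
      show "C$2$1 * gf u + C$2$2 \<noteq> 0" "gg u = (C$1$1 * gf u + C$1$2) / (C$2$1 * gf u + C$2$2)"
        unfolding gf_def gg_def
        using spinor_slope_conj[OF f.chart_nilpotent(1,2)[OF c(1) u(1)] C conj[OF c(1) u(1)] u(2,3)] by auto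
    qed
    have "schwarzian gg (snd c p) = schwarzian gf (snd c p)"
    proof (rule schwarzian_moebius[OF U wU _ _ mob(1) _ mob(2)])
      show "gf holomorphic_on U"
        using gf by (rule holomorphic_on_subset) (auto simp: U_def)
      show "C$1$1 * C$2$2 - C$1$2 * C$2$1 = 1"
        using C by (simp add: det_2)
    qed (auto simp: U_def)
    then show ?thesis
      using schwarzian_cong[OF U1 w1 eqf] schwarzian_cong[OF U1 w1 eqg] by simp
  qed
  show ?thesis
    unfolding goursat_related_def same_schwarzian_def Let_def
    using f.minimal g' hopf schw by blast
qed

text \<open>Two immersions with the same Hopf differential and the same Schwarzian derivative of the Gauss maps.\<close>

locale surface_pair = f: minimal_surface T \<B> X f + g: minimal_surface T \<B> X g
  for T :: "'b::t2_space set" and \<B> X f g +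
  assumes hopf_eq: "\<And>c p. c \<in> \<B> \<Longrightarrow> p \<in> fst c \<Longrightarrow> hopf X \<B> f c p = hopf X \<B> g c p"
    and schwarzian_eq: "same_schwarzian \<B> (gauss_map X \<B> f) (gauss_map X \<B> g)"
begin

text \<open>In a chart where \<open>Q\<close> is not identically zero there is a ball on which \<open>Q \<noteq> 0\<close> and both Gauss maps are finite. They
  are unramified there because \<open>a\<^sub>2\<^sub>1 g' = Q\<close>, so their Schwarzian derivatives are equal on this ball.\<close>

lemma local_conjugate:
  assumes c: "c \<in> \<B>" and p: "p \<in> fst c" and Q: "hopf X \<B> f c p \<noteq> 0"
  obtains C U where "det C = 1" "open U" "U \<noteq> {}" "U \<subseteq> snd c ` fst c"
    "\<And>w. w \<in> U \<Longrightarrow> g.A c w = C ** f.A c w ** adjugate C"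
proof -
  let ?W = "snd c ` fst c"
  define q where "q w = hopf X \<B> f c (inv_into (fst c) (snd c) w)" for w
  have eig: "f.A c w ** deriv_mat (f.A c) w = cscale (q w) (f.A c w)"
    "g.A c w ** deriv_mat (g.A c) w = cscale (q w) (g.A c w)" if w: "w \<in> ?W" for w
  proof -
    obtain p' where p': "p' \<in> fst c" "w = snd c p'"
      using w by blast
    then have q: "q w = hopf X \<B> f c p'" "q w = hopf X \<B> g c p'"
      using hopf_eq[OF c] by (simp_all add: q_def f.chart_inverse[OF c])
    show "f.A c w ** deriv_mat (f.A c) w = cscale (q w) (f.A c w)"
      "g.A c w ** deriv_mat (g.A c) w = cscale (q w) (g.A c w)"
      using f.hopf_deriv[OF c p'(1)] g.hopf_deriv[OF c p'(1)] p'(2) q by auto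
  qed
  have hol: "holomorphic_mat_on (f.A c) ?W" "holomorphic_mat_on (g.A c) ?W"
    using f.A_holomorphic[OF c] g.A_holomorphic[OF c] by auto
  have oW: "open ?W"
    by (rule f.image_open[OF c])
  define Z where "Z = {w \<in> ?W. f.A c w ** deriv_mat (f.A c) w \<noteq> 0}"
  have "open Z"
    unfolding Z_def
    by (intro open_nonzero_set oW holomorphic_mat_continuous holomorphic_mat_mult holomorphic_mat_deriv hol)
  have ZW: "Z \<subseteq> ?W"
    by (auto simp: Z_def)
  have Zq: "q w \<noteq> 0" if "w \<in> Z" for w
    using that eig(1)[of w] by (auto simp: Z_def)
  have Zg: "g.A c w ** deriv_mat (g.A c) w \<noteq> 0" if "w \<in> Z" for w
    using Zq[OF that] eig(2)[of w] that ZW g.chart_nilpotent(3)[OF c] by (auto simp: cscale_eq_0_iff)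
  have pZ: "snd c p \<in> Z"
    using p Q f.chart_nilpotent(3)[OF c, of "snd c p"] eig(1)[of "snd c p"]
    by (auto simp: Z_def cscale_eq_0_iff q_def f.chart_inverse[OF c])
  have holZ: "holomorphic_mat_on (f.A c) Z" "holomorphic_mat_on (g.A c) Z"
    using hol holomorphic_mat_subset ZW by blast+
  obtain w1 where w1: "w1 \<in> Z" "f.A c w1 $ 2 $ 1 \<noteq> 0"
  proof (rule exists_finite_slope[OF \<open>open Z\<close> pZ holZ(1)])
    show "f.A c (snd c p) ** deriv_mat (f.A c) (snd c p) \<noteq> 0"
      using pZ by (simp add: Z_def)
  qed (use f.chart_nilpotent[OF c] ZW in auto)
  define Z1 where "Z1 = {w \<in> Z. f.A c w $ 2 $ 1 \<noteq> 0}"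
  have oZ1: "open Z1"
    unfolding Z1_def
    by (intro open_nonzero_set \<open>open Z\<close> holomorphic_on_imp_continuous_on holomorphic_mat_entry holZ)
  have Z1Z: "Z1 \<subseteq> Z" and w1Z: "w1 \<in> Z1"
    using w1 by (auto simp: Z1_def)
  obtain w2 where w2: "w2 \<in> Z1" "g.A c w2 $ 2 $ 1 \<noteq> 0"
  proof (rule exists_finite_slope[OF oZ1 w1Z holomorphic_mat_subset[OF holZ(2) Z1Z]])
    show "g.A c w1 ** deriv_mat (g.A c) w1 \<noteq> 0"
      using w1(1) Zg by blast
  qed (use g.chart_nilpotent[OF c] ZW Z1Z in auto)
  define Z2 where "Z2 = {w \<in> Z1. g.A c w $ 2 $ 1 \<noteq> 0}"
  have Z2W: "Z2 \<subseteq> ?W"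
    using ZW Z1Z by (auto simp: Z2_def)
  have "open Z2"
    unfolding Z2_def
    by (intro open_nonzero_set oZ1 holomorphic_on_imp_continuous_on holomorphic_mat_entry
      holomorphic_mat_subset[OF holZ(2) Z1Z])
  moreover have "w2 \<in> Z2"
    using w2 by (simp add: Z2_def)
  ultimately obtain e where e: "e > 0" "ball w2 e \<subseteq> Z2"
    using open_contains_ball by blast
  define U where "U = ball w2 e"
  have U: "open U" "convex U" "U \<noteq> {}" "U \<subseteq> ?W" "U \<subseteq> Z2"
    using e Z2W by (auto simp: U_def)
  define gf where "gf u = f.A c u $ 1 $ 1 / f.A c u $ 2 $ 1" for u
  define gg where "gg u = g.A c u $ 1 $ 1 / g.A c u $ 2 $ 1" for u
  have nz: "f.A c w $ 2 $ 1 \<noteq> 0" "g.A c w $ 2 $ 1 \<noteq> 0" "q w \<noteq> 0" if "w \<in> U" for w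
    using that U(5) Zq by (auto simp: Z2_def Z1_def)
  have holU: "holomorphic_mat_on (f.A c) U" "holomorphic_mat_on (g.A c) U"
    using hol holomorphic_mat_subset U(4) by blast+
  have slopes: "gf holomorphic_on U" "gg holomorphic_on U"
    unfolding gf_def[abs_def] gg_def[abs_def] using holU[THEN holomorphic_mat_entry] nz
    by (auto intro!: holomorphic_intros)
  have nil: "trace (f.A c w) = 0 \<and> det (f.A c w) = 0" "trace (g.A c w) = 0 \<and> det (g.A c w) = 0" if "w \<in> U" for w
    using f.chart_nilpotent[OF c] g.chart_nilpotent[OF c] that U(4) by auto
  have der: "f.A c w $ 2 $ 1 * deriv gf w = q w" "g.A c w $ 2 $ 1 * deriv gg w = q w" if "w \<in> U" for w
    unfolding gf_def[abs_def] gg_def[abs_def]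
    using that U(4) nil[OF that] nz[OF that] eig
    by (auto intro!: slope_derivative[OF U(1) that] holU)
  have der0: "deriv gf w \<noteq> 0" "deriv gg w \<noteq> 0" if "w \<in> U" for w
    using der[OF that] nz[OF that] by auto
  have S: "schwarzian gf w = schwarzian gg w" if w: "w \<in> U" for w
  proof -
    obtain p' where p': "p' \<in> fst c" "w = snd c p'"
      using w U(4) by blast
    let ?Gf = "in_chart c (\<lambda>q. the (gauss_map X \<B> f q))" and ?Gg = "in_chart c (\<lambda>q. the (gauss_map X \<B> g q))"
    have eq: "?Gf u = gf u" "?Gg u = gg u" if "u \<in> U" for u
      unfolding gf_def gg_def using that U(4) nz[OF that] f.slope_chart[OF c] g.slope_chart[OF c] by auto
    have "gauss_map X \<B> f p' \<noteq> None" "gauss_map X \<B> g p' \<noteq> None"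
      using f.gauss_map_eq[OF c p'(1)] g.gauss_map_eq[OF c p'(1)] nz[OF w] p'(2) by (simp_all add: image_slope_def)
    moreover have "deriv ?Gf w \<noteq> 0" "deriv ?Gg w \<noteq> 0"
      using der0[OF w] deriv_cong_open[OF U(1) w eq(1)] deriv_cong_open[OF U(1) w eq(2)] by auto
    ultimately have "schwarzian ?Gf w = schwarzian ?Gg w"
      using schwarzian_eq c p' unfolding same_schwarzian_def Let_def by blast
    then show ?thesis
      using schwarzian_cong[OF U(1) w eq(1)] schwarzian_cong[OF U(1) w eq(2)] by simp
  qed
  obtain C where "det C = 1" "\<And>w. w \<in> U \<Longrightarrow> g.A c w = C ** f.A c w ** adjugate C"
  proof (rule equal_schwarzian_conjugate[OF U(1-3) slopes der0 S nil(1) der(1) _ nil(2) der(2) _ nz(3)])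
    show "f.A c w $ 1 $ 1 = gf w * f.A c w $ 2 $ 1" "g.A c w $ 1 $ 1 = gg w * g.A c w $ 2 $ 1" if "w \<in> U" for w
      using nz[OF that] by (simp_all add: gf_def gg_def)
  qed auto
  then show ?thesis
    using that U by blast
qed

lemma conjugate_chart_change:
  assumes c: "c \<in> \<B>" "c' \<in> \<B>" and p: "p \<in> fst c" "p \<in> fst c'"
    and conj: "g.A c' (snd c' p) = C ** f.A c' (snd c' p) ** adjugate C"
  shows "g.A c (snd c p) = C ** f.A c (snd c p) ** adjugate C"
proof -
  obtain \<kappa> where \<kappa>: "\<And>h. in_chart c' h differentiable at (snd c' p) \<Longrightarrow>
       wz (in_chart c h) (snd c p) = cscale \<kappa> (wz (in_chart c' h) (snd c' p))"
    using f.wirtinger_chart_change[OF c p] by blast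
  show ?thesis
    using f.A_chart_change[OF c p \<kappa>] g.A_chart_change[OF c p \<kappa>] conj
    by (simp add: mat2_distribs)
qed

text \<open>The set of points near which the conjugation formula holds is open. By the identity theorem, applied in a chart whose image is a ball, it
  is also closed.\<close>

theorem conjugate:
  assumes "\<not> flat X \<B> f"
  obtains C where "det C = 1"
    "\<And>c w. c \<in> \<B> \<Longrightarrow> w \<in> snd c ` fst c \<Longrightarrow> g.A c w = C ** f.A c w ** adjugate C"
proof -
  obtain c0 p0 where c0: "c0 \<in> \<B>" "p0 \<in> fst c0" "hopf X \<B> f c0 p0 \<noteq> 0"
    using assms by (auto simp: flat_def)
  obtain C U where C: "det C = 1" and U: "open U" "U \<noteq> {}" "U \<subseteq> snd c0 ` fst c0"
    "\<And>w. w \<in> U \<Longrightarrow> g.A c0 w = C ** f.A c0 w ** adjugate C"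
    using local_conjugate[OF c0] by blast
  \<comment> \<open>The formula at one point, in all charts; one chart is enough since both sides scale by the same factor.\<close>
  define R where "R q \<longleftrightarrow> (\<forall>c\<in>\<B>. q \<in> fst c \<longrightarrow> g.A c (snd c q) = C ** f.A c (snd c q) ** adjugate C)" for q
  have R_chart: "R q" if "c \<in> \<B>" "q \<in> fst c" "g.A c (snd c q) = C ** f.A c (snd c q) ** adjugate C" for q c
    unfolding R_def using conjugate_chart_change that by blast
  have opens: "openin (top_of_set T) (fst c \<inter> snd c -` D)" if "c \<in> \<B>" "open D" for c D
    using f.chart_open[OF f.restrict[OF that]] by simp
  define P where "P q \<longleftrightarrow> (\<exists>V. openin (top_of_set T) V \<and> q \<in> V \<and> (\<forall>x\<in>V. R x))" for q
  have "P constant_on T"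
  proof (rule locally_constant_imp_constant[OF f.connected])
    fix a assume "a \<in> T"
    then obtain c where c: "c \<in> \<B>" "a \<in> fst c"
      using f.cover by blast
    then obtain e where e: "e > 0" "ball (snd c a) e \<subseteq> snd c ` fst c"
      using f.image_open[OF c(1)] open_contains_ball by blast
    define D where "D = ball (snd c a) e"
    define V' where "V' = fst c \<inter> snd c -` D"
    have D: "open D" "connected D" "D \<subseteq> snd c ` fst c" "snd c a \<in> D"
      using e by (auto simp: D_def)
    have V': "openin (top_of_set T) V'" "a \<in> V'"
      using opens[OF c(1) D(1)] c(2) D(4) by (auto simp: V'_def)
    have all: "\<forall>y\<in>V'. R y" if x: "x \<in> V'" "P x" for x
    proof
      fix y assume y: "y \<in> V'"
      obtain V where V: "openin (top_of_set T) V" "x \<in> V" "\<forall>x\<in>V. R x"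
        using x(2) by (auto simp: P_def)
      let ?V = "snd c ` (V \<inter> V')"
      have VO: "open ?V" "?V \<noteq> {}" "?V \<subseteq> D"
        using f.open_chart_image[OF c(1) openin_Int[OF V(1) V'(1)]] V(2) x(1) by (auto simp: V'_def)
      have hol: "holomorphic_mat_on (g.A c) D" "holomorphic_mat_on (\<lambda>w. C ** f.A c w ** adjugate C) D"
        by (intro holomorphic_mat_subset[OF _ D(3)] holomorphic_mat_mult holomorphic_mat_const
              f.A_holomorphic g.A_holomorphic c(1))+
      have on_V: "g.A c w = C ** f.A c w ** adjugate C" if "w \<in> ?V" for w
        using that V(3) c(1) by (auto simp: R_def V'_def)
      have "g.A c (snd c y) $ i $ j = (C ** f.A c (snd c y) ** adjugate C) $ i $ j" for i j
      proof (rule analytic_continuation_open[where f = "\<lambda>w. g.A c w $ i $ j"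
            and g = "\<lambda>w. (C ** f.A c w ** adjugate C) $ i $ j" and z = "snd c y", OF VO(1) D(1) VO(2) D(2) VO(3)])
        show "(\<lambda>w. g.A c w $ i $ j) holomorphic_on D" "(\<lambda>w. (C ** f.A c w ** adjugate C) $ i $ j) holomorphic_on D"
          using hol by (auto intro: holomorphic_mat_entry)
      qed (use y on_V in \<open>auto simp: V'_def\<close>)
      then have "g.A c (snd c y) = C ** f.A c (snd c y) ** adjugate C"
        by (simp add: vec_eq_iff)
      then show "R y"
        using R_chart c(1) y by (auto simp: V'_def)
    qed
    then have "P x = P a" if "x \<in> V'" for x
      using that V' unfolding P_def[of x] P_def[of a] by (metis P_def)
    then show "\<exists>V. openin (top_of_set T) V \<and> a \<in> V \<and> (\<forall>x\<in>V. P x = P a)"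
      using V' by blast
  qed
  moreover obtain p1 where p1: "p1 \<in> fst c0" "snd c0 p1 \<in> U"
    using U by blast
  have "P p1"
    unfolding P_def using p1 opens[OF c0(1) U(1)] U(4) R_chart[OF c0(1)]
    by (intro exI[of _ "fst c0 \<inter> snd c0 -` U"]) auto
  moreover have "p1 \<in> T"
    using p1 f.chart_subset[OF c0(1)] by blast
  ultimately have "P q" if "q \<in> T" for q
    using that by (metis constant_on_def)
  then have "R q" if "q \<in> T" for q
    using that by (auto simp: P_def)
  then have "g.A c w = C ** f.A c w ** adjugate C" if "c \<in> \<B>" "w \<in> snd c ` fst c" for c w
    using that f.chart_subset[OF that(1)] by (auto simp: R_def)
  then show ?thesis
    using that C by blast
qed

end


section \<open>The atlas of the covering\<close>

lemma riemann_surface_chart: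
  assumes S: "riemann_surface S \<A>" and c: "c \<in> \<A>"
  shows "openin (top_of_set S) (fst c)" "open (snd c ` fst c)"
    "homeomorphism (fst c) (snd c ` fst c) (snd c) (inv_into (fst c) (snd c))"
    "c' \<in> \<A> \<Longrightarrow> in_chart c (snd c') holomorphic_on snd c ` (fst c \<inter> fst c')"
proof -
  have 1: "\<forall>c\<in>\<A>. openin (top_of_set S) (fst c) \<and> open (snd c ` fst c) \<and>
      homeomorphism (fst c) (snd c ` fst c) (snd c) (inv_into (fst c) (snd c))"
    and 2: "\<forall>c\<in>\<A>. \<forall>c'\<in>\<A>. in_chart c (snd c') holomorphic_on snd c ` (fst c \<inter> fst c')"
    using S by (simp_all add: riemann_surface_def case_prod_unfold)
  show "openin (top_of_set S) (fst c)" "open (snd c ` fst c)"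
    "homeomorphism (fst c) (snd c ` fst c) (snd c) (inv_into (fst c) (snd c))"
    using bspec[OF 1 c] by simp_all
  show "c' \<in> \<A> \<Longrightarrow> in_chart c (snd c') holomorphic_on snd c ` (fst c \<inter> fst c')"
    using bspec[OF bspec[OF 2 c]] .
qed

lemma open_in_chart_image:
  assumes S: "riemann_surface S \<A>" and c: "c \<in> \<A>" and V: "openin (top_of_set S) V" "V \<subseteq> fst c"
  shows "open (snd c ` V)"
proof -
  have o: "openin (top_of_set S) (fst c)" "open (snd c ` fst c)"
    and h: "homeomorphism (fst c) (snd c ` fst c) (snd c) (inv_into (fst c) (snd c))"
    using riemann_surface_chart[OF S c] by auto
  have "openin (top_of_set (fst c)) V"
    using openin_subset_trans[OF V(1) V(2) openin_imp_subset[OF o(1)]] .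
  then have "openin (top_of_set (snd c ` fst c)) (snd c ` V)"
    using homeomorphism_imp_open_map[OF h] by blast
  then show ?thesis
    using o(2) openin_open_trans by blast
qed

lemma openin_diff_isolated:
  assumes "\<And>p. p \<in> S \<Longrightarrow> \<not> p islimpt P"
  shows "openin (top_of_set S) (S - P)"
proof (subst openin_subopen, intro ballI)
  fix x assume x: "x \<in> S - P"
  then have "\<not> x islimpt P"
    using assms by blast
  then obtain U where U: "x \<in> U" "open U" "\<And>y. y \<in> P \<Longrightarrow> y \<in> U \<Longrightarrow> y = x"
    unfolding islimpt_def by auto
  have "openin (top_of_set S) (S \<inter> U)" "x \<in> S \<inter> U" "S \<inter> U \<subseteq> S - P"
    using x U by (auto simp: openin_open)
  then show "\<exists>U. openin (top_of_set S) U \<and> x \<in> U \<and> U \<subseteq> S - P"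
    by blast
qed

text \<open>A covering map is a local homeomorphism.\<close>

lemma covering_image_open:
  fixes T :: "'b::topological_space set"
  assumes cov: "covering_space T \<pi> S" and V: "openin (top_of_set T) V"
  shows "openin (top_of_set S) (\<pi> ` V)"
proof (subst openin_subopen, intro ballI)
  fix y assume "y \<in> \<pi> ` V"
  then obtain x where x: "x \<in> V" "y = \<pi> x"
    by blast
  then have "x \<in> T"
    using V openin_imp_subset by blast
  obtain U u q where U: "x \<in> U" "openin (top_of_set T) U" "\<pi> x \<in> u" "openin (top_of_set S) u"
    "homeomorphism U u \<pi> q"
    using covering_space_local_homeomorphism[OF cov \<open>x \<in> T\<close>] .
  have "openin (top_of_set U) (U \<inter> V)"
    using openin_subset_trans[OF openin_Int[OF U(2) V] _ openin_imp_subset[OF U(2)]] by simp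
  then have "openin (top_of_set u) (\<pi> ` (U \<inter> V))"
    using homeomorphism_imp_open_map[OF U(5)] by blast
  then have "openin (top_of_set S) (\<pi> ` (U \<inter> V))"
    using U(4) openin_trans by blast
  then show "\<exists>W. openin (top_of_set S) W \<and> y \<in> W \<and> W \<subseteq> \<pi> ` V"
    using x U(1) by blast
qed

text \<open>Constant loops at two points are homotopic as loops, and the base point runs along a path during such a homotopy.\<close>

lemma simply_connected_imp_connected_general:
  fixes T :: "'b::topological_space set"
  assumes "simply_connected T"
  shows "connected T"
proof -
  have "path_component T a b" if ab: "a \<in> T" "b \<in> T" for a b
  proof -
    have loop: "path (\<lambda>t::real. c) \<and> pathfinish (\<lambda>t::real. c) = pathstart (\<lambda>t::real. c) \<and> path_image (\<lambda>t::real. c) \<subseteq> T"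
      if "c \<in> T" for c
      using that by (auto simp: path_def pathfinish_def pathstart_def path_image_def)
    have "homotopic_loops T (\<lambda>t. a) (\<lambda>t. b)"
      using assms loop[OF ab(1)] loop[OF ab(2)] unfolding simply_connected_def by blast
    then show ?thesis
      using homotopic_loops_imp_path_component_value[of T "\<lambda>t. a" "\<lambda>t. b" 0] by simp
  qed
  then have "path_connected T"
    by (simp add: path_connected_component)
  then show ?thesis
    by (rule path_connected_imp_connected)
qed

text \<open>The set \<open>S - P\<close> is open because \<open>P\<close> has no limit points in \<open>S\<close>, and the covering map is open. So on a set where it is
  injective it composes with a chart to a chart, and the transition maps are those of the base.\<close>

theorem lifted_complex_atlas:
  fixes S P :: "'a::t2_space set" and T :: "'b::t2_space set"
  assumes S: "riemann_surface S \<A>" and P: "P \<subseteq> S" "\<And>p. p \<in> S \<Longrightarrow> \<not> p islimpt P"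
    and cov: "universal_covering T \<pi> (S - P)"
  shows "complex_atlas T (lifted_atlas T \<pi> \<A>)"
proof -
  have cs: "covering_space T \<pi> (S - P)" and sc: "simply_connected T"
    using cov by (auto simp: universal_covering_def)
  have cont: "continuous_on T \<pi>" and im: "\<pi> ` T = S - P"
    using cs by (auto simp: covering_space_def)
  have oSP: "openin (top_of_set S) (S - P)"
    using openin_diff_isolated P(2) by blast
  have img: "openin (top_of_set S) (\<pi> ` U)" if "openin (top_of_set T) U" for U
    using openin_trans[OF covering_image_open[OF cs that] oSP] .
  have A_open: "openin (top_of_set S) (fst c)"
    and A_cont: "continuous_on (fst c) (snd c)"
    and A_inj: "inj_on (snd c) (fst c)" if "c \<in> \<A>" for c
  proof -
    have h: "openin (top_of_set S) (fst c) \<and> homeomorphism (fst c) (snd c ` fst c) (snd c) (inv_into (fst c) (snd c))"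
      using riemann_surface_chart[OF S that] by auto
    then show "openin (top_of_set S) (fst c)" "continuous_on (fst c) (snd c)"
      by (auto simp: homeomorphism_def)
    show "inj_on (snd c) (fst c)"
      using h by (metis homeomorphism_apply1 inj_on_inverseI)
  qed
  have img_c: "open ((snd c \<circ> \<pi>) ` U)" if "c \<in> \<A>" "openin (top_of_set T) U" "\<pi> ` U \<subseteq> fst c" for c U
    using open_in_chart_image[OF S that(1) img[OF that(2)] that(3)] by (simp add: image_comp)
  have cont_c: "continuous_on V (snd c \<circ> \<pi>)" if "c \<in> \<A>" "lifted_domain T \<pi> c V" for c V
  proof (rule continuous_on_compose)
    have V: "openin (top_of_set T) V" "\<pi> ` V \<subseteq> fst c"
      using that(2) by (auto simp: lifted_domain_def)
    show "continuous_on V \<pi>"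
      using continuous_on_subset[OF cont openin_imp_subset[OF V(1)]] .
    show "continuous_on (\<pi> ` V) (snd c)"
      using continuous_on_subset[OF A_cont[OF that(1)] V(2)] .
  qed
  have inj_c: "inj_on (snd c \<circ> \<pi>) V" if "c \<in> \<A>" "lifted_domain T \<pi> c V" for c V
    using A_inj[OF that(1)] that(2) unfolding lifted_domain_def
    by (intro comp_inj_on) (auto intro: inj_on_subset)
  show ?thesis
  proof
    show "connected T"
      using sc by (rule simply_connected_imp_connected_general)
  next
    fix c assume "c \<in> lifted_atlas T \<pi> \<A>"
    then obtain c0 V where c: "c = (V, snd c0 \<circ> \<pi>)" "c0 \<in> \<A>" "lifted_domain T \<pi> c0 V"
      by (auto simp: lifted_atlas_def)
    have V: "openin (top_of_set T) V" "\<pi> ` V \<subseteq> fst c0"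
      using c by (auto simp: lifted_domain_def)
    show "openin (top_of_set T) (fst c)"
      using c V by simp
    show "open (snd c ` fst c)"
      using img_c[OF c(2) V] c(1) by simp
    have "openin (top_of_set (snd c ` fst c)) (snd c ` U)" if U: "openin (top_of_set (fst c)) U" for U
    proof -
      have "openin (top_of_set T) U" "U \<subseteq> V"
        using U V(1) c(1) openin_trans openin_imp_subset by fastforce+
      then have "open ((snd c0 \<circ> \<pi>) ` U)"
        using V(2) by (intro img_c c(2)) auto
      then show ?thesis
        using \<open>U \<subseteq> V\<close> c(1) by (intro open_subset) auto
    qed
    then obtain g where g: "homeomorphism (fst c) (snd c ` fst c) (snd c) g"
      using homeomorphism_injective_open_map[of "fst c" "snd c" "snd c ` fst c"]
        cont_c[OF c(2,3)] inj_c[OF c(2,3)] c(1) by auto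
    have gi: "g y = inv_into (fst c) (snd c) y" if y: "y \<in> snd c ` fst c" for y
    proof -
      obtain x where x: "x \<in> fst c" "y = snd c x"
        using y by blast
      then show ?thesis
        using homeomorphism_apply1[OF g] inv_into_f_f[of "snd c" "fst c"] inj_c[OF c(2,3)] c(1) by auto
    qed
    show "homeomorphism (fst c) (snd c ` fst c) (snd c) (inv_into (fst c) (snd c))"
      using g by (rule homeomorphism_cong) (use gi in auto)
  next
    fix c c' assume "c \<in> lifted_atlas T \<pi> \<A>" "c' \<in> lifted_atlas T \<pi> \<A>"
    then obtain c0 V c0' V' where c: "c = (V, snd c0 \<circ> \<pi>)" "c0 \<in> \<A>" "lifted_domain T \<pi> c0 V"
      and c': "c' = (V', snd c0' \<circ> \<pi>)" "c0' \<in> \<A>" "lifted_domain T \<pi> c0' V'"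
      by (auto simp: lifted_atlas_def)
    have sub: "snd c ` (fst c \<inter> fst c') \<subseteq> snd c0 ` (fst c0 \<inter> fst c0')"
      using c c' by (auto simp: lifted_domain_def)
    have "in_chart c0 (snd c0') holomorphic_on snd c0 ` (fst c0 \<inter> fst c0')"
      using riemann_surface_chart(4)[OF S c(2) c'(2)] .
    then have "in_chart c0 (snd c0') holomorphic_on snd c ` (fst c \<inter> fst c')"
      using sub holomorphic_on_subset by blast
    then show "in_chart c (snd c') holomorphic_on snd c ` (fst c \<inter> fst c')"
    proof (rule holomorphic_transform)
      fix w assume "w \<in> snd c ` (fst c \<inter> fst c')"
      then obtain p where p: "p \<in> V" "p \<in> V'" "w = snd c0 (\<pi> p)"
        using c c' by auto
      have "inv_into V (snd c0 \<circ> \<pi>) w = p"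
        using inv_into_f_f[OF inj_c[OF c(2,3)] p(1)] p(3) by simp
      moreover have "inv_into (fst c0) (snd c0) w = \<pi> p"
        using inv_into_f_f[OF A_inj[OF c(2)]] p c(3) by (auto simp: lifted_domain_def)
      ultimately show "in_chart c0 (snd c0') w = in_chart c (snd c') w"
        by (simp add: in_chart_def c(1) c'(1))
    qed
  next
    fix p assume p: "p \<in> T"
    then have "\<pi> p \<in> S - P"
      using im by blast
    moreover have "(\<Union>c\<in>\<A>. fst c) = S"
      using S by (simp add: riemann_surface_def)
    ultimately obtain c0 where c0: "c0 \<in> \<A>" "\<pi> p \<in> fst c0"
      by blast
    obtain U u q where U: "p \<in> U" "openin (top_of_set T) U" "homeomorphism U u \<pi> q"
      using covering_space_local_homeomorphism[OF cs p] by metis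
    define V where "V = U \<inter> (T \<inter> \<pi> -` (fst c0 \<inter> (S - P)))"
    have "openin (top_of_set (S - P)) (fst c0 \<inter> (S - P))"
      using openin_subset_trans[OF openin_Int[OF A_open[OF c0(1)] oSP] _ openin_imp_subset[OF oSP]] by simp
    then have "openin (top_of_set T) (T \<inter> \<pi> -` (fst c0 \<inter> (S - P)))"
      using cont im by (intro continuous_openin_preimage) auto
    then have "openin (top_of_set T) V"
      unfolding V_def using U(2) by (rule openin_Int[rotated])
    moreover have "inj_on \<pi> V"
    proof (rule inj_on_subset)
      show "inj_on \<pi> U"
        using homeomorphism_apply1[OF U(3)] by (rule inj_on_inverseI)
    qed (simp add: V_def)
    moreover have "\<pi> ` V \<subseteq> fst c0"
      by (auto simp: V_def)
    ultimately have "(V, snd c0 \<circ> \<pi>) \<in> lifted_atlas T \<pi> \<A>"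
      using c0(1) unfolding lifted_atlas_def lifted_domain_def
      by (intro CollectI exI[of _ c0] exI[of _ V]) simp
    moreover have "p \<in> V"
      using U(1) p c0(2) im by (auto simp: V_def)
    ultimately show "\<exists>c\<in>lifted_atlas T \<pi> \<A>. p \<in> fst c"
      by force
  next
    fix c and D :: "complex set" assume "c \<in> lifted_atlas T \<pi> \<A>" "open D"
    then obtain c0 V where c: "c = (V, snd c0 \<circ> \<pi>)" "c0 \<in> \<A>" "lifted_domain T \<pi> c0 V"
      by (auto simp: lifted_atlas_def)
    have "openin (top_of_set V) (V \<inter> (snd c0 \<circ> \<pi>) -` D)"
      using continuous_openin_preimage_gen[OF cont_c[OF c(2,3)] \<open>open D\<close>] .
    then have "openin (top_of_set T) (V \<inter> (snd c0 \<circ> \<pi>) -` D)"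
      using c(3) openin_trans unfolding lifted_domain_def by blast
    then have "lifted_domain T \<pi> c0 (V \<inter> (snd c0 \<circ> \<pi>) -` D)"
      using c(3) unfolding lifted_domain_def by (auto intro: inj_on_subset)
    then show "(fst c \<inter> snd c -` D, snd c) \<in> lifted_atlas T \<pi> \<A>"
      using c(1,2) unfolding lifted_atlas_def
      by (intro CollectI exI[of _ c0] exI[of _ "V \<inter> (snd c0 \<circ> \<pi>) -` D"]) simp
  qed
qed

section \<open>Dependence on the spectral parameter\<close>

text \<open>By Cauchy's formula the derivative in \<open>l\<close> is an integral over a circle, and one may differentiate under the
  integral. This is how \<open>\<partial>/\<partial>z\<close> and \<open>\<partial>/\<partial>\<lambda>\<close> of the frame are interchanged.\<close>

lemma deriv_parameter:
  fixes h k :: "complex \<Rightarrow> complex \<Rightarrow> complex"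
  assumes W: "open W" "w \<in> W"
    and ch: "continuous_on (UNIV \<times> W) (\<lambda>(l, u). h l u)"
    and hh: "\<And>u. u \<in> W \<Longrightarrow> (\<lambda>l. h l u) holomorphic_on UNIV"
    and D: "\<And>l u. u \<in> W \<Longrightarrow> (h l has_field_derivative k l u) (at u)"
    and ck: "continuous_on (UNIV \<times> W) (\<lambda>(l, u). k l u)"
    and hk: "(\<lambda>l. k l w) holomorphic_on UNIV"
  shows "((\<lambda>u. deriv (\<lambda>l. h l u) l0) has_field_derivative deriv (\<lambda>l. k l w) l0) (at w)"
proof -
  define \<gamma> where "\<gamma> = circlepath l0 1"
  define v where "v t = 2 * of_real pi * \<i> * exp (2 * of_real pi * \<i> * of_real t)" for t :: real
  have \<gamma>: "\<gamma> t = l0 + exp (2 * of_real pi * \<i> * of_real t)" for t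
    by (simp add: \<gamma>_def circlepath)
  have nz: "\<gamma> t - l0 \<noteq> 0" for t
    by (simp add: \<gamma>)
  have cont_\<gamma>: "continuous_on UNIV \<gamma>" and cont_v: "continuous_on UNIV v"
    unfolding \<gamma>[abs_def] v_def[abs_def] by (intro continuous_intros)+
  have cauchy: "deriv f l0 = 1 / (2 * of_real pi * \<i>) * integral (cbox 0 1) (\<lambda>t. f (\<gamma> t) / (\<gamma> t - l0)\<^sup>2 * v t)"
    if f: "f holomorphic_on UNIV" for f
  proof -
    have "(f has_field_derivative (1 / (2 * of_real pi * \<i>) * contour_integral (circlepath l0 1) (\<lambda>u. f u / (u - l0)\<^sup>2))) (at l0)"
      using f by (intro Cauchy_derivative_integral_circlepath(2)[of l0 1])
        (auto intro: holomorphic_on_imp_continuous_on holomorphic_on_subset)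
    moreover have "contour_integral (circlepath l0 1) (\<lambda>u. f u / (u - l0)\<^sup>2) =
       integral (cbox 0 1) (\<lambda>t. f (\<gamma> t) / (\<gamma> t - l0)\<^sup>2 * v t)"
      unfolding contour_integral_integral \<gamma>_def[symmetric] box_real
      by (intro integral_cong) (simp add: \<gamma>_def vector_derivative_circlepath v_def mult.assoc)
    ultimately show ?thesis
      by (simp add: DERIV_imp_deriv)
  qed
  obtain e where e: "e > 0" "ball w e \<subseteq> W"
    using W open_contains_ball by blast
  define U where "U = ball w e"
  have U: "w \<in> U" "convex U" "open U" "U \<subseteq> W"
    using e by (auto simp: U_def)
  have comp: "continuous_on (U \<times> cbox 0 1) (\<lambda>(u, t). m (\<gamma> t) u / (\<gamma> t - l0)\<^sup>2 * v t)"
    if m: "continuous_on (UNIV \<times> W) (\<lambda>(l, u). m l u)" for m :: "complex \<Rightarrow> complex \<Rightarrow> complex"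
  proof -
    have 1: "continuous_on (U \<times> cbox 0 1) (\<lambda>x. \<gamma> (snd x))" "continuous_on (U \<times> cbox 0 1) (\<lambda>x. v (snd x))"
      by (rule continuous_on_compose2[OF cont_\<gamma>] continuous_on_compose2[OF cont_v]; auto intro: continuous_intros)+
    have "continuous_on (U \<times> cbox 0 1) (\<lambda>x. (\<lambda>(l, u). m l u) (\<gamma> (snd x), fst x))"
      using U(4) by (intro continuous_on_compose2[OF m] continuous_on_Pair 1 continuous_intros) auto
    then show ?thesis
      unfolding case_prod_unfold using nz by (intro continuous_intros 1) auto
  qed
  have "((\<lambda>u. integral (cbox 0 1) (\<lambda>t. h (\<gamma> t) u / (\<gamma> t - l0)\<^sup>2 * v t)) has_field_derivative
     integral (cbox 0 1) (\<lambda>t. k (\<gamma> t) w / (\<gamma> t - l0)\<^sup>2 * v t)) (at w within U)"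
  proof (rule leibniz_rule_field_derivative[OF _ _ comp[OF ck] U(1,2)])
    fix u t assume "u \<in> U" "t \<in> cbox (0::real) 1"
    then have "u \<in> W"
      using U(4) by blast
    then have "(h (\<gamma> t) has_field_derivative k (\<gamma> t) u) (at u within U)"
      by (rule has_field_derivative_at_within[OF D])
    then show "((\<lambda>u. h (\<gamma> t) u / (\<gamma> t - l0)\<^sup>2 * v t) has_field_derivative k (\<gamma> t) u / (\<gamma> t - l0)\<^sup>2 * v t) (at u within U)"
      unfolding divide_inverse by (rule DERIV_cmult_right[OF DERIV_cmult_right])
  next
    fix u assume u: "u \<in> U"
    have "continuous_on (cbox 0 1) (\<lambda>t. (\<lambda>(u, t). h (\<gamma> t) u / (\<gamma> t - l0)\<^sup>2 * v t) (u, t))"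
      using u by (intro continuous_on_compose2[OF comp[OF ch]] continuous_intros) auto
    then show "(\<lambda>t. h (\<gamma> t) u / (\<gamma> t - l0)\<^sup>2 * v t) integrable_on cbox 0 1"
      unfolding prod.case by (rule integrable_continuous)
  qed
  then have "((\<lambda>u. 1 / (2 * of_real pi * \<i>) * integral (cbox 0 1) (\<lambda>t. h (\<gamma> t) u / (\<gamma> t - l0)\<^sup>2 * v t)) has_field_derivative
     1 / (2 * of_real pi * \<i>) * integral (cbox 0 1) (\<lambda>t. k (\<gamma> t) w / (\<gamma> t - l0)\<^sup>2 * v t)) (at w)"
    unfolding at_within_open[OF U(1,3)] by (rule DERIV_cmult)
  then have "((\<lambda>u. 1 / (2 * of_real pi * \<i>) * integral (cbox 0 1) (\<lambda>t. h (\<gamma> t) u / (\<gamma> t - l0)\<^sup>2 * v t)) has_field_derivative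
     deriv (\<lambda>l. k l w) l0) (at w)"
    unfolding cauchy[OF hk] .
  moreover have "1 / (2 * of_real pi * \<i>) * integral (cbox 0 1) (\<lambda>t. h (\<gamma> t) u / (\<gamma> t - l0)\<^sup>2 * v t) =
      deriv (\<lambda>l. h l u) l0" if "u \<in> U" for u
    using cauchy[OF hh[OF subsetD[OF U(4) that]]] by (rule sym)
  ultimately show ?thesis
    by (rule has_field_derivative_cong_open[OF U(3,1), rotated])
qed


section \<open>The immersion induced by a frame\<close>

text \<open>A vanishing power forces the determinant to be zero, then \<open>a a = tr(a) a\<close> and the powers are \<open>tr(a)\<^sup>k a\<close>.\<close>

lemma nilpotent_mat_2:
  assumes "nilpotent_mat a"
  shows "trace a = 0" "det a = 0"
proof -
  obtain n where n: "(((**) a) ^^ n) (mat 1) = 0"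
    using assms by (auto simp: nilpotent_mat_def)
  have dn: "det ((((**) a) ^^ k) (mat 1)) = det a ^ k" for k
    by (induction k) (simp_all add: det_mul)
  show d: "det a = 0"
    using dn[of n] n by (simp add: det_2)
  have aa: "a ** a = cscale (trace a) a"
  proof -
    have "a$1$1 * a$2$2 = a$1$2 * a$2$1"
      using d by (simp add: det_2)
    then show ?thesis
      by (simp add: mat2_simps algebra_simps)
  qed
  have pow: "(((**) a) ^^ Suc k) (mat 1) = cscale (trace a ^ k) a" for k
    by (induction k) (simp_all add: cscale_mult_right aa cscale_cscale mult.commute)
  show "trace a = 0"
  proof (cases n)
    case 0
    then show ?thesis
      using n by (simp add: mat2_simps)
  next
    case (Suc k)
    then have "cscale (trace a ^ k) a = 0"
      using n pow[of k] by simp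
    then show ?thesis
      by (auto simp: cscale_eq_0_iff)
  qed
qed

lemma ctranspose_mult_self_ambient:
  assumes "det M = 1"
  shows "ctranspose M ** M \<in> ambient_space Hyperbolic"
proof -
  have "M \<noteq> 0"
    using assms by (auto simp: det_2)
  then obtain t where "t > 0" "trace (M ** ctranspose M) = of_real t"
    using trace_mult_ctranspose_pos by blast
  then show ?thesis
    using assms by (simp add: hermitian_def ctranspose_mult det_mul det_ctranspose trace_mul_sym[of "ctranspose M"])
qed

text \<open>An LWR frame \<open>\<phi>\<close> in one chart, with \<open>\<phi>\<^sup>-\<^sup>1 d\<phi> = (l a + b) dz\<close>.\<close>

locale lwr_chart =
  fixes W :: "complex set" and \<phi> :: "complex \<Rightarrow> complex \<Rightarrow> mat2" and a b :: "complex \<Rightarrow> mat2"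
    and l0 l1 :: complex
  assumes open_W: "open W"
    and det_\<phi>: "\<And>l w. w \<in> W \<Longrightarrow> det (\<phi> l w) = 1"
    and cont: "continuous_on (UNIV \<times> W) (\<lambda>(l, w). \<phi> l w)"
    and hol_l: "\<And>w. w \<in> W \<Longrightarrow> holomorphic_mat_on (\<lambda>l. \<phi> l w) UNIV"
    and hol_w: "\<And>l. holomorphic_mat_on (\<phi> l) W"
    and ode: "\<And>l w. w \<in> W \<Longrightarrow> deriv_mat (\<phi> l) w = \<phi> l w ** (cscale l (a w) + b w)"
    and hol_ab: "holomorphic_mat_on a W" "holomorphic_mat_on b W"
    and nilpotent: "\<And>w. w \<in> W \<Longrightarrow> trace (a w) = 0 \<and> det (a w) = 0"
    and trace_free: "\<And>w. w \<in> W \<Longrightarrow> trace (b w) = 0"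
begin

text \<open>The value of \<open>tangent_form\<close> for the induced immersion, in either space; it is \<open>\<phi> (\<xi>\<^sub>1 - \<xi>\<^sub>0) \<phi>\<^sup>-\<^sup>1\<close> at \<open>l0\<close>.\<close>

definition "C w = cscale (l1 - l0) (\<phi> l0 w ** a w ** adjugate (\<phi> l0 w))"

lemma C_holomorphic: "holomorphic_mat_on C W"
  unfolding C_def[abs_def]
  by (intro holomorphic_mat_cscale holomorphic_mat_mult holomorphic_mat_adjugate hol_w hol_ab)

lemma C_nilpotent: assumes "w \<in> W" shows "trace (C w) = 0" "det (C w) = 0"
  using nilpotent[OF assms] det_\<phi>[OF assms, of l0]
  by (simp_all add: C_def trace_cscale det_cscale trace_conj_adjugate det_conj_adjugate)

lemma ode_wz: "w \<in> W \<Longrightarrow> wz (\<phi> l) w = \<phi> l w ** (cscale l (a w) + b w)"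
  using holomorphic_mat_wirtinger(2)[OF hol_w open_W] ode by simp

lemma ode_inverse:
  assumes w: "w \<in> W"
  shows "wz (\<lambda>u. adjugate (\<phi> l u)) w = - ((cscale l (a w) + b w) ** adjugate (\<phi> l w))"
proof -
  have "trace (cscale l (a w) + b w) = 0"
    using nilpotent[OF w] trace_free[OF w] by (simp add: trace_add trace_cscale)
  then have "adjugate (cscale l (a w) + b w) = - (cscale l (a w) + b w)"
    by (rule adjugate_trace_free)
  then show ?thesis
    using wirtinger_bounded_linear(1)[OF bounded_linear_adjugate holomorphic_mat_wirtinger(1)[OF hol_w open_W w] adjugate_cscale, of l]
    by (simp only: ode_wz[OF w] adjugate_mult mat2_mult_minus)
qed

text \<open>The holomorphic null curve with \<open>f = \<Psi>\<^sup>* \<Psi>\<close> in \<open>H\<^sup>3\<close>; \<open>\<psi>\<close> below is its counterpart in \<open>E\<^sup>3\<close>.\<close>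

definition "\<Psi> w = \<phi> l1 w ** adjugate (\<phi> l0 w)"

lemma det_\<Psi>: "w \<in> W \<Longrightarrow> det (\<Psi> w) = 1"
  by (simp add: \<Psi>_def det_mul det_adjugate det_\<phi>)

lemma \<Psi>_holomorphic: "holomorphic_mat_on \<Psi> W"
  unfolding \<Psi>_def[abs_def] by (intro holomorphic_mat_mult holomorphic_mat_adjugate hol_w)

lemma wz_\<Psi>: assumes w: "w \<in> W" shows "wz \<Psi> w = \<Psi> w ** C w"
proof -
  have d: "\<phi> l1 differentiable at w" "(\<lambda>u. adjugate (\<phi> l0 u)) differentiable at w"
    using holomorphic_mat_wirtinger(1)[OF hol_w open_W w] mat2_differentiable by blast+
  have "wz \<Psi> w = \<phi> l1 w ** (cscale l1 (a w) + b w) ** adjugate (\<phi> l0 w) - \<phi> l1 w ** (cscale l0 (a w) + b w) ** adjugate (\<phi> l0 w)"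
    unfolding \<Psi>_def[abs_def] wirtinger_mult(1)[OF d] ode_wz[OF w] ode_inverse[OF w]
    by (simp add: mat2_mult_minus matrix_mul_assoc)
  also have "\<dots> = cscale (l1 - l0) (\<phi> l1 w ** a w ** adjugate (\<phi> l0 w))"
    by (simp add: mat2_distribs) (simp add: mat2_eq_iff cscale_entry algebra_simps)
  also have "\<dots> = \<Psi> w ** C w"
    by (simp add: \<Psi>_def C_def cscale_mult_right matrix_mul_assoc adjugate_cancel[OF det_\<phi>[OF w]])
  finally show ?thesis .
qed

definition "\<delta> w = deriv_mat (\<lambda>l. \<phi> l w) l0"

text \<open>The parameter derivative of the equation \<open>\<phi>\<^sub>z = \<phi> (l a + b)\<close>.\<close>

lemma \<delta>_derivative:
  assumes w: "w \<in> W"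
  shows "((\<lambda>u. \<delta> u $ i $ j) has_field_derivative (\<delta> w ** (cscale l0 (a w) + b w) + \<phi> l0 w ** a w) $ i $ j) (at w)"
proof -
  define k where "k l u = (\<phi> l u ** (cscale l (a u) + b u)) $ i $ j" for l u
  have ent: "continuous_on (UNIV \<times> W) (\<lambda>(l, u). \<phi> l u $ i $ j)" for i j
    using bounded_linear.continuous_on[OF bounded_linear_entry cont] by (simp add: case_prod_unfold)
  have D: "((\<lambda>u. deriv (\<lambda>l. \<phi> l u $ i $ j) l0) has_field_derivative deriv (\<lambda>l. k l w) l0) (at w)"
  proof (rule deriv_parameter[OF open_W w ent])
    fix l u assume u: "u \<in> W"
    show "(\<lambda>l. \<phi> l u $ i $ j) holomorphic_on UNIV"
      using hol_l[OF u] by (rule holomorphic_mat_entry)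
    show "((\<lambda>u. \<phi> l u $ i $ j) has_field_derivative k l u) (at u)"
      using holomorphic_has_deriv[OF holomorphic_mat_entry[OF hol_w] open_W u, of l i j] ode[OF u, of l]
      by (simp add: k_def deriv_mat_def vec_eq_iff)
  next
    have s: "continuous_on (UNIV \<times> W) (\<lambda>x. F (snd x))" if "continuous_on W F" for F :: "complex \<Rightarrow> complex"
      by (rule continuous_on_compose2[OF that]) (auto intro: continuous_intros)
    have ab: "continuous_on W (\<lambda>u. a u $ i $ j)" "continuous_on W (\<lambda>u. b u $ i $ j)" for i j
      using hol_ab by (auto intro!: holomorphic_on_imp_continuous_on holomorphic_mat_entry)
    show "continuous_on (UNIV \<times> W) (\<lambda>(l, u). k l u)"
      using ent unfolding k_def matrix_mult_entry vector_add_component cscale_entry case_prod_unfold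
      by (intro continuous_on_add continuous_on_mult s[OF ab(1)] s[OF ab(2)] continuous_on_fst continuous_on_id)
    show "(\<lambda>l. k l w) holomorphic_on UNIV"
      unfolding k_def matrix_mult_entry vector_add_component cscale_entry
      by (intro holomorphic_intros holomorphic_mat_entry[OF hol_l[OF w]])
  qed
  have "((\<lambda>l. k l w) has_field_derivative (\<delta> w ** (cscale l0 (a w) + b w) + \<phi> l0 w ** a w) $ i $ j) (at l0)"
  proof -
    have E: "((\<lambda>l. \<phi> l w $ i $ j) has_field_derivative \<delta> w $ i $ j) (at l0)" for i j
      using holomorphic_has_deriv[OF holomorphic_mat_entry[OF hol_l[OF w]] open_UNIV UNIV_I, of i j l0]
      by (simp add: \<delta>_def deriv_mat_def)
    show ?thesis
      unfolding k_def matrix_mult_entry vector_add_component cscale_entry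
      by (rule derivative_eq_intros E refl)+ (simp add: algebra_simps)
  qed
  then show ?thesis
    using D by (simp add: DERIV_imp_deriv \<delta>_def deriv_mat_def)
qed

lemma \<delta>_holomorphic: "holomorphic_mat_on \<delta> W"
  unfolding holomorphic_mat_on_def using \<delta>_derivative open_W by (auto simp: holomorphic_on_open)

lemma wz_\<delta>: assumes w: "w \<in> W" shows "wz \<delta> w = \<delta> w ** (cscale l0 (a w) + b w) + \<phi> l0 w ** a w"
proof -
  have "deriv_mat \<delta> w = \<delta> w ** (cscale l0 (a w) + b w) + \<phi> l0 w ** a w"
    by (simp add: deriv_mat_def vec_eq_iff DERIV_imp_deriv[OF \<delta>_derivative[OF w]])
  then show ?thesis
    using holomorphic_mat_wirtinger(2)[OF \<delta>_holomorphic open_W w] by simp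
qed

definition "\<psi> w = cscale (l1 - l0) (\<delta> w ** adjugate (\<phi> l0 w))"

lemma \<psi>_holomorphic: "holomorphic_mat_on \<psi> W"
  unfolding \<psi>_def[abs_def]
  by (intro holomorphic_mat_cscale holomorphic_mat_mult holomorphic_mat_adjugate \<delta>_holomorphic hol_w)

lemma wz_\<psi>: assumes w: "w \<in> W" shows "wz \<psi> w = C w"
proof -
  have d: "\<delta> differentiable at w" "(\<lambda>u. adjugate (\<phi> l0 u)) differentiable at w"
    using holomorphic_mat_wirtinger(1)[OF hol_w open_W w] holomorphic_mat_wirtinger(1)[OF \<delta>_holomorphic open_W w]
      mat2_differentiable by blast+
  have "wz (\<lambda>u. \<delta> u ** adjugate (\<phi> l0 u)) w = \<phi> l0 w ** a w ** adjugate (\<phi> l0 w)"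
  proof -
    define K where "K = cscale l0 (a w) + b w"
    show ?thesis
      unfolding wirtinger_mult(1)[OF d] wz_\<delta>[OF w] ode_inverse[OF w] K_def[symmetric]
      by (simp add: mat2_mult_minus mat2_add_rdistrib matrix_mul_assoc)
  qed
  then show ?thesis
    unfolding \<psi>_def[abs_def] C_def
    using wirtinger_bounded_linear(1)[OF bounded_linear_cscale mat2_differentiable(1)[OF d], of "l1 - l0"]
    by (simp add: cscale_cscale mult.commute)
qed

lemma trace_\<psi>: assumes w: "w \<in> W" shows "trace (\<psi> w) = 0"
proof -
  note h = holomorphic_mat_wirtinger[OF hol_l[OF w] open_UNIV UNIV_I, of l0]
  have "trace (wz (\<lambda>l. \<phi> l w) l0 ** adjugate (\<phi> l0 w)) = 0"
    using det_\<phi>[OF w] by (intro det_one_derivative[OF open_UNIV UNIV_I h(1)])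
  then show ?thesis
    using h(2) by (simp add: \<psi>_def \<delta>_def trace_cscale)
qed

abbreviation "F X \<equiv> induced X \<phi> l0 l1"

lemma F_Euclidean: "w \<in> W \<Longrightarrow> F Euclidean w = \<psi> w + ctranspose (\<psi> w)"
  by (simp add: \<psi>_def \<delta>_def Let_def matrix_inv_eq_adjugate det_\<phi>)

lemma F_Hyperbolic: "w \<in> W \<Longrightarrow> F Hyperbolic w = ctranspose (\<Psi> w) ** \<Psi> w"
  by (simp add: \<Psi>_def Let_def matrix_inv_eq_adjugate det_\<phi>)

lemma F_smooth: "Ck_on n (F X) W"
proof (cases X)
  case Euclidean
  have "Ck_on n (\<lambda>w. \<psi> w + ctranspose (\<psi> w)) W"
    by (intro Ck_on_add Ck_on_bounded_linear[OF _ bounded_linear_ctranspose] Ck_on_holomorphic open_W \<psi>_holomorphic)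
  then show ?thesis
    unfolding Euclidean by (rule Ck_on_cong[OF open_W, rotated]) (simp only: F_Euclidean)
next
  case Hyperbolic
  have "Ck_on n (\<lambda>w. ctranspose (\<Psi> w) ** \<Psi> w) W"
    by (intro Ck_on_mult Ck_on_bounded_linear[OF _ bounded_linear_ctranspose] Ck_on_holomorphic open_W \<Psi>_holomorphic)
  then show ?thesis
    unfolding Hyperbolic by (rule Ck_on_cong[OF open_W, rotated]) (simp only: F_Hyperbolic)
qed

lemma F_ambient: assumes w: "w \<in> W" shows "F X w \<in> ambient_space X"
proof (cases X)
  case Euclidean
  show ?thesis
    using trace_\<psi>[OF w] unfolding Euclidean F_Euclidean[OF w]
    by (simp add: hermitian_def ctranspose_add trace_add trace_ctranspose add.commute)
next
  case Hyperbolic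
  show ?thesis
    unfolding Hyperbolic F_Hyperbolic[OF w] by (rule ctranspose_mult_self_ambient[OF det_\<Psi>[OF w]])
qed

lemma wz_F: assumes w: "w \<in> W" shows "wz (F X) w = gram X (F X w) ** C w"
proof (cases X)
  case Euclidean
  note h = holomorphic_mat_wirtinger[OF \<psi>_holomorphic open_W w]
  have "wz (\<lambda>w. \<psi> w + ctranspose (\<psi> w)) w = C w"
    using h wz_\<psi>[OF w] by (simp add: wirtinger_add wirtinger_ctranspose mat2_differentiable) (simp add: mat2_simps)
  moreover have "wz (F Euclidean) w = wz (\<lambda>w. \<psi> w + ctranspose (\<psi> w)) w"
    by (rule wirtinger_cong(1)[OF open_W w]) (rule F_Euclidean)
  ultimately show ?thesis
    by (simp only: Euclidean gram.simps matrix_mul_lid)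
next
  case Hyperbolic
  note h = holomorphic_mat_wirtinger[OF \<Psi>_holomorphic open_W w]
  have "wz (\<lambda>w. ctranspose (\<Psi> w) ** \<Psi> w) w = ctranspose (\<Psi> w) ** \<Psi> w ** C w"
    using h(1,3) wz_\<Psi>[OF w] by (simp add: wirtinger_mult wirtinger_ctranspose mat2_differentiable matrix_mul_assoc)
      (simp add: mat2_simps)
  moreover have "wz (F Hyperbolic) w = wz (\<lambda>w. ctranspose (\<Psi> w) ** \<Psi> w) w"
    by (rule wirtinger_cong(1)[OF open_W w]) (rule F_Hyperbolic)
  ultimately show ?thesis
    by (simp only: Hyperbolic gram.simps F_Hyperbolic[OF w])
qed

lemma tangent_form_F: assumes w: "w \<in> W" shows "tangent_form X (F X) w = C w"
proof -
  have "det (gram X (F X w)) = 1"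
    using F_ambient[OF w, of X] by (cases X) auto
  then show ?thesis
    by (simp add: tangent_form_def wz_F[OF w] matrix_mul_assoc adjugate_cancel)
qed

lemma minner_F: "w \<in> W \<Longrightarrow> minner (wz (F X) w) (wz (F X) w) = 0"
  by (simp add: minner_self wz_F det_mul C_nilpotent)

text \<open>In complex notation the derivative is \<open>h \<mapsto> h m C + cnj h C\<^sup>* m\<close>. Multiplication by \<open>C m\<^sup>-\<^sup>1\<close> leaves \<open>cnj h\<close> times a matrix of
  positive trace.\<close>

lemma F_immersed:
  assumes w: "w \<in> W" and nz: "C w \<noteq> 0"
  shows "inj (frechet_derivative (F X) (at w))"
proof -
  interpret t: tangent_direction X "F X w" "gram X (F X w)" "C w"
    using F_ambient[OF w] C_nilpotent[OF w] nz by unfold_locales auto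
  have d: "F X differentiable at w"
    using F_smooth[of 1 X] w by simp
  have herm: "ctranspose (F X u) = F X u" if "u \<in> W" for u
    using F_ambient[OF that, of X] by (cases X) (auto simp: hermitian_def)
  have zb: "wzb (F X) w = ctranspose (C w) ** gram X (F X w)"
    using wirtinger_ctranspose(2)[OF d] wirtinger_cong(2)[OF open_W w herm]
    by (simp add: wz_F[OF w] ctranspose_mult t.hermitian_m)
  have "h = 0" if 0: "frechet_derivative (F X) (at w) h = 0" for h
  proof (rule ccontr)
    assume "h \<noteq> 0"
    have "frechet_derivative (F X) (at w) h = cscale h (wz (F X) w) + cscale (cnj h) (wzb (F X) w)"
      using fun_cong[OF frechet_derivative_at[OF has_derivative_wirtinger[OF d]], of h] by (rule sym)
    then have "cscale h (gram X (F X w) ** C w) + cscale (cnj h) (gram X (F X w) ** t.s) = 0"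
      using 0 by (simp add: wz_F[OF w] zb t.m_s)
    then have "C w ** adjugate (gram X (F X w)) ** (cscale h (gram X (F X w) ** C w) + cscale (cnj h) (gram X (F X w) ** t.s)) = 0"
      by simp
    then have "cscale (cnj h) (C w ** t.s) = 0"
      by (simp add: mat2_distribs matrix_mul_assoc adjugate_cancel[OF t.det_m] t.aa)
    then have "cnj h * t.t = 0"
      by (metis trace_cscale trace_zero)
    then show False
      using t.t_nz \<open>h \<noteq> 0\<close> by simp
  qed
  then show ?thesis
    using linear_injective_0[OF linear_frechet_derivative[OF d]] by blast
qed

end


section \<open>Entire matrices with prescribed values\<close>

text \<open>A product of three one-parameter groups, generated by the upper right, the lower left and the diagonal part of \<open>Y\<close>, stays in \<open>SL\<^sub>2\<close>; the
  derivative at \<open>l0\<close> is the sum of the generators.\<close>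

lemma exists_entire_with_derivative:
  assumes "det C = 1" "trace Y = 0"
  obtains R where "dressing_matrix R" "R l0 = C" "deriv_mat R l0 = Y ** C"
proof -
  define E :: "complex \<Rightarrow> mat2" where "E l =
    vector [vector [(1 + (l - l0) * Y$1$2 * ((l - l0) * Y$2$1)) * exp ((l - l0) * Y$1$1), (l - l0) * Y$1$2 * exp (- ((l - l0) * Y$1$1))],
      vector [(l - l0) * Y$2$1 * exp ((l - l0) * Y$1$1), exp (- ((l - l0) * Y$1$1))]]" for l
  have E: "E l $ 1 $ 1 = (1 + (l - l0) * Y$1$2 * ((l - l0) * Y$2$1)) * exp ((l - l0) * Y$1$1)"
    "E l $ 1 $ 2 = (l - l0) * Y$1$2 * exp (- ((l - l0) * Y$1$1))"
    "E l $ 2 $ 1 = (l - l0) * Y$2$1 * exp ((l - l0) * Y$1$1)"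
    "E l $ 2 $ 2 = exp (- ((l - l0) * Y$1$1))" for l
    by (simp_all add: E_def)
  have hol: "holomorphic_mat_on E UNIV"
    unfolding holomorphic_mat_on_def forall_2 E by (intro conjI holomorphic_intros)
  have Y22: "Y$2$2 = - Y$1$1"
    using assms(2) by (simp add: trace_2 add_eq_0_iff)
  have "\<forall>i j. ((\<lambda>l. E l $ i $ j) has_field_derivative Y $ i $ j) (at l0)"
    unfolding forall_2 E Y22 by (auto intro!: derivative_eq_intros)
  then have dE: "deriv_mat E l0 = Y"
    by (simp add: deriv_mat_def vec_eq_iff DERIV_imp_deriv)
  have "det (E l) = 1" for l
    by (simp add: det_2 E algebra_simps flip: exp_add)
  then have "dressing_matrix (\<lambda>l. E l ** C)"
    using assms(1) by (simp add: dressing_matrix_def det_mul holomorphic_mat_mult[OF hol holomorphic_mat_const])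
  moreover have "E l0 ** C = C"
    by (simp add: mat2_eq_iff matrix_mult_entry E)
  moreover have "deriv_mat (\<lambda>l. E l ** C) l0 = Y ** C"
    using holomorphic_mat_wirtinger[OF hol open_UNIV UNIV_I, of l0]
      holomorphic_mat_wirtinger(2)[OF holomorphic_mat_mult[OF hol holomorphic_mat_const] open_UNIV UNIV_I, of C l0]
    by (simp add: wirtinger_mult dE)
  ultimately show ?thesis
    using that by blast
qed

definition upper_unipotent :: "complex \<Rightarrow> mat2" where "upper_unipotent x = vector [vector [1, x], vector [0, 1]]"
definition lower_unipotent :: "complex \<Rightarrow> mat2" where "lower_unipotent x = vector [vector [1, 0], vector [x, 1]]"

lemma upper_lower_entry:
  "upper_unipotent x $ 1 $ 1 = 1" "upper_unipotent x $ 1 $ 2 = x" "upper_unipotent x $ 2 $ 1 = 0" "upper_unipotent x $ 2 $ 2 = 1"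
  "lower_unipotent x $ 1 $ 1 = 1" "lower_unipotent x $ 1 $ 2 = 0" "lower_unipotent x $ 2 $ 1 = x" "lower_unipotent x $ 2 $ 2 = 1"
  by (simp_all add: upper_unipotent_def lower_unipotent_def)

text \<open>Three factors suffice if the lower left entry is nonzero, and one row operation achieves this.\<close>

lemma elementary_factorization:
  assumes "det M = 1"
  obtains w x y z where "M = lower_unipotent w ** upper_unipotent x ** lower_unipotent y ** upper_unipotent z"
proof -
  have fact: "\<exists>x y z. N = upper_unipotent x ** lower_unipotent y ** upper_unipotent z" if N: "det N = 1" "N$2$1 \<noteq> 0" for N
  proof -
    have "N$1$2 = (N$1$1 * N$2$2 - 1) / N$2$1"
      using N by (simp add: det_2 field_simps)
    then have "N = upper_unipotent ((N$1$1 - 1) / N$2$1) ** lower_unipotent (N$2$1) ** upper_unipotent ((N$2$2 - 1) / N$2$1)"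
      using N(2) by (simp add: mat2_eq_iff matrix_mult_entry upper_lower_entry) (simp add: field_simps)
    then show ?thesis
      by blast
  qed
  show ?thesis
  proof (cases "M$2$1 = 0")
    case False
    then obtain x y z where M: "M = upper_unipotent x ** lower_unipotent y ** upper_unipotent z"
      using fact assms by blast
    have "lower_unipotent 0 = mat 1"
      by (simp add: mat2_eq_iff mat_entry upper_lower_entry)
    then have "M = lower_unipotent 0 ** upper_unipotent x ** lower_unipotent y ** upper_unipotent z"
      using M by simp
    then show ?thesis
      using that by blast
  next
    case True
    have "det (lower_unipotent 1 ** M) = 1"
      using assms by (simp add: det_mul det_2[of "lower_unipotent 1"] upper_lower_entry)
    moreover have "(lower_unipotent 1 ** M) $ 2 $ 1 \<noteq> 0"
      using assms True by (auto simp: matrix_mult_entry upper_lower_entry det_2)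
    ultimately obtain x y z where M: "lower_unipotent 1 ** M = upper_unipotent x ** lower_unipotent y ** upper_unipotent z"
      using fact by blast
    have "lower_unipotent (-1) ** (lower_unipotent 1 ** M) = M"
      by (simp add: mat2_eq_iff matrix_mult_entry upper_lower_entry)
    then have "M = lower_unipotent (-1) ** upper_unipotent x ** lower_unipotent y ** upper_unipotent z"
      by (simp add: M matrix_mul_assoc)
    then show ?thesis
      using that by blast
  qed
qed

text \<open>The exponential map of \<open>SL\<^sub>2\<close> is not surjective, but elementary matrices generate \<open>SL\<^sub>2\<close>, and each of them is joined to
  the identity by a line.\<close>

lemma exists_entire_interpolation:
  assumes "l0 \<noteq> l1" "det C = 1" "det K = 1"
  obtains R where "dressing_matrix R" "R l0 = C" "R l1 = K"
proof -
  have "det (K ** adjugate C) = 1"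
    using assms by (simp add: det_mul det_adjugate)
  then obtain w x y z where M: "K ** adjugate C = lower_unipotent w ** upper_unipotent x ** lower_unipotent y ** upper_unipotent z"
    using elementary_factorization by blast
  define \<tau> where "\<tau> l = (l - l0) / (l1 - l0)" for l
  define R where "R l = lower_unipotent (w * \<tau> l) ** upper_unipotent (x * \<tau> l) ** lower_unipotent (y * \<tau> l) ** upper_unipotent (z * \<tau> l) ** C" for l
  have t: "\<tau> l0 = 0" "\<tau> l1 = 1"
    using assms(1) by (simp_all add: \<tau>_def)
  have "(\<lambda>l. k * \<tau> l) holomorphic_on UNIV" for k
    unfolding \<tau>_def using assms(1) by (intro holomorphic_intros) auto
  then have "holomorphic_mat_on (\<lambda>l. lower_unipotent (k * \<tau> l)) UNIV" "holomorphic_mat_on (\<lambda>l. upper_unipotent (k * \<tau> l)) UNIV" for k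
    unfolding holomorphic_mat_on_def forall_2 upper_lower_entry by simp_all
  then have "holomorphic_mat_on R UNIV"
    unfolding R_def[abs_def] by (intro holomorphic_mat_mult holomorphic_mat_const)
  moreover have "det (lower_unipotent u) = 1" "det (upper_unipotent u) = 1" for u
    by (simp_all add: det_2 upper_lower_entry)
  then have "det (R l) = 1" for l
    by (simp add: R_def det_mul assms(2))
  ultimately have "dressing_matrix R"
    by (simp add: dressing_matrix_def)
  moreover have "lower_unipotent 0 = mat 1" "upper_unipotent 0 = mat 1"
    by (simp_all add: mat2_eq_iff mat_entry upper_lower_entry)
  then have "R l0 = C"
    by (simp add: R_def t)
  moreover have "R l1 = K"
    by (simp add: R_def t flip: M) (simp add: adjugate_cancel[OF assms(2)])
  ultimately show ?thesis
    using that by blast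
qed

section \<open>Dressing of frames\<close>

lemma (in complex_atlas) constant_of_wirtinger:
  fixes K :: "'b \<Rightarrow> mat2"
  assumes K: "\<And>c w. c \<in> \<B> \<Longrightarrow> w \<in> snd c ` fst c \<Longrightarrow>
    in_chart c K differentiable at w \<and> wz (in_chart c K) w = 0 \<and> wzb (in_chart c K) w = 0"
  obtains k where "\<And>p. p \<in> T \<Longrightarrow> K p = k"
proof -
  have "K constant_on T"
  proof (rule locally_constant_imp_constant[OF connected])
    fix p assume "p \<in> T"
    then obtain c where c: "c \<in> \<B>" "p \<in> fst c"
      using cover by blast
    then obtain e where e: "e > 0" "ball (snd c p) e \<subseteq> snd c ` fst c"
      using image_open[OF c(1)] open_contains_ball by blast
    define V where "V = fst c \<inter> snd c -` ball (snd c p) e"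
    have "openin (top_of_set T) V"
      using chart_open[OF restrict[OF c(1), of "ball (snd c p) e"]] by (simp add: V_def)
    moreover have "K q = K p" if q: "q \<in> V" for q
    proof -
      have "in_chart c K (snd c q) = in_chart c K (snd c p)"
      proof (rule has_derivative_zero_unique_connected[of "ball (snd c p) e"])
        fix w assume "w \<in> ball (snd c p) e"
        then have w: "w \<in> snd c ` fst c"
          using e by blast
        then show "(in_chart c K has_derivative (\<lambda>h. 0)) (at w)"
          using has_derivative_wirtinger[of "in_chart c K" w] K[OF c(1) w] by simp
      qed (use q e in \<open>auto simp: V_def\<close>)
      then show ?thesis
        using q c by (simp add: V_def in_chart_apply)
    qed
    moreover have "p \<in> V"
      using c e by (simp add: V_def)
    ultimately show "\<exists>V. openin (top_of_set T) V \<and> p \<in> V \<and> (\<forall>q\<in>V. K q = K p)"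
      by blast
  qed
  then show ?thesis
    using that by (auto simp: constant_on_def)
qed

lemma in_chart_induced: "in_chart c (induced X \<Phi> l0 l1) = induced X (\<lambda>l. in_chart c (\<Phi> l)) l0 l1"
  by (cases X) (simp_all add: in_chart_def fun_eq_iff)

lemma in_chart_dress: "in_chart c (dress R \<Phi> l) = (\<lambda>w. R l ** in_chart c (\<Phi> l) w)"
  by (simp add: in_chart_def dress_def fun_eq_iff)

locale lwr_setting =
  fixes S P :: "'a::t2_space set" and \<A> :: "'a chart set"
    and T :: "'b::t2_space set" and \<pi> :: "'b \<Rightarrow> 'a"
    and \<xi> :: "'a form_family" and l0 l1 :: complex
  assumes surface: "riemann_surface S \<A>" and potential: "lwr_potential S \<A> P \<xi>"
    and covering: "universal_covering T \<pi> (S - P)" and distinct: "l0 \<noteq> l1"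
begin

abbreviation "\<B> \<equiv> lifted_atlas T \<pi> \<A>"

sublocale complex_atlas T \<B>
  using lifted_complex_atlas[OF surface _ _ covering] potential by (simp add: lwr_potential_def)

lemma lwr_chart_exists:
  assumes c: "c \<in> \<B>"
  obtains a b where "\<And>\<Phi>. lwr_frame \<A> T \<pi> \<xi> \<Phi> \<Longrightarrow> lwr_chart (snd c ` fst c) (\<lambda>l. in_chart c (\<Phi> l)) a b"
proof -
  obtain c0 V where c0: "c = (V, snd c0 \<circ> \<pi>)" "c0 \<in> \<A>" "lifted_domain T \<pi> c0 V"
    using c unfolding lifted_atlas_def by blast
  have fc: "fst c = V" "snd c = snd c0 \<circ> \<pi>"
    using c0(1) by auto
  have VT: "V \<subseteq> T" and V: "\<pi> ` V \<subseteq> fst c0"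
    using chart_subset[OF c] c0 by (auto simp: lifted_domain_def)
  have "\<pi> ` T = S - P"
    using covering by (simp add: universal_covering_def covering_space_def)
  then have VP: "\<pi> p \<in> fst c0 - P" if "p \<in> V" for p
    using that VT V by blast
  obtain A B where AB: "holomorphic_mat_on (in_chart c0 A) (snd c0 ` (fst c0 - P))"
    "holomorphic_mat_on (in_chart c0 B) (snd c0 ` (fst c0 - P))"
    "\<And>p l. p \<in> fst c0 - P \<Longrightarrow> nilpotent_mat (A p) \<and> \<xi> l c0 p = cscale l (A p) + B p"
    using potential c0(2) unfolding lwr_potential_def by (metis (no_types, lifting))
  have tr: "trace (\<xi> l c0 p) = 0" if "p \<in> fst c0 - P" for l p
    using potential c0(2) that unfolding lwr_potential_def by blast
  have W: "snd c ` fst c \<subseteq> snd c0 ` (fst c0 - P)"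
    using VP by (auto simp: fc)
  have apply_c0: "in_chart c0 h (snd c p) = h (\<pi> p)" if "p \<in> V" for h :: "'a \<Rightarrow> mat2" and p
    using homeomorphism_apply1[OF riemann_surface_chart(3)[OF surface c0(2)]] VP[OF that]
    by (simp add: in_chart_def fc)
  have "lwr_chart (snd c ` fst c) (\<lambda>l. in_chart c (\<Phi> l)) (in_chart c0 A) (in_chart c0 B)"
    if \<Phi>: "lwr_frame \<A> T \<pi> \<xi> \<Phi>" for \<Phi>
  proof
    show "open (snd c ` fst c)"
      by (rule image_open[OF c])
    show "holomorphic_mat_on (in_chart c0 A) (snd c ` fst c)" "holomorphic_mat_on (in_chart c0 B) (snd c ` fst c)"
      using AB W holomorphic_mat_subset by blast+
    show "holomorphic_mat_on (in_chart c (\<Phi> l)) (snd c ` fst c)" for l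
      using \<Phi> c unfolding lwr_frame_def by blast
    have inv: "continuous_on (snd c ` fst c) (inv_into (fst c) (snd c))" "inv_into (fst c) (snd c) ` snd c ` fst c = fst c"
      using homeo[OF c] by (auto simp: homeomorphism_def)
    have "continuous_on (UNIV \<times> snd c ` fst c) (\<lambda>x. (\<lambda>(l, p). \<Phi> l p) (fst x, inv_into (fst c) (snd c) (snd x)))"
    proof (rule continuous_on_compose2[where g = "\<lambda>(l, p). \<Phi> l p" and t = "UNIV \<times> T"
          and f = "\<lambda>x. (fst x, inv_into (fst c) (snd c) (snd x))"])
      show "continuous_on (UNIV \<times> T) (\<lambda>(l, p). \<Phi> l p)"
        using \<Phi> by (simp add: lwr_frame_def)
      show "continuous_on (UNIV \<times> snd c ` fst c) (\<lambda>x. (fst x, inv_into (fst c) (snd c) (snd x)))"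
        by (intro continuous_on_Pair continuous_on_fst continuous_on_id continuous_on_compose2[OF inv(1)] continuous_on_snd) auto
      show "(\<lambda>x. (fst x, inv_into (fst c) (snd c) (snd x))) ` (UNIV \<times> snd c ` fst c) \<subseteq> UNIV \<times> T"
        using inv(2) VT fc by fastforce
    qed
    then show "continuous_on (UNIV \<times> snd c ` fst c) (\<lambda>(l, w). in_chart c (\<Phi> l) w)"
      by (simp add: in_chart_def case_prod_unfold)
  next
    fix w assume "w \<in> snd c ` fst c"
    then obtain p where p: "p \<in> fst c" "w = snd c p"
      by blast
    have pV: "p \<in> V" "p \<in> T"
      using p fc VT by auto
    show det1: "det (in_chart c (\<Phi> l) w) = 1" for l
      using \<Phi> pV c p by (simp add: in_chart_apply lwr_frame_def)
    show "holomorphic_mat_on (\<lambda>l. in_chart c (\<Phi> l) w) UNIV"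
      using \<Phi> pV(2) c p by (simp add: in_chart_apply lwr_frame_def)
    show "trace (in_chart c0 A w) = 0 \<and> det (in_chart c0 A w) = 0"
      using AB(3)[OF VP[OF pV(1)]] nilpotent_mat_2 p(2) apply_c0[OF pV(1)] by auto
    show "trace (in_chart c0 B w) = 0"
      using AB(3)[OF VP[OF pV(1)], of 0] tr[OF VP[OF pV(1)], of 0] p(2) apply_c0[OF pV(1)] by simp
    show "deriv_mat (in_chart c (\<Phi> l)) w = in_chart c (\<Phi> l) w ** (cscale l (in_chart c0 A w) + in_chart c0 B w)" for l
    proof -
      have "matrix_inv (\<Phi> l p) ** deriv_mat (in_chart (V, snd c0 \<circ> \<pi>) (\<Phi> l)) (snd c0 (\<pi> p)) = \<xi> l c0 (\<pi> p)"
        using \<Phi> c0 pV(1) unfolding lwr_frame_def by blast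
      then have 1: "matrix_inv (\<Phi> l p) ** deriv_mat (in_chart c (\<Phi> l)) w = \<xi> l c0 (\<pi> p)"
        using c0(1) p(2) by simp
      have d: "det (\<Phi> l p) = 1"
        using det1[of l] c p by (simp add: in_chart_apply)
      have "\<Phi> l p ** (adjugate (\<Phi> l p) ** deriv_mat (in_chart c (\<Phi> l)) w) = \<Phi> l p ** \<xi> l c0 (\<pi> p)"
        using 1 by (simp add: matrix_inv_eq_adjugate[OF d])
      then have "deriv_mat (in_chart c (\<Phi> l)) w = \<Phi> l p ** \<xi> l c0 (\<pi> p)"
        by (simp add: matrix_mul_assoc adjugate_cancel[OF d])
      then show ?thesis
        using AB(3)[OF VP[OF pV(1)], of l] p c apply_c0[OF pV(1)] by (simp add: in_chart_apply)
    qed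
  qed
  then show ?thesis
    using that by blast
qed

text \<open>A left factor that does not depend on the point cancels in \<open>\<Phi>\<^sup>-\<^sup>1 d\<Phi>\<close>.\<close>

lemma dress_frame:
  assumes \<Phi>: "lwr_frame \<A> T \<pi> \<xi> \<Phi>" and R: "dressing_matrix R"
  shows "lwr_frame \<A> T \<pi> \<xi> (dress R \<Phi>)"
  unfolding lwr_frame_def
proof (intro conjI allI ballI impI)
  have hR: "holomorphic_mat_on R UNIV" and dR: "\<And>l. det (R l) = 1"
    using R by (auto simp: dressing_matrix_def)
  show "det (dress R \<Phi> l p) = 1" if "p \<in> T" for l p
    using \<Phi> that dR by (simp add: dress_def det_mul lwr_frame_def)
  have "continuous_on (UNIV \<times> T) (\<lambda>x. R (fst x))"
    by (rule continuous_on_compose2[OF holomorphic_mat_continuous[OF hR open_UNIV]]) (auto intro: continuous_intros)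
  moreover have "continuous_on (UNIV \<times> T) (\<lambda>x. \<Phi> (fst x) (snd x))"
    using \<Phi> by (simp add: lwr_frame_def case_prod_unfold)
  ultimately show "continuous_on (UNIV \<times> T) (\<lambda>(l, p). dress R \<Phi> l p)"
    unfolding dress_def case_prod_unfold by (rule bounded_bilinear.continuous_on[OF bounded_bilinear_mat2_mult])
  show "holomorphic_mat_on (\<lambda>l. dress R \<Phi> l p) UNIV" if "p \<in> T" for p
    using \<Phi> that unfolding dress_def lwr_frame_def by (intro holomorphic_mat_mult hR) blast
  show hc: "holomorphic_mat_on (in_chart c (dress R \<Phi> l)) (snd c ` fst c)" if "c \<in> \<B>" for l c
    using \<Phi> that unfolding in_chart_dress lwr_frame_def by (intro holomorphic_mat_mult holomorphic_mat_const) blast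
  fix l c V p assume c: "c \<in> \<A>" "lifted_domain T \<pi> c V" and p: "p \<in> V"
  define c' where "c' = (V, snd c \<circ> \<pi>)"
  have c': "c' \<in> \<B>"
    using c unfolding lifted_atlas_def c'_def by blast
  have w: "snd c (\<pi> p) \<in> snd c' ` fst c'"
    using p by (auto simp: c'_def)
  have pT: "p \<in> T"
    using chart_subset[OF c'] p by (auto simp: c'_def)
  have h: "holomorphic_mat_on (in_chart c' (\<Phi> l)) (snd c' ` fst c')"
    using \<Phi> c' unfolding lwr_frame_def by blast
  have d: "det (\<Phi> l p) = 1"
    using \<Phi> pT by (simp add: lwr_frame_def)
  have "deriv_mat (in_chart c' (dress R \<Phi> l)) (snd c (\<pi> p)) = wz (\<lambda>w. R l ** in_chart c' (\<Phi> l) w) (snd c (\<pi> p))"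
    using holomorphic_mat_wirtinger(2)[OF hc[OF c'] image_open[OF c'] w] by (simp add: in_chart_dress)
  also have "\<dots> = R l ** deriv_mat (in_chart c' (\<Phi> l)) (snd c (\<pi> p))"
    using holomorphic_mat_wirtinger[OF h image_open[OF c'] w] by (simp add: wirtinger_mult)
  finally have "matrix_inv (dress R \<Phi> l p) ** deriv_mat (in_chart c' (dress R \<Phi> l)) (snd c (\<pi> p)) =
     matrix_inv (\<Phi> l p) ** deriv_mat (in_chart c' (\<Phi> l)) (snd c (\<pi> p))"
    by (simp add: dress_def matrix_inv_eq_adjugate det_mul d dR adjugate_mult matrix_mul_assoc adjugate_cancel[OF dR])
  also have "\<dots> = \<xi> l c (\<pi> p)"
    using \<Phi> c p unfolding lwr_frame_def c'_def by blast
  finally show "matrix_inv (dress R \<Phi> l p) ** deriv_mat (in_chart (V, snd c \<circ> \<pi>) (dress R \<Phi> l)) (snd c (\<pi> p)) = \<xi> l c (\<pi> p)"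
    by (simp add: c'_def)
qed

lemma induced_minimal_surface:
  assumes \<Phi>: "lwr_frame \<A> T \<pi> \<xi> \<Phi>" and imm: "immersion \<B> (induced X \<Phi> l0 l1)"
  shows "minimal_surface T \<B> X (induced X \<Phi> l0 l1)"
proof -
  let ?f = "induced X \<Phi> l0 l1"
  have conf: "conformal_immersion X \<B> ?f"
    unfolding conformal_immersion_def
  proof (intro conjI ballI imm)
    fix c p assume c: "c \<in> \<B>" "p \<in> fst c"
    obtain a b where L: "lwr_chart (snd c ` fst c) (\<lambda>l. in_chart c (\<Phi> l)) a b"
      using lwr_chart_exists[OF c(1)] \<Phi> by metis
    interpret L: lwr_chart "snd c ` fst c" "\<lambda>l. in_chart c (\<Phi> l)" a b l0 l1
      by (rule L)
    show "?f p \<in> ambient_space X"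
      using L.F_ambient[OF imageI[OF c(2)], of X] in_chart_apply[OF c, of ?f]
      by (simp only: in_chart_induced)
    show "minner (dz c ?f p) (dz c ?f p) = 0"
      unfolding dz_eq_wz in_chart_induced using lwr_chart.minner_F[OF L, of "snd c p"] c(2) by blast
  qed
  interpret conformal_surface T \<B> X ?f
    by unfold_locales (rule conf)
  show ?thesis
  proof
    show "minimal_or_cmc1 X \<B> ?f"
      unfolding minimal_or_cmc1_iff
    proof (intro ballI)
      fix c w assume c: "c \<in> \<B>" "w \<in> snd c ` fst c"
      obtain a b where L: "lwr_chart (snd c ` fst c) (\<lambda>l. in_chart c (\<Phi> l)) a b"
        using lwr_chart_exists[OF c(1)] \<Phi> by metis
      interpret L: lwr_chart "snd c ` fst c" "\<lambda>l. in_chart c (\<Phi> l)" a b l0 l1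
        by (rule L)
      have eq: "A c u = L.C u" if "u \<in> snd c ` fst c" for u
        using L.tangent_form_F[OF that] by (simp only: in_chart_induced)
      have "wzb (A c) w = wzb L.C w"
        by (rule wirtinger_cong(2)[OF image_open[OF c(1)] c(2)]) (rule eq)
      also have "\<dots> = 0"
        using holomorphic_mat_wirtinger(3)[OF L.C_holomorphic L.open_W c(2)] .
      finally show "wzb (A c) w = 0" .
    qed
  qed
qed

lemma tangent_form_dress:
  assumes \<Phi>: "lwr_frame \<A> T \<pi> \<xi> \<Phi>" and R: "dressing_matrix R"
    and c: "c \<in> \<B>" "w \<in> snd c ` fst c"
  shows "tangent_form X (in_chart c (induced X (dress R \<Phi>) l0 l1)) w =
    R l0 ** tangent_form X (in_chart c (induced X \<Phi> l0 l1)) w ** adjugate (R l0)"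
proof -
  obtain a b where L: "\<And>\<Phi>. lwr_frame \<A> T \<pi> \<xi> \<Phi> \<Longrightarrow> lwr_chart (snd c ` fst c) (\<lambda>l. in_chart c (\<Phi> l)) a b"
    using lwr_chart_exists[OF c(1)] by blast
  interpret L: lwr_chart "snd c ` fst c" "\<lambda>l. in_chart c (\<Phi> l)" a b l0 l1
    by (rule L[OF \<Phi>])
  interpret L': lwr_chart "snd c ` fst c" "\<lambda>l. in_chart c (dress R \<Phi> l)" a b l0 l1
    by (rule L[OF dress_frame[OF \<Phi> R]])
  have "L'.C w = R l0 ** L.C w ** adjugate (R l0)"
    unfolding L.C_def L'.C_def unfolding in_chart_dress by (simp add: adjugate_mult mat2_distribs matrix_mul_assoc)
  then show ?thesis
    by (simp only: in_chart_induced L.tangent_form_F[OF c(2)] L'.tangent_form_F[OF c(2)])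
qed

lemma immersion_dress:
  assumes \<Phi>: "lwr_frame \<A> T \<pi> \<xi> \<Phi>" and imm: "immersion \<B> (induced X \<Phi> l0 l1)" and R: "dressing_matrix R"
  shows "immersion \<B> (induced X (dress R \<Phi>) l0 l1)"
proof -
  interpret f: minimal_surface T \<B> X "induced X \<Phi> l0 l1"
    by (rule induced_minimal_surface[OF \<Phi> imm])
  show ?thesis
    unfolding immersion_def
  proof (intro ballI conjI allI)
    fix c n assume c: "c \<in> \<B>"
    obtain a b where L: "lwr_chart (snd c ` fst c) (\<lambda>l. in_chart c (dress R \<Phi> l)) a b"
      using lwr_chart_exists[OF c] dress_frame[OF \<Phi> R] by metis
    show "Ck_on n (in_chart c (induced X (dress R \<Phi>) l0 l1)) (snd c ` fst c)"
      unfolding in_chart_induced by (rule lwr_chart.F_smooth[OF L])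
    fix p assume p: "p \<in> fst c"
    then have w: "snd c p \<in> snd c ` fst c"
      by blast
    have "det (R l0) = 1"
      using R by (simp add: dressing_matrix_def)
    then have "tangent_form X (in_chart c (induced X (dress R \<Phi>) l0 l1)) (snd c p) \<noteq> 0"
      unfolding tangent_form_dress[OF \<Phi> R c w] using f.chart_nilpotent(3)[OF c w] by (simp add: conj_adjugate_eq_0_iff)
    then have "lwr_chart.C (\<lambda>l. in_chart c (dress R \<Phi> l)) a l0 l1 (snd c p) \<noteq> 0"
      unfolding in_chart_induced lwr_chart.tangent_form_F[OF L w] .
    then show "inj (frechet_derivative (in_chart c (induced X (dress R \<Phi>) l0 l1)) (at (snd c p)))"
      unfolding in_chart_induced by (rule lwr_chart.F_immersed[OF L w])
  qed
qed

theorem dressing_goursat: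
  assumes \<Phi>: "lwr_frame \<A> T \<pi> \<xi> \<Phi>" and imm: "immersion \<B> (induced X \<Phi> l0 l1)" and R: "dressing_matrix R"
  shows "goursat_related X \<B> (induced X \<Phi> l0 l1) (induced X (dress R \<Phi>) l0 l1)"
proof (rule goursat_related_of_conjugate)
  show "minimal_surface T \<B> X (induced X \<Phi> l0 l1)"
    by (rule induced_minimal_surface[OF \<Phi> imm])
  show "conformal_surface T \<B> X (induced X (dress R \<Phi>) l0 l1)"
    using induced_minimal_surface[OF dress_frame[OF \<Phi> R] immersion_dress[OF \<Phi> imm R]]
    by (simp add: minimal_surface_def)
  show "det (R l0) = 1"
    using R by (simp add: dressing_matrix_def)
qed (rule tangent_form_dress[OF \<Phi> R])

text \<open>Dressing by the constant \<open>C\<close> gives an immersion \<open>h\<close> with the same derivative as \<open>g\<close>. The difference is a constant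
  trace-free Hermitian matrix \<open>k\<close>, and changing \<open>R'(l0)\<close> by \<open>Y C\<close> translates the induced immersion by \<open>(l1 - l0) Y\<close> plus its
  adjoint.\<close>

lemma recover_Euclidean:
  assumes \<Phi>: "lwr_frame \<A> T \<pi> \<xi> \<Phi>" and imm: "immersion \<B> (induced Euclidean \<Phi> l0 l1)"
    and g: "minimal_surface T \<B> Euclidean g" and C: "det C = 1"
    and conj: "\<And>c w. c \<in> \<B> \<Longrightarrow> w \<in> snd c ` fst c \<Longrightarrow> tangent_form Euclidean (in_chart c g) w =
      C ** tangent_form Euclidean (in_chart c (induced Euclidean \<Phi> l0 l1)) w ** adjugate C"
  obtains R where "dressing_matrix R" "\<And>p. p \<in> T \<Longrightarrow> g p = induced Euclidean (dress R \<Phi>) l0 l1 p"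
proof -
  interpret g: minimal_surface T \<B> Euclidean g by fact
  have R0: "dressing_matrix (\<lambda>l. C)"
    using C by (simp add: dressing_matrix_def holomorphic_mat_const)
  define h where "h = induced Euclidean (dress (\<lambda>l. C) \<Phi>) l0 l1"
  interpret h: minimal_surface T \<B> Euclidean h
    unfolding h_def by (rule induced_minimal_surface[OF dress_frame[OF \<Phi> R0] immersion_dress[OF \<Phi> imm R0]])
  define K where "K p = g p + cscale (-1) (h p)" for p
  obtain k where k: "\<And>p. p \<in> T \<Longrightarrow> K p = k"
  proof (rule constant_of_wirtinger)
    fix c w assume c: "c \<in> \<B>" "w \<in> snd c ` fst c"
    interpret G: conformal_chart Euclidean "in_chart c g" "snd c ` fst c"
      by (rule g.chart[OF c(1)])
    interpret H: conformal_chart Euclidean "in_chart c h" "snd c ` fst c"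
      by (rule h.chart[OF c(1)])
    have Kc: "in_chart c K = (\<lambda>w. in_chart c g w + cscale (-1) (in_chart c h w))"
      by (simp add: K_def in_chart_def fun_eq_iff)
    have d: "in_chart c g differentiable at w" "(\<lambda>w. cscale (-1) (in_chart c h w)) differentiable at w"
      using G.F_differentiable[OF c(2)] H.F_differentiable[OF c(2)] mat2_differentiable by blast+
    have "wz (in_chart c g) w = wz (in_chart c h) w"
      using G.M_A[OF c(2)] H.M_A[OF c(2)] conj[OF c] tangent_form_dress[OF \<Phi> R0 c] by (simp add: h_def)
    then have "wz (in_chart c K) w = 0" "wzb (in_chart c K) w = 0"
      unfolding Kc wirtinger_add[OF d]
      using wirtinger_bounded_linear[OF bounded_linear_cscale H.F_differentiable[OF c(2)], of "-1"]
        G.wzb_F[OF c(2)] H.wzb_F[OF c(2)]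
      by (simp_all add: cscale_cscale) (simp_all add: mat2_simps)
    moreover have "in_chart c K differentiable at w"
      unfolding Kc by (rule differentiable_add[OF d])
    ultimately show "in_chart c K differentiable at w \<and> wz (in_chart c K) w = 0 \<and> wzb (in_chart c K) w = 0"
      by blast
  qed blast
  show ?thesis
  proof (cases "T = {}")
    case True
    then show ?thesis
      using that[OF R0] by simp
  next
    case False
    then obtain p0 c0 where p0: "p0 \<in> T" "c0 \<in> \<B>" "p0 \<in> fst c0"
      using cover by blast
    have "g p0 \<in> ambient_space Euclidean" "h p0 \<in> ambient_space Euclidean"
      using g.tangent[OF p0(2,3)] h.tangent[OF p0(2,3)] by (auto simp: tangent_direction_def)
    then have herm: "ctranspose k = k" and tr: "trace k = 0"
      using k[OF p0(1)] by (auto simp: K_def hermitian_def ctranspose_add ctranspose_cscale trace_add trace_cscale)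
    define Y where "Y = cscale (1 / (2 * (l1 - l0))) k"
    have half: "cscale (l1 - l0) Y = cscale (1/2) k"
    proof -
      have "(l1 - l0) * (1 / (2 * (l1 - l0))) = 1 / 2"
        using distinct by (simp add: field_simps)
      then show ?thesis
        by (simp only: Y_def cscale_cscale)
    qed
    have trY: "trace Y = 0"
      by (simp add: Y_def trace_cscale tr)
    obtain R where R: "dressing_matrix R" "R l0 = C" "deriv_mat R l0 = Y ** C"
      using exists_entire_with_derivative[OF C trY] by blast
    have "g p = induced Euclidean (dress R \<Phi>) l0 l1 p" if p: "p \<in> T" for p
    proof -
      have dp: "det (\<Phi> l p) = 1" for l
        using \<Phi> p by (simp add: lwr_frame_def)
      have hol: "holomorphic_mat_on (\<lambda>l. \<Phi> l p) UNIV" "holomorphic_mat_on R UNIV"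
        using \<Phi> p R(1) by (auto simp: lwr_frame_def dressing_matrix_def)
      note w = holomorphic_mat_wirtinger[OF _ open_UNIV UNIV_I]
      have prod: "deriv_mat (\<lambda>l. Q l ** \<Phi> l p) l0 = deriv_mat Q l0 ** \<Phi> l0 p + Q l0 ** deriv_mat (\<lambda>l. \<Phi> l p) l0"
        if "holomorphic_mat_on Q UNIV" for Q
        using w(2)[OF holomorphic_mat_mult[OF that hol(1)], of l0] wirtinger_mult(1)[OF w(1)[OF that] w(1)[OF hol(1)]]
        by (simp add: w(2)[OF that] w(2)[OF hol(1)])
      have "deriv_mat (\<lambda>l. C) l0 = 0"
        using w(2)[OF holomorphic_mat_const, of C l0] by simp
      note prod0 = prod[OF holomorphic_mat_const, of C, unfolded this]
      let ?D = "deriv_mat (\<lambda>l. \<Phi> l p) l0"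
      define \<psi>0 where "\<psi>0 = cscale (l1 - l0) (C ** ?D ** adjugate (C ** \<Phi> l0 p))"
      have hp: "h p = \<psi>0 + ctranspose \<psi>0"
        by (simp add: h_def dress_def Let_def prod0 matrix_inv_eq_adjugate det_mul C dp \<psi>0_def)
      have "cscale (l1 - l0) ((Y ** C ** \<Phi> l0 p + C ** ?D) ** adjugate (C ** \<Phi> l0 p)) = cscale (1/2) k + \<psi>0"
        by (simp add: mat2_add_rdistrib \<psi>0_def adjugate_mult matrix_mul_assoc adjugate_cancel[OF dp]
            adjugate_cancel[OF C] cscale_add half)
      then have "induced Euclidean (dress R \<Phi>) l0 l1 p = (cscale (1/2) k + \<psi>0) + ctranspose (cscale (1/2) k + \<psi>0)"
        by (simp add: dress_def Let_def prod[OF hol(2)] R matrix_inv_eq_adjugate det_mul C dp)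
      also have "\<dots> = k + h p"
        by (simp add: hp ctranspose_add ctranspose_cscale herm) (simp add: mat2_eq_iff cscale_entry)
      also have "\<dots> = g p"
        by (simp add: k[OF p, symmetric] K_def) (simp add: mat2_eq_iff cscale_entry)
      finally show ?thesis ..
    qed
    then show ?thesis
      using that R(1) by blast
  qed
qed

lemma wz_congruence:
  assumes "Q differentiable at w" "wzb Q w = 0" "G differentiable at w"
  shows "wz (\<lambda>w. ctranspose (Q w) ** G w ** Q w) w = ctranspose (Q w) ** (wz G w ** Q w + G w ** wz Q w)"
proof -
  have "ctranspose (0::mat2) = 0"
    by (simp add: mat2_simps)
  then show ?thesis
    using assms by (simp add: wirtinger_mult wirtinger_ctranspose mat2_differentiable mat2_add_ldistrib matrix_mul_assoc)
qed

text \<open>With \<open>\<Psi>\<close> the holomorphic factor of the first immersion and \<open>\<Theta> = C \<Psi>\<^sup>-\<^sup>1\<close>, the matrix \<open>\<Theta>\<^sup>* g \<Theta>\<close> has zero derivative. It is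
  a constant \<open>N\<^sup>* N\<close>, so \<open>g = (N \<Psi> C\<^sup>-\<^sup>1)\<^sup>* (N \<Psi> C\<^sup>-\<^sup>1)\<close>, which is induced after dressing with \<open>R(l0) = C\<close> and
  \<open>R(l1) = N\<close>.\<close>

lemma recover_Hyperbolic:
  assumes \<Phi>: "lwr_frame \<A> T \<pi> \<xi> \<Phi>"
    and g: "minimal_surface T \<B> Hyperbolic g" and C: "det C = 1"
    and conj: "\<And>c w. c \<in> \<B> \<Longrightarrow> w \<in> snd c ` fst c \<Longrightarrow> tangent_form Hyperbolic (in_chart c g) w =
      C ** tangent_form Hyperbolic (in_chart c (induced Hyperbolic \<Phi> l0 l1)) w ** adjugate C"
  obtains R where "dressing_matrix R" "\<And>p. p \<in> T \<Longrightarrow> g p = induced Hyperbolic (dress R \<Phi>) l0 l1 p"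
proof -
  interpret g: minimal_surface T \<B> Hyperbolic g by fact
  define \<Theta> where "\<Theta> p = C ** adjugate (\<Phi> l1 p ** adjugate (\<Phi> l0 p))" for p
  define K where "K p = ctranspose (\<Theta> p) ** g p ** \<Theta> p" for p
  obtain k where k: "\<And>p. p \<in> T \<Longrightarrow> K p = k"
  proof (rule constant_of_wirtinger)
    fix c w assume c: "c \<in> \<B>" "w \<in> snd c ` fst c"
    interpret G: conformal_chart Hyperbolic "in_chart c g" "snd c ` fst c"
      by (rule g.chart[OF c(1)])
    obtain a b where L: "lwr_chart (snd c ` fst c) (\<lambda>l. in_chart c (\<Phi> l)) a b"
      using lwr_chart_exists[OF c(1)] \<Phi> by metis
    interpret L: lwr_chart "snd c ` fst c" "\<lambda>l. in_chart c (\<Phi> l)" a b l0 l1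
      by (rule L)
    let ?\<Theta> = "\<lambda>w. C ** adjugate (L.\<Psi> w)" and ?G = "in_chart c g"
    have Kc: "in_chart c K = (\<lambda>w. ctranspose (?\<Theta> w) ** ?G w ** ?\<Theta> w)"
      unfolding L.\<Psi>_def by (simp only: K_def \<Theta>_def in_chart_def comp_def)
    have h\<Theta>: "holomorphic_mat_on ?\<Theta> (snd c ` fst c)"
      by (intro holomorphic_mat_mult holomorphic_mat_const holomorphic_mat_adjugate L.\<Psi>_holomorphic)
    note \<Theta>w = holomorphic_mat_wirtinger[OF h\<Theta> L.open_W c(2)]
    note dG = G.F_differentiable[OF c(2)]
    note d\<Psi> = holomorphic_mat_wirtinger(1)[OF L.\<Psi>_holomorphic L.open_W c(2)]
    have "adjugate (L.C w) = - L.C w"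
      using L.C_nilpotent[OF c(2)] by (intro adjugate_trace_free) simp
    then have wz\<Theta>: "wz ?\<Theta> w = - (C ** L.C w ** adjugate (L.\<Psi> w))"
      using d\<Psi> L.wz_\<Psi>[OF c(2)]
      by (simp add: wirtinger_mult mat2_differentiable wirtinger_bounded_linear[OF bounded_linear_adjugate _ adjugate_cscale]
          adjugate_mult mat2_mult_minus matrix_mul_assoc)
    have "tangent_form Hyperbolic ?G w = C ** L.C w ** adjugate C"
      using conj[OF c] L.tangent_form_F[OF c(2), of Hyperbolic] by (simp only: in_chart_induced)
    then have wzG: "wz ?G w = ?G w ** C ** L.C w ** adjugate C"
      using G.M_A[OF c(2)] by (simp add: matrix_mul_assoc)
    have wzK: "wz (in_chart c K) w = 0"
      unfolding Kc wz_congruence[OF \<Theta>w(1,3) dG] wz\<Theta> wzG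
      by (simp add: mat2_mult_minus matrix_mul_assoc adjugate_cancel[OF C])
    have dK: "in_chart c K differentiable at w"
      unfolding Kc using dG \<Theta>w(1) d\<Psi> by (intro mat2_differentiable) auto
    have "ctranspose (in_chart c K u) = in_chart c K u" if "u \<in> snd c ` fst c" for u
      unfolding Kc using G.hermitian_F[OF that] by (simp add: ctranspose_mult matrix_mul_assoc)
    then have "wzb (in_chart c K) w = wzb (\<lambda>u. ctranspose (in_chart c K u)) w"
      by (intro wirtinger_cong(2)[OF L.open_W c(2)]) simp
    also have "\<dots> = 0"
      using wirtinger_ctranspose(2)[OF dK] wzK by (simp add: mat2_simps)
    finally show "in_chart c K differentiable at w \<and> wz (in_chart c K) w = 0 \<and> wzb (in_chart c K) w = 0"
      using dK wzK by blast
  qed blast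
  have det\<Phi>: "det (\<Phi> l p) = 1" if "p \<in> T" for l p
    using \<Phi> that by (simp add: lwr_frame_def)
  have det\<Theta>: "det (\<Theta> p) = 1" if "p \<in> T" for p
    using that by (simp add: \<Theta>_def det_mul det_adjugate C det\<Phi>)
  show ?thesis
  proof (cases "T = {}")
    case True
    then show ?thesis
      using that[of "\<lambda>l. C"] C by (simp add: dressing_matrix_def holomorphic_mat_const)
  next
    case False
    then obtain p0 c0 where p0: "p0 \<in> T" "c0 \<in> \<B>" "p0 \<in> fst c0"
      using cover by blast
    have "g p0 \<in> ambient_space Hyperbolic"
      using g.tangent[OF p0(2,3)] by (simp add: tangent_direction_def)
    then obtain V where V: "det V = 1" "g p0 = V ** ctranspose V"
      using hermitian_factorization[of "g p0"] by auto
    define N where "N = ctranspose V ** \<Theta> p0"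
    have detN: "det N = 1"
      using V det\<Theta>[OF p0(1)] by (simp add: N_def det_mul det_ctranspose)
    have kN: "k = ctranspose N ** N"
      using k[OF p0(1)] by (simp add: K_def V N_def ctranspose_mult matrix_mul_assoc)
    obtain R where R: "dressing_matrix R" "R l0 = C" "R l1 = N"
      using exists_entire_interpolation[OF distinct C detN] by blast
    have "g p = induced Hyperbolic (dress R \<Phi>) l0 l1 p" if p: "p \<in> T" for p
    proof -
      let ?i = "adjugate (\<Theta> p)"
      note c = adjugate_cancel[OF det\<Theta>[OF p]]
      have dc: "det (ctranspose (\<Theta> p)) = 1"
        using det\<Theta>[OF p] by (simp add: det_ctranspose)
      have "ctranspose ?i ** K p ** ?i = g p"
        by (simp add: K_def matrix_mul_assoc c flip: adjugate_ctranspose) (simp add: adjugate_cancel[OF dc])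
      then have gp: "g p = ctranspose (N ** ?i) ** (N ** ?i)"
        by (simp add: k[OF p] kN ctranspose_mult matrix_mul_assoc)
      have "N ** ?i = (N ** \<Phi> l1 p) ** adjugate (C ** \<Phi> l0 p)"
        by (simp add: \<Theta>_def adjugate_mult matrix_mul_assoc)
      then show ?thesis
        unfolding gp by (simp add: dress_def Let_def R matrix_inv_eq_adjugate det_mul C det\<Phi>[OF p])
    qed
    then show ?thesis
      using that R(1) by blast
  qed
qed

theorem goursat_dressing:
  assumes \<Phi>: "lwr_frame \<A> T \<pi> \<xi> \<Phi>" and imm: "immersion \<B> (induced X \<Phi> l0 l1)"
    and nonflat: "\<not> flat X \<B> (induced X \<Phi> l0 l1)" and g: "goursat_related X \<B> (induced X \<Phi> l0 l1) g"
  obtains R where "dressing_matrix R" "\<And>p. p \<in> T \<Longrightarrow> g p = induced X (dress R \<Phi>) l0 l1 p"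
proof -
  have gs: "minimal_surface T \<B> X g"
    using g by unfold_locales (auto simp: goursat_related_def minimal_or_cmc1_def)
  have fs: "minimal_surface T \<B> X (induced X \<Phi> l0 l1)"
    by (rule induced_minimal_surface[OF \<Phi> imm])
  have "surface_pair T \<B> X (induced X \<Phi> l0 l1) g"
    using g by (intro surface_pair.intro fs gs surface_pair_axioms.intro) (auto simp: goursat_related_def)
  then obtain C where C: "det C = 1" "\<And>c w. c \<in> \<B> \<Longrightarrow> w \<in> snd c ` fst c \<Longrightarrow>
      tangent_form X (in_chart c g) w = C ** tangent_form X (in_chart c (induced X \<Phi> l0 l1)) w ** adjugate C"
    using surface_pair.conjugate[OF _ nonflat] by blast
  show ?thesis
  proof (cases X)
    case Euclidean
    show ?thesis
      by (rule recover_Euclidean[OF \<Phi> imm[unfolded Euclidean] gs[unfolded Euclidean] C[unfolded Euclidean]])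
        (auto intro: that[unfolded Euclidean])
  next
    case Hyperbolic
    show ?thesis
      by (rule recover_Hyperbolic[OF \<Phi> gs[unfolded Hyperbolic] C[unfolded Hyperbolic]])
        (auto intro: that[unfolded Hyperbolic])
  qed
qed

end

theorem theorem4p10:
  fixes S P :: "'a::t2_space set" and \<A> :: "'a chart set"
    and T :: "'b::t2_space set" and \<pi> :: "'b \<Rightarrow> 'a"
    and \<xi> :: "'a form_family" and \<Phi> :: "complex \<Rightarrow> 'b \<Rightarrow> mat2"
    and X :: ambient and l\<^sub>0 l\<^sub>1 :: complex
    and \<B> :: "'b chart set" and f :: "'b \<Rightarrow> mat2"
  assumes "riemann_surface S \<A>"
    and "lwr_potential S \<A> P \<xi>"
    and "universal_covering T \<pi> (S - P)"
    and "lwr_frame \<A> T \<pi> \<xi> \<Phi>"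
    and "l\<^sub>0 \<noteq> l\<^sub>1"
    and "\<B> = lifted_atlas T \<pi> \<A>"
    and "f = induced X \<Phi> l\<^sub>0 l\<^sub>1"
    and "immersion \<B> f"
  shows "(\<forall>R. dressing_matrix R \<longrightarrow>
            goursat_related X \<B> f (induced X (dress R \<Phi>) l\<^sub>0 l\<^sub>1)) \<and>
         (\<not> flat X \<B> f \<longrightarrow>
            (\<forall>f'. goursat_related X \<B> f f' \<longrightarrow>
               (\<exists>R. dressing_matrix R \<and> (\<forall>p\<in>T. f' p = induced X (dress R \<Phi>) l\<^sub>0 l\<^sub>1 p))))"
proof -
  interpret lwr_setting S P \<A> T \<pi> \<xi> l\<^sub>0 l\<^sub>1
    using assms(1-3,5) by unfold_locales
  note imm = assms(8)[unfolded assms(6,7)]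
  show ?thesis
    unfolding assms(6,7)
  proof (intro conjI allI impI)
    show "goursat_related X (lifted_atlas T \<pi> \<A>) (induced X \<Phi> l\<^sub>0 l\<^sub>1) (induced X (dress R \<Phi>) l\<^sub>0 l\<^sub>1)"
      if "dressing_matrix R" for R
      by (rule dressing_goursat[OF assms(4) imm that])
    show "\<exists>R. dressing_matrix R \<and> (\<forall>p\<in>T. g p = induced X (dress R \<Phi>) l\<^sub>0 l\<^sub>1 p)"
      if "\<not> flat X (lifted_atlas T \<pi> \<A>) (induced X \<Phi> l\<^sub>0 l\<^sub>1)"
        "goursat_related X (lifted_atlas T \<pi> \<A>) (induced X \<Phi> l\<^sub>0 l\<^sub>1) g" for g
      by (rule goursat_dressing[OF assms(4) imm that]) blast
  qed
qed

end
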